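(* The problem SteinerTree over definable structures is decidable: there is an algorithm which, given (finite presentations of) a definable graph $G=(V,E)$ and definable subsets $W\subseteq V$ and $F\subseteq E$, decides whether $G$ has a tree that spans all vertices from $W$ and uses only finitely many edges from $F$.
   Context: Fix a countably infinite set $\mathbb{A}$ of atoms and an infinite set of atom variables. An expression is either a variable or a formal finite (possibly empty) union of set-builder expressions $\{e \mid x_1,\dots,x_k\in\mathbb{A},\ \varphi\}$ (with $k\ge 0$), where $e$ is an expression, the $x_i$ are bound variables, and $\varphi$ is a first-order formula over the atom variables with equality as the only relation symbol (interpreted in $(\mathbb{A},=)$). An expression $e$ with set of free variables $V$, together with a valuation $\sigma:V\to\mathbb{A}$, has a value $e[\sigma]$, defined in the obvious way by induction on $e$, which is an atom or a set; the sets arising this way are called definable. Pairs, tuples, integers, constants, disjoint unions etc. are encoded by standard set-theoretic means (e.g. $(x,y)=\{x,\{x,y\}\}$). A definable set is presented to an algorithm as a pair $(e,\sigma)$. A definable graph is a definable pair $G=(V,E)$ where $E$ is a set of two-element subsets of $V$ (undirected). A tree in $G$ is a connected acyclic subgraph, possibly infinite and not required to be definable; it spans $W$ if it contains every vertex of $W$. *)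

theory Defs
  imports "HOL-Library.Countable_Set_Type" "HOL-Library.Nat_Bijection"
begin

text \<open>Atoms and atom variables are represented by natural numbers, so that they can be handed
  to an algorithm.  All atoms are alike for the formulas below, which only know equality.\<close>

type_synonym atom = nat
type_synonym var = nat


section \<open>Hereditarily countable sets with atoms\<close>

text \<open>Since there are countably many atoms, the value of every set expression is a countable
  set, and so are its elements that are sets.\<close>

datatype val = Atm atom | St "val cset"

definition upair :: "val \<Rightarrow> val \<Rightarrow> val" where
  "upair x y = St (cinsert x (cinsert y cempty))"

text \<open>The ordered pair is encoded as \<open>{x, {x, y}}\<close>.\<close>

definition vpair :: "val \<Rightarrow> val \<Rightarrow> val" where
  "vpair x y = upair x (upair x y)"


section \<open>Expressions and definable sets\<close>

text \<open>First-order formulas over \<open>(\<bbbA>, =)\<close>; the remaining connectives and the universal quantifier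
  are expressible.\<close>

datatype fm = Eq var var | Neg fm | Conj fm fm | Ex var fm

primrec sat :: "fm \<Rightarrow> (var \<Rightarrow> atom) \<Rightarrow> bool" where
  "sat (Eq x y) \<sigma> \<longleftrightarrow> \<sigma> x = \<sigma> y"
| "sat (Neg \<phi>) \<sigma> \<longleftrightarrow> \<not> sat \<phi> \<sigma>"
| "sat (Conj \<phi> \<psi>) \<sigma> \<longleftrightarrow> sat \<phi> \<sigma> \<and> sat \<psi> \<sigma>"
| "sat (Ex x \<phi>) \<sigma> \<longleftrightarrow> (\<exists>a. sat \<phi> (\<sigma>(x := a)))"

primrec fv_fm :: "fm \<Rightarrow> var set" where
  "fv_fm (Eq x y) = {x, y}"
| "fv_fm (Neg \<phi>) = fv_fm \<phi>"
| "fv_fm (Conj \<phi> \<psi>) = fv_fm \<phi> \<union> fv_fm \<psi>"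
| "fv_fm (Ex x \<phi>) = fv_fm \<phi> - {x}"

text \<open>\<open>Builder e [x\<^sub>1, \<dots>, x\<^sub>k] \<phi>\<close> stands for \<open>{e | x\<^sub>1, \<dots>, x\<^sub>k \<in> \<bbbA>, \<phi>}\<close>.\<close>

datatype expr = EVar var | EUnion "builder list"
  and builder = Builder expr "var list" fm

fun fv :: "expr \<Rightarrow> var set" and fv_builder :: "builder \<Rightarrow> var set" where
  "fv (EVar x) = {x}"
| "fv (EUnion bs) = (\<Union>b\<in>set bs. fv_builder b)"
| "fv_builder (Builder e xs \<phi>) = (fv e \<union> fv_fm \<phi>) - set xs"

fun eval :: "expr \<Rightarrow> (var \<Rightarrow> atom) \<Rightarrow> val"
  and elems :: "builder \<Rightarrow> (var \<Rightarrow> atom) \<Rightarrow> val set" where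
  "eval (EVar x) \<sigma> = Atm (\<sigma> x)"
| "eval (EUnion bs) \<sigma> = St (acset (\<Union>b\<in>set bs. elems b \<sigma>))"
| "elems (Builder e xs \<phi>) \<sigma> = {eval e \<tau> | \<tau>. (\<forall>y. y \<notin> set xs \<longrightarrow> \<tau> y = \<sigma> y) \<and> sat \<phi> \<tau>}"

text \<open>The abstraction \<open>acset\<close> is only meaningful on countable sets, which is what it gets here.\<close>

lemma countable_elems: "countable (elems b \<sigma>)"
proof (cases b)
  case (Builder e xs \<phi>)
  let ?upd = "\<lambda>as y. case map_of (zip xs as) y of None \<Rightarrow> \<sigma> y | Some a \<Rightarrow> a"
  have upd: "\<tau> = ?upd (map \<tau> xs)" if "\<forall>y. y \<notin> set xs \<longrightarrow> \<tau> y = \<sigma> y" for \<tau>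
  proof
    fix y
    show "\<tau> y = ?upd (map \<tau> xs) y"
      using that by (cases "y \<in> set xs") (simp_all add: map_of_zip_map)
  qed
  have "elems b \<sigma> \<subseteq> (\<lambda>as. eval e (?upd as)) ` UNIV"
  proof
    fix v assume "v \<in> elems b \<sigma>"
    then obtain \<tau> where "v = eval e \<tau>" "\<forall>y. y \<notin> set xs \<longrightarrow> \<tau> y = \<sigma> y"
      unfolding Builder elems.simps by blast
    with upd[of \<tau>] have "v = eval e (?upd (map \<tau> xs))" by metis
    then show "v \<in> (\<lambda>as. eval e (?upd as)) ` UNIV" by (rule image_eqI) (rule UNIV_I)
  qed
  moreover have "countable ((\<lambda>as. eval e (?upd as)) ` UNIV)"
    by (rule countable_image) (rule countableI_type)
  ultimately show ?thesis
    by (rule countable_subset)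
qed

lemma rcset_acset_elems: "rcset (acset (\<Union>b\<in>set bs. elems b \<sigma>)) = (\<Union>b\<in>set bs. elems b \<sigma>)"
  by (simp add: acset_inverse countable_UN countable_finite countable_elems)


section \<open>Finite presentations\<close>

text \<open>The valuation of the free variables is given as an association list.\<close>

type_synonym presentation = "expr \<times> (var \<times> atom) list"

definition presents :: "presentation \<Rightarrow> val \<Rightarrow> bool" where
  "presents p v \<longleftrightarrow> (case p of (e, \<sigma>) \<Rightarrow>
     distinct (map fst \<sigma>) \<and> set (map fst \<sigma>) = fv e \<and> eval e (\<lambda>x. the (map_of \<sigma> x)) = v)"

primrec code_fm :: "fm \<Rightarrow> nat" where
  "code_fm (Eq x y) = list_encode [0, x, y]"
| "code_fm (Neg \<phi>) = list_encode [1, code_fm \<phi>]"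
| "code_fm (Conj \<phi> \<psi>) = list_encode [2, code_fm \<phi>, code_fm \<psi>]"
| "code_fm (Ex x \<phi>) = list_encode [3, x, code_fm \<phi>]"

fun code_expr :: "expr \<Rightarrow> nat" and code_builder :: "builder \<Rightarrow> nat" where
  "code_expr (EVar x) = list_encode [0, x]"
| "code_expr (EUnion bs) = list_encode (1 # map code_builder bs)"
| "code_builder (Builder e xs \<phi>) = list_encode [code_expr e, list_encode xs, code_fm \<phi>]"

definition code_presentation :: "presentation \<Rightarrow> nat" where
  "code_presentation p =
     (case p of (e, \<sigma>) \<Rightarrow> prod_encode (code_expr e, list_encode (map prod_encode \<sigma>)))"


section \<open>Algorithms\<close>

text \<open>\<open>recursive n f\<close>: the restriction of \<open>f\<close> to lists of length \<open>n\<close> is a total recursive function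
  of \<open>n\<close> arguments.  Minimisation is only applied where it is everywhere defined.\<close>

inductive recursive :: "nat \<Rightarrow> (nat list \<Rightarrow> nat) \<Rightarrow> bool" where
  zero: "recursive n (\<lambda>_. 0)"
| succ: "recursive 1 (\<lambda>xs. Suc (xs ! 0))"
| proj: "i < n \<Longrightarrow> recursive n (\<lambda>xs. xs ! i)"
| comp: "recursive (length gs) f \<Longrightarrow> (\<forall>g\<in>set gs. recursive n g) \<Longrightarrow>
    recursive n (\<lambda>xs. f (map (\<lambda>g. g xs) gs))"
| prim_rec: "recursive n f \<Longrightarrow> recursive (Suc (Suc n)) g \<Longrightarrow>
    recursive (Suc n) (\<lambda>xs. rec_nat (f (tl xs)) (\<lambda>k r. g (k # r # tl xs)) (hd xs))"
| minim: "recursive (Suc n) f \<Longrightarrow> (\<forall>xs. length xs = n \<longrightarrow> (\<exists>y. f (y # xs) = 0)) \<Longrightarrow>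
    recursive n (\<lambda>xs. LEAST y. f (y # xs) = 0)"


section \<open>Graphs and trees\<close>

definition is_graph :: "val set \<Rightarrow> val set \<Rightarrow> bool" where
  "is_graph V E \<longleftrightarrow> (\<forall>d\<in>E. \<exists>u\<in>V. \<exists>v\<in>V. u \<noteq> v \<and> d = upair u v)"

definition is_subgraph :: "val set \<Rightarrow> val set \<Rightarrow> val set \<Rightarrow> val set \<Rightarrow> bool" where
  "is_subgraph V' E' V E \<longleftrightarrow> V' \<subseteq> V \<and> E' \<subseteq> E \<and> is_graph V' E'"

definition connected_graph :: "val set \<Rightarrow> val set \<Rightarrow> bool" where
  "connected_graph V E \<longleftrightarrow> (\<forall>u\<in>V. \<forall>v\<in>V. (u, v) \<in> {(x, y). upair x y \<in> E}\<^sup>*)"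

definition is_cycle :: "val set \<Rightarrow> val list \<Rightarrow> bool" where
  "is_cycle E c \<longleftrightarrow> 3 \<le> length c \<and> distinct c \<and>
     (\<forall>i<length c. upair (c ! i) (c ! (Suc i mod length c)) \<in> E)"

definition acyclic_graph :: "val set \<Rightarrow> bool" where
  "acyclic_graph E \<longleftrightarrow> \<not> (\<exists>c. is_cycle E c)"

text \<open>The graph \<open>(T, D)\<close> is a tree in \<open>(V, E)\<close>; the empty tree is admitted.\<close>

definition is_tree_in :: "val set \<Rightarrow> val set \<Rightarrow> val set \<Rightarrow> val set \<Rightarrow> bool" where
  "is_tree_in T D V E \<longleftrightarrow> is_subgraph T D V E \<and> connected_graph T D \<and> acyclic_graph D"

definition has_steiner_tree :: "val set \<Rightarrow> val set \<Rightarrow> val set \<Rightarrow> val set \<Rightarrow> bool" where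
  "has_steiner_tree V E W F \<longleftrightarrow> (\<exists>T D. is_tree_in T D V E \<and> W \<subseteq> T \<and> finite (D \<inter> F))"

end

(* A tree in G that spans W with finitely many edges from F exists iff W lies in one component of G
   and meets only finitely many components of (V, E - F): finitely many paths join these components,
   and a breadth-first tree of the result is as required.

   Atoms are only compared for equality, so expressions with fewer than M variables have the same
   equalities and memberships whether the bound variables range over all atoms or only over
   N = 8 M + 8 of them, and by moving intermediate vertices with permutations of atoms the same holds
   for connectivity.  If every w in W that uses the first N atoms is connected to some w' in W that
   avoids the last of these atoms, then permutations remove one atom after the other from any vertex
   of W, so that finitely many components remain; conversely, if there are finitely many components,
   two of the copies of w with this atom replaced by a fresh one are connected, and renaming the
   fresh atoms gives such a w'. *)

theory Submission
  imports Defs "HOL-Combinatorics.Transposition"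
begin

text \<open>Reachability is not first-order, so eliminating quantifiers over the atoms would not
  decide it. It is computed outright in a finite structure, and the comparison with all atoms has to
  be made for paths, whose length and whose number of atoms are unbounded. What saves the argument
  is that only a bounded number of values is considered at a time, each depending on at most
  \<open>M\<close> atoms: a permutation that fixes the atoms of the three inputs
  (\<open>3 * M\<close>) and of the two ends of a path (\<open>2 * M\<close>) and moves the last
  inner vertex together with its edge (\<open>2 * M\<close>) needs room for \<open>7 * M\<close>
  atoms. The bound \<open>N\<close> leaves some slack above this, and room for the atom
  \<open>N - 1\<close>, which the inputs are made to avoid.

  The second obstacle is that vertices are nested sets whose equality has itself to be decided.
  Finite sets are therefore represented by canonical numbers, equal exactly when the values are
  equal.\<close>

section \<open>Computable functions of environments\<close>

text \<open>A function of finitely many arguments is written as a function of an environment \<open>x\<close>, whose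
  \<open>i\<close>-th argument is \<open>x i\<close>.  The arity is left implicit.  A binder such as a bounded quantifier
  shifts the environment.\<close>

definition computable :: "((nat \<Rightarrow> nat) \<Rightarrow> nat) \<Rightarrow> bool" where
  "computable f \<longleftrightarrow> (\<exists>n g. recursive n g \<and> (\<forall>x. g (map x [0..<n]) = f x))"

definition decidable :: "((nat \<Rightarrow> nat) \<Rightarrow> bool) \<Rightarrow> bool" where
  "decidable P \<longleftrightarrow> computable (\<lambda>x. of_bool (P x))"

text \<open>Composition with projections makes a function ignore additional arguments. Witnesses can
  thus be brought to a common larger arity, which is what allows the arity to stay implicit.\<close>

lemma recursive_weaken:
  assumes "recursive n g" "n \<le> m"
  shows "\<exists>g'. recursive m g' \<and> (\<forall>x. g' (map x [0..<m]) = g (map x [0..<n]))"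
proof -
  let ?gs = "map (\<lambda>i (xs :: nat list). xs ! i) [0..<n]"
  have "recursive m (\<lambda>xs. g (map (\<lambda>h. h xs) ?gs))"
    using assms by (intro recursive.comp) (auto intro: recursive.proj)
  moreover have "g (map (\<lambda>h. h (map x [0..<m])) ?gs) = g (map x [0..<n])" for x
  proof -
    have "map (\<lambda>h. h (map x [0..<m])) ?gs = map x [0..<n]"
      using assms(2) by (auto intro!: nth_equalityI)
    then show ?thesis by (rule arg_cong)
  qed
  ultimately show ?thesis by blast
qed

lemma computable_large:
  assumes "computable f"
  obtains n where "\<And>m. n \<le> m \<Longrightarrow> \<exists>g. recursive m g \<and> (\<forall>x. g (map x [0..<m]) = f x)"
  using assms recursive_weaken unfolding computable_def by (metis (no_types, lifting))

text \<open>The witness of \<open>F\<close> reads only \<open>n\<close> entries of its environment,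
  so that only finitely many of the functions \<open>G i\<close> matter and a common arity exists
  for them.\<close>

lemma computable_subst:
  assumes F: "computable F" and G: "\<And>i. computable (G i)"
  shows "computable (\<lambda>x. F (\<lambda>i. G i x))"
proof -
  obtain n g where g: "recursive n g" "\<And>x. g (map x [0..<n]) = F x"
    using F unfolding computable_def by blast
  have "\<forall>i. \<exists>b. \<forall>m\<ge>b. \<exists>g. recursive m g \<and> (\<forall>x. g (map x [0..<m]) = G i x)"
    using G computable_large by metis
  then obtain b where b: "\<And>i m. b i \<le> m \<Longrightarrow> \<exists>g. recursive m g \<and> (\<forall>x. g (map x [0..<m]) = G i x)"
    by metis
  define m where "m = (\<Sum>i<n. b i)"
  have "\<forall>i<n. \<exists>g. recursive m g \<and> (\<forall>x. g (map x [0..<m]) = G i x)"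
    unfolding m_def by (auto intro!: b member_le_sum)
  then obtain h where h: "\<And>i. i < n \<Longrightarrow> recursive m (h i)"
      "\<And>i x. i < n \<Longrightarrow> h i (map x [0..<m]) = G i x"
    by metis
  have "recursive m (\<lambda>xs. g (map (\<lambda>k. k xs) (map h [0..<n])))"
    using g h by (intro recursive.comp) auto
  moreover have "g (map (\<lambda>k. k (map x [0..<m])) (map h [0..<n])) = F (\<lambda>i. G i x)" for x
  proof -
    have "map (\<lambda>k. k (map x [0..<m])) (map h [0..<n]) = map (\<lambda>i. G i x) [0..<n]"
      by (auto simp: h(2))
    then show ?thesis using g(2) by metis
  qed
  ultimately show ?thesis unfolding computable_def by blast
qed

lemma computable_var: "computable (\<lambda>x. x i)"
  unfolding computable_def
  by (rule exI[of _ "Suc i"], rule exI[of _ "\<lambda>xs. xs ! i"])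
    (use recursive.proj[of i "Suc i"] in \<open>auto simp: nth_append simp del: upt_Suc\<close>)

lemma computable_Suc' : "computable (\<lambda>x. Suc (x 0))"
  unfolding computable_def
  by (rule exI[of _ 1], rule exI[of _ "\<lambda>xs. Suc (xs ! 0)"]) (use recursive.succ in auto)

lemma computable_0: "computable (\<lambda>x. 0)"
  unfolding computable_def using recursive.zero[of 0] by (intro exI[of _ 0]) auto

lemma computable1:
  "computable (\<lambda>x. F (x 0)) \<Longrightarrow> computable f \<Longrightarrow> computable (\<lambda>x. F (f x))"
  using computable_subst[of "\<lambda>x. F (x 0)" "\<lambda>_. f"] by simp

lemma computable_list:
  assumes "computable F" "\<forall>g\<in>set gs. computable g"
  shows "computable (\<lambda>x. F (\<lambda>i. if i < length gs then (gs ! i) x else 0))"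
proof (rule computable_subst[where G = "\<lambda>i x. if i < length gs then (gs ! i) x else 0", OF assms(1)])
  show "computable (\<lambda>x. if i < length gs then (gs ! i) x else 0)" for i
    using assms(2) computable_0 by (cases "i < length gs") simp_all
qed

text \<open>A binder shifts the environment, under which arbitrary arguments \<open>f x\<close> and
  \<open>g x\<close> would have to be shifted too. It is simpler to prove computability for
  variables once and to substitute the arguments afterwards.\<close>

lemma computable2:
  "computable (\<lambda>x. F (x 0) (x 1)) \<Longrightarrow> computable f \<Longrightarrow> computable g \<Longrightarrow> computable (\<lambda>x. F (f x) (g x))"
  using computable_list[of "\<lambda>x. F (x 0) (x 1)" "[f, g]"] by simp

lemma computable3:
  "computable (\<lambda>x. F (x 0) (x 1) (x 2)) \<Longrightarrow> computable f \<Longrightarrow> computable g \<Longrightarrow> computable h \<Longrightarrow>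
   computable (\<lambda>x. F (f x) (g x) (h x))"
  using computable_list[of "\<lambda>x. F (x 0) (x 1) (x 2)" "[f, g, h]"] by (simp add: numeral_2_eq_2)

lemma computable4:
  "computable (\<lambda>x. F (x 0) (x 1) (x 2) (x 3)) \<Longrightarrow> computable f \<Longrightarrow> computable g \<Longrightarrow> computable h \<Longrightarrow>
   computable k \<Longrightarrow> computable (\<lambda>x. F (f x) (g x) (h x) (k x))"
  using computable_list[of "\<lambda>x. F (x 0) (x 1) (x 2) (x 3)" "[f, g, h, k]"]
  by (simp add: numeral_2_eq_2 numeral_3_eq_3)

lemma computable5:
  "computable (\<lambda>x. F (x 0) (x 1) (x 2) (x 3) (x 4)) \<Longrightarrow> computable f \<Longrightarrow> computable g \<Longrightarrow>
   computable h \<Longrightarrow> computable k \<Longrightarrow> computable l \<Longrightarrow>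
   computable (\<lambda>x. F (f x) (g x) (h x) (k x) (l x))"
  using computable_list[of "\<lambda>x. F (x 0) (x 1) (x 2) (x 3) (x 4)" "[f, g, h, k, l]"]
  by (simp add: numeral_eq_Suc)

lemma decidable2:
  "decidable (\<lambda>x. F (x 0) (x 1)) \<Longrightarrow> computable f \<Longrightarrow> computable g \<Longrightarrow> decidable (\<lambda>x. F (f x) (g x))"
  unfolding decidable_def by (rule computable2)

lemma computable_Suc: "computable f \<Longrightarrow> computable (\<lambda>x. Suc (f x))"
  using computable1[OF computable_Suc'] .

lemma computable_const: "computable (\<lambda>x. k)"
  by (induction k) (auto intro: computable_0 computable_Suc)

text \<open>In the step function, argument \<open>0\<close> is the counter and argument \<open>1\<close> the previous value.\<close>

lemma computable_rec_nat:
  assumes a: "computable a" and b: "computable (\<lambda>z. b (z 0) (z 1) (\<lambda>i. z (Suc (Suc i))))"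
    and n: "computable n"
  shows "computable (\<lambda>x. rec_nat (a x) (\<lambda>k r. b k r x) (n x))"
proof -
  obtain m1 where m1: "\<And>m. m1 \<le> m \<Longrightarrow> \<exists>g. recursive m g \<and> (\<forall>x. g (map x [0..<m]) = a x)"
    using computable_large[OF a] by blast
  obtain m2 where m2: "\<And>m. m2 \<le> m \<Longrightarrow> \<exists>g. recursive m g \<and>
      (\<forall>x. g (map x [0..<m]) = b (x 0) (x 1) (\<lambda>i. x (Suc (Suc i))))"
    using computable_large[OF b] by blast
  define m where "m = max m1 m2"
  obtain f where f: "recursive m f" "\<And>x. f (map x [0..<m]) = a x"
    using m1[of m] unfolding m_def by auto
  have "m2 \<le> Suc (Suc m)" unfolding m_def by simp
  then obtain g where g: "recursive (Suc (Suc m)) g"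
      "\<And>x. g (map x [0..<Suc (Suc m)]) = b (x 0) (x 1) (\<lambda>i. x (Suc (Suc i)))"
    using m2 by blast
  have up: "map z [0..<Suc k] = z 0 # map (\<lambda>i. z (Suc i)) [0..<k]" for z :: "nat \<Rightarrow> nat" and k
    by (simp add: map_upt_Suc del: upt_Suc)
  have g': "g (k # r # map x [0..<m]) = b k r x" for k r x
    using g(2)[of "case_nat k (case_nat r x)"] by (simp add: up del: upt_Suc)
  let ?g = "\<lambda>xs. rec_nat (f (tl xs)) (\<lambda>k r. g (k # r # tl xs)) (hd xs)"
  have "?g (map z [0..<Suc m]) = rec_nat (a (\<lambda>i. z (Suc i))) (\<lambda>k r. b k r (\<lambda>i. z (Suc i))) (z 0)" for z
    unfolding up list.sel f(2) g' ..
  with recursive.prim_rec[OF f(1) g(1)]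
  have c: "computable (\<lambda>z. rec_nat (a (\<lambda>i. z (Suc i))) (\<lambda>k r. b k r (\<lambda>i. z (Suc i))) (z 0))"
    unfolding computable_def by blast
  have "computable (case i of 0 \<Rightarrow> n | Suc j \<Rightarrow> \<lambda>x. x j)" for i
    using n by (cases i) (simp_all add: computable_var)
  from computable_subst[where G = "\<lambda>i. case i of 0 \<Rightarrow> n | Suc j \<Rightarrow> \<lambda>x. x j", OF c this]
  show ?thesis by simp
qed

lemma computable_minim:
  assumes f: "computable (\<lambda>z. f (z 0) (\<lambda>i. z (Suc i)))" and ex: "\<And>x. \<exists>y. f y x = 0"
  shows "computable (\<lambda>x. LEAST y. f y x = 0)"
proof -
  obtain m where m: "\<And>n. m \<le> n \<Longrightarrow> \<exists>g. recursive n g \<and> (\<forall>x. g (map x [0..<n]) = f (x 0) (\<lambda>i. x (Suc i)))"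
    using computable_large[OF f] by blast
  obtain g where g: "recursive (Suc m) g" "\<And>x. g (map x [0..<Suc m]) = f (x 0) (\<lambda>i. x (Suc i))"
    using m[of "Suc m"] by auto
  have g': "g (y # map x [0..<m]) = f y x" for x y
    using g(2)[of "case_nat y x"] by (simp add: map_upt_Suc del: upt_Suc)
  have "\<exists>y. g (y # xs) = 0" if "length xs = m" for xs
  proof -
    have "xs = map ((!) xs) [0..<m]" using that map_nth by metis
    then show ?thesis using ex[of "(!) xs"] g' by metis
  qed
  then have "recursive m (\<lambda>xs. LEAST y. g (y # xs) = 0)"
    using recursive.minim[OF g(1)] by blast
  moreover have "(LEAST y. g (y # map x [0..<m]) = 0) = (LEAST y. f y x = 0)" for x
    by (simp only: g')
  ultimately show ?thesis
    unfolding computable_def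
    by (intro exI[of _ m] exI[of _ "\<lambda>xs. LEAST y. g (y # xs) = 0"]) simp
qed

lemma computable_of_bool: "decidable P \<Longrightarrow> computable (\<lambda>x. of_bool (P x))"
  unfolding decidable_def .

lemma computable_Least:
  assumes "decidable (\<lambda>z. P (z 0) (\<lambda>i. z (Suc i)))" "\<And>x. \<exists>y. P y x"
  shows "computable (\<lambda>x. LEAST y. P y x)"
proof -
  \<comment> \<open>Minimisation looks for a zero, so the truth value is negated, by a recursion
    that maps 0 to 1 and successors to 0.\<close>
  have "computable (\<lambda>z. rec_nat 1 (\<lambda>k r. 0) (of_bool (P (z 0) (\<lambda>i. z (Suc i)))))"
    by (intro computable_rec_nat computable_of_bool computable_const assms(1))
  then have "computable (\<lambda>x. LEAST y. rec_nat (1 :: nat) (\<lambda>k r. 0) (of_bool (P y x)) = 0)"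
    by (rule computable_minim) (use assms(2) in force)
  moreover have "rec_nat (1 :: nat) (\<lambda>k r. 0) (of_bool Q) = 0 \<longleftrightarrow> Q" for Q
    by (cases Q) simp_all
  ultimately show ?thesis by simp
qed

lemma computable_add:
  assumes "computable f" "computable g" shows "computable (\<lambda>x. f x + g x)"
proof -
  have "computable (\<lambda>x. rec_nat (f x) (\<lambda>k r. Suc r) (g x))"
    using assms by (intro computable_rec_nat computable_Suc computable_var)
  moreover have "rec_nat m (\<lambda>k r. Suc r) n = m + n" for m n by (induction n) auto
  ultimately show ?thesis by simp
qed

lemma computable_mult:
  assumes "computable f" "computable g" shows "computable (\<lambda>x. f x * g x)"
proof -
  have "computable (\<lambda>x. x 0 * x 1)"
  proof -
    have "computable (\<lambda>x. rec_nat 0 (\<lambda>k r. r + x 0) (x 1))"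
      by (intro computable_rec_nat[where b = "\<lambda>k r x. r + x 0"] computable_add computable_var computable_const)
    moreover have "rec_nat 0 (\<lambda>k r. r + m) n = m * n" for m n :: nat by (induction n) auto
    ultimately show ?thesis by simp
  qed
  then show ?thesis using assms by (rule computable2)
qed

lemma computable_power:
  assumes "computable f" "computable g" shows "computable (\<lambda>x. f x ^ g x)"
proof -
  have "computable (\<lambda>x. x 0 ^ x 1)"
  proof -
    have "computable (\<lambda>x. rec_nat 1 (\<lambda>k r. r * x 0) (x 1))"
      by (intro computable_rec_nat[where b = "\<lambda>k r x. r * x 0"] computable_mult computable_var computable_const)
    moreover have "rec_nat 1 (\<lambda>k r. r * m) n = m ^ n" for m n :: nat by (induction n) auto
    ultimately show ?thesis by simp
  qed
  then show ?thesis using assms by (rule computable2)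
qed

lemma computable_diff:
  assumes "computable f" "computable g" shows "computable (\<lambda>x. f x - g x)"
proof -
  have pred: "computable (\<lambda>x. x 0 - 1)"
  proof -
    have "computable (\<lambda>x. rec_nat 0 (\<lambda>k r. k) (x 0))"
      by (intro computable_rec_nat computable_var computable_const)
    moreover have "rec_nat 0 (\<lambda>k r. k) n = n - 1" for n :: nat by (cases n) auto
    ultimately show ?thesis by simp
  qed
  have "computable (\<lambda>x. rec_nat (f x) (\<lambda>k r. r - 1) (g x))"
    using assms by (intro computable_rec_nat computable1[OF pred] computable_var)
  moreover have "rec_nat m (\<lambda>k r. r - 1) n = m - n" for m n :: nat by (induction n) auto
  ultimately show ?thesis by simp
qed

lemma of_bool_not: "of_bool (\<not> P) = (1 :: nat) - of_bool P" by simp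

lemma decidable_Not: "decidable P \<Longrightarrow> decidable (\<lambda>x. \<not> P x)"
  unfolding decidable_def of_bool_not by (intro computable_diff computable_const)

lemma decidable_conj: "decidable P \<Longrightarrow> decidable Q \<Longrightarrow> decidable (\<lambda>x. P x \<and> Q x)"
  unfolding decidable_def of_bool_conj by (rule computable_mult)

lemma disj_not_not: "P \<or> Q \<longleftrightarrow> \<not> (\<not> P \<and> \<not> Q)" by blast

lemma decidable_disj: "decidable P \<Longrightarrow> decidable Q \<Longrightarrow> decidable (\<lambda>x. P x \<or> Q x)"
  unfolding disj_not_not by (intro decidable_Not decidable_conj)

lemma decidable_imp: "decidable P \<Longrightarrow> decidable Q \<Longrightarrow> decidable (\<lambda>x. P x \<longrightarrow> Q x)"
  unfolding imp_conv_disj by (intro decidable_disj decidable_Not)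

lemma decidable_less:
  assumes "computable f" "computable g" shows "decidable (\<lambda>x. f x < g x)"
proof -
  have "computable (\<lambda>x. rec_nat 0 (\<lambda>k r. 1) (g x - f x))"
    using assms by (intro computable_rec_nat computable_diff computable_const)
  moreover have "rec_nat 0 (\<lambda>k r. 1) (n - m) = (of_bool (m < n) :: nat)" for m n :: nat
    by (cases "n - m") auto
  ultimately show ?thesis unfolding decidable_def by simp
qed

lemma decidable_le:
  assumes "computable f" "computable g" shows "decidable (\<lambda>x. f x \<le> g x)"
  using decidable_Not[OF decidable_less[OF assms(2,1)]] by (simp add: not_less)

lemma decidable_eq:
  assumes "computable f" "computable g" shows "decidable (\<lambda>x. f x = g x)"
  unfolding eq_iff[of "_ :: nat"] using assms by (intro decidable_conj decidable_le)

text \<open>An unbounded search for \<open>y\<close> becomes total by also stopping at the bound;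
  the quantifier holds iff the search stops before it.\<close>

lemma decidable_ex:
  assumes "computable b" "decidable (\<lambda>z. P (z 0) (\<lambda>i. z (Suc i)))"
  shows "decidable (\<lambda>x. \<exists>y<b x. P y x)"
proof -
  have "computable (\<lambda>z. b (\<lambda>i. z (Suc i)))"
    using computable_subst[where G = "\<lambda>i z. z (Suc i)", OF assms(1) computable_var] .
  from decidable_disj[OF assms(2) decidable_le[OF this computable_var]]
  have "computable (\<lambda>x. LEAST y. P y x \<or> b x \<le> y)"
    by (rule computable_Least) blast
  then have "decidable (\<lambda>x. (LEAST y. P y x \<or> b x \<le> y) < b x)"
    using assms(1) by (rule decidable_less)
  moreover have "(LEAST y. P y x \<or> b x \<le> y) < b x \<longleftrightarrow> (\<exists>y<b x. P y x)" for x
  proof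
    assume "(LEAST y. P y x \<or> b x \<le> y) < b x"
    moreover have "P (LEAST y. P y x \<or> b x \<le> y) x \<or> b x \<le> (LEAST y. P y x \<or> b x \<le> y)"
      by (rule LeastI_ex) auto
    ultimately show "\<exists>y<b x. P y x" by auto
  next
    assume "\<exists>y<b x. P y x"
    then obtain y where "y < b x" "P y x" by blast
    moreover from this have "(LEAST y. P y x \<or> b x \<le> y) \<le> y" by (intro Least_le) simp
    ultimately show "(LEAST y. P y x \<or> b x \<le> y) < b x" by simp
  qed
  ultimately show ?thesis by simp
qed

lemma decidable_all:
  assumes "computable b" "decidable (\<lambda>z. P (z 0) (\<lambda>i. z (Suc i)))"
  shows "decidable (\<lambda>x. \<forall>y<b x. P y x)"
proof -
  have "decidable (\<lambda>x. \<not> (\<exists>y<b x. \<not> P y x))"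
    by (rule decidable_Not, rule decidable_ex, rule assms, rule decidable_Not, rule assms)
  then show ?thesis by simp
qed

lemma computable_if:
  assumes "decidable P" "computable f" "computable g"
  shows "computable (\<lambda>x. if P x then f x else g x)"
proof -
  have "computable (\<lambda>x. of_bool (P x) * f x + of_bool (\<not> P x) * g x)"
    using assms by (intro computable_add computable_mult computable_of_bool decidable_Not)
  moreover have "of_bool (P x) * f x + of_bool (\<not> P x) * g x = (if P x then f x else g x)" for x
    by simp
  ultimately show ?thesis by simp
qed

lemma decidable_if:
  assumes "decidable P" "decidable Q" "decidable R"
  shows "decidable (\<lambda>x. if P x then Q x else R x)"
  unfolding if_bool_eq_conj using assms by (intro decidable_conj decidable_imp decidable_Not)

lemma computable_div:
  assumes "computable f" "computable g" shows "computable (\<lambda>x. f x div g x)"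
proof -
  have ex: "\<exists>q. n = 0 \<or> m < n + q * n" for m n :: nat
    by (rule exI[of _ m], cases n) auto
  have "computable (\<lambda>x. if x 1 = 0 then 0 else LEAST q. x 1 = 0 \<or> x 0 < Suc q * x 1)"
    by (intro computable_if computable_Least decidable_disj decidable_eq decidable_less computable_mult
        computable_Suc computable_var computable_const) (use ex in simp)
  moreover have "(if n = 0 then 0 else LEAST q. n = 0 \<or> m < Suc q * n) = m div n" for m n :: nat
  proof (cases "n = 0")
    case False
    have "(LEAST q. n = 0 \<or> m < Suc q * n) = m div n"
    proof (rule Least_equality)
      show "n = 0 \<or> m < Suc (m div n) * n"
        using dividend_less_div_times[of n m] False by simp
      show "m div n \<le> q" if "n = 0 \<or> m < Suc q * n" for q
        using that False less_mult_imp_div_less[of m "Suc q" n] by simp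
    qed
    then show ?thesis using False by simp
  qed simp
  ultimately have "computable (\<lambda>x. x 0 div x 1)" by (simp only:)
  then show ?thesis using assms by (rule computable2)
qed

lemma computable_mod:
  assumes "computable f" "computable g" shows "computable (\<lambda>x. f x mod g x)"
  unfolding minus_mult_div_eq_mod[symmetric] using assms by (intro computable_diff computable_mult computable_div)

text \<open>Fixes the arity at last: the witness of unknown arity \<open>m\<close> is composed with
  projections, and with the zero function for arguments from \<open>n\<close> on, whichever of the
  two arities is larger.\<close>

lemma recursive_computable:
  assumes "computable f"
  shows "\<exists>g. recursive n g \<and> (\<forall>x. (\<forall>i\<ge>n. x i = 0) \<longrightarrow> g (map x [0..<n]) = f x)"
proof -
  obtain m g where g: "recursive m g" "\<And>x. g (map x [0..<m]) = f x"
    using assms unfolding computable_def by blast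
  let ?gs = "map (\<lambda>i (xs :: nat list). if i < n then xs ! i else 0) [0..<m]"
  have "recursive n (\<lambda>xs. if i < n then xs ! i else 0)" for i
    by (cases "i < n") (auto intro: recursive.proj recursive.zero)
  then have "recursive n (\<lambda>xs. g (map (\<lambda>h. h xs) ?gs))"
    using g(1) by (intro recursive.comp) auto
  moreover have "g (map (\<lambda>h. h (map x [0..<n])) ?gs) = f x" if "\<forall>i\<ge>n. x i = 0" for x
  proof -
    have "map (\<lambda>h. h (map x [0..<n])) ?gs = map x [0..<m]"
      using that by (auto intro!: nth_equalityI)
    then show ?thesis using g(2) by metis
  qed
  ultimately show ?thesis by blast
qed

lemmas computable_intros = computable_var computable_const computable_Suc computable_add computable_mult
  computable_power computable_diff computable_div computable_mod computable_if computable_of_bool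
  decidable_Not decidable_conj decidable_disj decidable_imp decidable_less decidable_le decidable_eq
  decidable_ex decidable_all decidable_if

section \<open>Arithmetic of codes\<close>

lemma computable_prod_encode:
  assumes "computable f" "computable g" shows "computable (\<lambda>x. prod_encode (f x, g x))"
  unfolding prod_encode_def triangle_def split by (intro computable_intros assms)

lemma computable_fst_prod_decode:
  assumes "computable f" shows "computable (\<lambda>x. fst (prod_decode (f x)))"
proof -
  have dec: "\<exists>a b. b < Suc n \<and> prod_encode (a, b) = n" for n
    by (metis le_imp_less_Suc le_prod_encode_2 prod.collapse prod_decode_inverse)
  have "computable (\<lambda>x. LEAST a. \<exists>b<Suc (x 0). prod_encode (a, b) = x 0)"
    by (intro computable_Least computable_intros computable_prod_encode) (rule dec)
  moreover have "(LEAST a. \<exists>b<Suc n. prod_encode (a, b) = n) = fst (prod_decode n)" for n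
    by (rule Least_equality) (metis dec fst_conv prod_encode_inverse, force)
  ultimately have "computable (\<lambda>x. fst (prod_decode (x 0)))" by (simp only:)
  then show ?thesis using assms by (rule computable1)
qed

lemma computable_snd_prod_decode:
  assumes "computable f" shows "computable (\<lambda>x. snd (prod_decode (f x)))"
proof -
  have dec: "\<exists>b a. a < Suc n \<and> prod_encode (a, b) = n" for n
    by (metis le_imp_less_Suc le_prod_encode_1 prod.collapse prod_decode_inverse)
  have "computable (\<lambda>x. LEAST b. \<exists>a<Suc (x 0). prod_encode (a, b) = x 0)"
    by (intro computable_Least computable_intros computable_prod_encode) (rule dec)
  moreover have "(LEAST b. \<exists>a<Suc n. prod_encode (a, b) = n) = snd (prod_decode n)" for n
    by (rule Least_equality) (metis dec snd_conv prod_encode_inverse, force)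
  ultimately have "computable (\<lambda>x. snd (prod_decode (x 0)))" by (simp only:)
  then show ?thesis using assms by (rule computable1)
qed

text \<open>\<open>dig N t\<close> is the valuation coded by \<open>t\<close>: its base-\<open>N\<close> digits.\<close>

definition dig :: "nat \<Rightarrow> nat \<Rightarrow> nat \<Rightarrow> nat" where
  "dig N t i = t div N ^ i mod N"

lemma dig_less: "0 < N \<Longrightarrow> dig N t i < N"
  unfolding dig_def by simp

text \<open>Turns the quantifier over valuations of the variables below \<open>M\<close> by atoms
  below \<open>N\<close> into a bounded quantifier over numbers.\<close>

lemma ex_dig:
  assumes "\<And>y. y < M \<Longrightarrow> \<tau> y < N"
  shows "\<exists>t<N ^ M. \<forall>y<M. dig N t y = \<tau> y"
  using assms
proof (induction M)
  case (Suc M)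
  then obtain t where t: "t < N ^ M" "\<forall>y<M. dig N t y = \<tau> y" by auto
  have N: "\<tau> M < N" using Suc.prems by simp
  define u where "u = t + \<tau> M * N ^ M"
  have "u < N ^ M + \<tau> M * N ^ M" unfolding u_def using t by simp
  also have "\<dots> = Suc (\<tau> M) * N ^ M" by simp
  also have "\<dots> \<le> N * N ^ M" using N by (intro mult_le_mono1) simp
  finally have "u < N ^ Suc M" by simp
  moreover have "dig N u y = \<tau> y" if "y < Suc M" for y
  proof (cases "y = M")
    case True
    then show ?thesis unfolding dig_def u_def using t N by simp
  next
    case False
    then have "y < M" using that by simp
    then obtain k where k: "M = y + Suc k" using less_iff_Suc_add[of y M] by auto
    have "u = t + (\<tau> M * N ^ k * N) * N ^ y"
      unfolding u_def k by (simp add: power_add mult_ac)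
    then have "u div N ^ y = t div N ^ y + \<tau> M * N ^ k * N"
      using N by simp
    then show ?thesis using t that False unfolding dig_def by simp
  qed
  ultimately show ?case by blast
qed simp

lemma computable_dig:
  "computable f \<Longrightarrow> computable g \<Longrightarrow> computable h \<Longrightarrow> computable (\<lambda>x. dig (f x) (g x) (h x))"
  unfolding dig_def by (intro computable_intros)

text \<open>A nonempty list is coded by the successor of a pair, hence the predecessor. On the code
  0 of the empty list both functions return 0, so reading past the end of a list yields 0.\<close>

definition hd_code :: "nat \<Rightarrow> nat" where "hd_code c = fst (prod_decode (c - 1))"
definition tl_code :: "nat \<Rightarrow> nat" where "tl_code c = snd (prod_decode (c - 1))"
definition drop_code :: "nat \<Rightarrow> nat \<Rightarrow> nat" where "drop_code c i = rec_nat c (\<lambda>_. tl_code) i"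
definition nth_code :: "nat \<Rightarrow> nat \<Rightarrow> nat" where "nth_code c i = hd_code (drop_code c i)"

lemma prod_decode_0: "prod_decode 0 = (0, 0)"
  using prod_encode_inverse[of "(0, 0)"] by (simp add: prod_encode_def)

lemma tl_code: "list_decode (tl_code c) = tl (list_decode c)"
  unfolding tl_code_def by (cases c) (simp_all add: prod_decode_0 split: prod.split)

lemma drop_code: "list_decode (drop_code c i) = drop i (list_decode c)"
  unfolding drop_code_def by (induction i) (simp_all add: tl_code drop_Suc tl_drop)

lemma hd_code: "list_decode c \<noteq> [] \<Longrightarrow> hd_code c = hd (list_decode c)"
  unfolding hd_code_def by (cases c) (simp_all split: prod.split)

lemma nth_code: "i < length (list_decode c) \<Longrightarrow> nth_code c i = list_decode c ! i"
  unfolding nth_code_def by (subst hd_code) (simp_all add: drop_code hd_drop_conv_nth)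

lemma list_decode_less: "b \<in> set (list_decode c) \<Longrightarrow> b < c"
proof (induction c rule: list_decode.induct)
  case (2 n)
  obtain x y where xy: "prod_decode n = (x, y)" by (cases "prod_decode n")
  then have n: "n = prod_encode (x, y)" by (metis prod_decode_inverse)
  have "x \<le> n" "y \<le> n" unfolding n by (rule le_prod_encode_1, rule le_prod_encode_2)
  then show ?case using 2 xy by (auto simp: less_Suc_eq_le dest: less_imp_le)
qed simp

lemma length_list_decode: "length (list_decode c) \<le> c"
proof (induction c rule: list_decode.induct)
  case (2 n)
  obtain x y where xy: "prod_decode n = (x, y)" by (cases "prod_decode n")
  then have n: "n = prod_encode (x, y)" by (metis prod_decode_inverse)
  have "y \<le> n" unfolding n by (rule le_prod_encode_2)
  then show ?case using 2 xy by auto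
qed simp

lemma nth_code_0: "nth_code 0 i = 0"
proof -
  have "drop_code 0 i = 0" using drop_code[of 0 i] by (metis drop_Nil list_decode.simps(1) list_decode_eq)
  then show ?thesis unfolding nth_code_def hd_code_def by (simp add: prod_decode_0)
qed

text \<open>Descent for recursions on codes. It covers every index, because an entry past the end is
  0, and thus also numbers that code no expression.\<close>

lemma nth_code_less: "c \<noteq> 0 \<Longrightarrow> nth_code c i < c"
proof (cases "i < length (list_decode c)")
  case True
  then show ?thesis by (simp add: nth_code list_decode_less)
next
  case False
  then have "list_decode (drop_code c i) = list_decode 0" by (simp add: drop_code)
  then have "drop_code c i = 0" by (simp only: list_decode_eq)
  then have "nth_code c i = 0" unfolding nth_code_def hd_code_def by (simp add: prod_decode_0)
  then show "c \<noteq> 0 \<Longrightarrow> nth_code c i < c" by simp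
qed

lemma computable_hd_code: "computable f \<Longrightarrow> computable (\<lambda>x. hd_code (f x))"
  unfolding hd_code_def by (intro computable_intros computable_fst_prod_decode)

lemma computable_tl_code: "computable f \<Longrightarrow> computable (\<lambda>x. tl_code (f x))"
  unfolding tl_code_def by (intro computable_intros computable_snd_prod_decode)

lemma computable_drop_code: "computable f \<Longrightarrow> computable g \<Longrightarrow> computable (\<lambda>x. drop_code (f x) (g x))"
  unfolding drop_code_def by (intro computable_rec_nat computable_tl_code computable_var)

lemma computable_nth_code: "computable f \<Longrightarrow> computable g \<Longrightarrow> computable (\<lambda>x. nth_code (f x) (g x))"
  unfolding nth_code_def by (intro computable_hd_code computable_drop_code)

lemma decidable_in_list:
  assumes "computable f" "computable g" shows "decidable (\<lambda>x. f x \<in> set (list_decode (g x)))"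
proof -
  have "b \<in> set (list_decode c) \<longleftrightarrow> (\<exists>i<c. drop_code c i \<noteq> 0 \<and> nth_code c i = b)" for b c
  proof -
    have "drop_code c i \<noteq> 0 \<longleftrightarrow> i < length (list_decode c)" for i
      using drop_code[of c i] by (metis drop_eq_Nil list_decode.simps(1) list_decode_eq not_le)
    then show ?thesis
      using length_list_decode[of c] by (auto simp: in_set_conv_nth nth_code intro: less_le_trans)
  qed
  then have "decidable (\<lambda>x. x 0 \<in> set (list_decode (x 1)))"
    by (simp only:) (intro computable_intros computable_drop_code computable_nth_code)
  then show ?thesis using assms by (rule decidable2)
qed

section \<open>Finite sets of numbers coded by their binary digits\<close>

lemma set_decode_less: "v \<in> set_decode s \<Longrightarrow> v < s"
proof -
  assume "v \<in> set_decode s"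
  then have "s div 2 ^ v \<noteq> 0" unfolding set_decode_def by (auto intro!: Nat.gr0I)
  then have "2 ^ v \<le> s" by (simp add: div_eq_0_iff)
  then show "v < s" using less_exp[of v] by (rule less_le_trans[rotated])
qed

lemma decidable_in_set_decode:
  assumes "computable f" "computable g" shows "decidable (\<lambda>x. f x \<in> set_decode (g x))"
proof -
  have "v \<in> set_decode s \<longleftrightarrow> s div 2 ^ v mod 2 = 1" for v s
    unfolding set_decode_def by (simp add: odd_iff_mod_2_eq_one)
  then show ?thesis by (simp only:) (intro computable_intros assms)
qed

lemma set_decode_Least:
  assumes "finite X" "P (set_encode X)" "\<And>s. P s \<Longrightarrow> X \<subseteq> set_decode s"
  shows "set_decode (LEAST s. P s) = X"
proof -
  have "(LEAST s. P s) = set_encode X"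
  proof (intro Least_equality subset_decode_imp_le)
    show "set_decode (set_encode X) \<subseteq> set_decode s" if "P s" for s
      using assms(1) assms(3)[OF that] by simp
  qed (rule assms(2))
  then show ?thesis using assms(1) by simp
qed

text \<open>Hereditarily finite sets with atoms are coded by numbers: the atom \<open>a\<close> by \<open>2 * a\<close> and a set by
  \<open>2 * s + 1\<close>, where the binary digits of \<open>s\<close> indicate the codes of the elements.\<close>

definition mem :: "nat \<Rightarrow> nat \<Rightarrow> bool" where
  "mem v s \<longleftrightarrow> odd s \<and> v \<in> set_decode (s div 2)"

lemma mem_less: "mem v s \<Longrightarrow> v < s"
  unfolding mem_def using set_decode_less[of v "s div 2"] by auto

lemma mem_set: "mem v (2 * s + 1) \<longleftrightarrow> v \<in> set_decode s"
  unfolding mem_def by simp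

lemma mem_ext:
  assumes "odd s" "odd s'" "\<And>v. mem v s \<longleftrightarrow> mem v s'" shows "s = s'"
proof -
  have "set_decode (s div 2) = set_decode (s' div 2)" using assms unfolding mem_def by blast
  then have "s div 2 = s' div 2" by (metis set_decode_inverse)
  then show ?thesis using assms(1,2) by (metis odd_two_times_div_two_succ)
qed

lemma decidable_mem: "computable f \<Longrightarrow> computable g \<Longrightarrow> decidable (\<lambda>x. mem (f x) (g x))"
  unfolding mem_def odd_iff_mod_2_eq_one by (intro computable_intros decidable_in_set_decode)

section \<open>Course-of-values recursion on codes\<close>

definition tab :: "nat \<Rightarrow> nat \<Rightarrow> nat \<Rightarrow> nat" where
  "tab T c t = nth_code T (prod_encode (c, t))"

text \<open>\<open>G h c t N M\<close> computes the value at the code \<open>c\<close> and the valuation \<open>t < N ^ M\<close> from the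
  values \<open>h\<close> at smaller codes.  The recursion is carried out by searching for a table of values.\<close>

type_synonym stepfun = "(nat \<Rightarrow> nat \<Rightarrow> nat) \<Rightarrow> nat \<Rightarrow> nat \<Rightarrow> nat \<Rightarrow> nat \<Rightarrow> nat"

definition below :: "stepfun \<Rightarrow> bool" where
  "below G \<longleftrightarrow> (\<forall>h h' c t N M. t < N ^ M \<longrightarrow> (\<forall>c'<c. \<forall>t'<N ^ M. h c' t' = h' c' t') \<longrightarrow>
     G h c t N M = G h' c t N M)"

definition cov :: "stepfun \<Rightarrow> nat \<Rightarrow> nat \<Rightarrow> nat \<Rightarrow> nat \<Rightarrow> nat" where
  "cov G c t N M = tab (LEAST T. \<forall>c'<Suc c. \<forall>t'<N ^ M. tab T c' t' = G (tab T) c' t' N M) c t"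

context
  fixes G :: stepfun
  assumes below: "below G"
begin

lemma G_cong:
  "t < N ^ M \<Longrightarrow> (\<And>c' t'. c' < c \<Longrightarrow> t' < N ^ M \<Longrightarrow> h c' t' = h' c' t') \<Longrightarrow> G h c t N M = G h' c t N M"
  using below unfolding below_def by blast

text \<open>\<open>cov\<close> searches for a table anew for every code. That these tables agree
  where both are correct is what turns the search into the recursion equation
  \<open>cov_eq\<close>.\<close>

lemma table_unique:
  assumes "\<forall>c'<n. \<forall>t'<N ^ M. h c' t' = G h c' t' N M" "\<forall>c'<n'. \<forall>t'<N ^ M. h' c' t' = G h' c' t' N M"
    "c < n" "c < n'" "t < N ^ M"
  shows "h c t = h' c t"
  using assms(3-5)
proof (induction c arbitrary: t rule: less_induct)
  case (less c)
  have "h c t = G h c t N M" using assms(1) less.prems by blast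
  also have "\<dots> = G h' c t N M" using less by (intro G_cong) auto
  also have "\<dots> = h' c t" using assms(2) less.prems by simp
  finally show ?case .
qed

lemma table_exists: "\<exists>h. \<forall>c'<n. \<forall>t'<N ^ M. h c' t' = G h c' t' N M"
proof (induction n)
  case (Suc n)
  then obtain h where "\<forall>c'<n. \<forall>t'<N ^ M. h c' t' = G h c' t' N M" by (rule exE)
  then have h: "\<And>c' t'. c' < n \<Longrightarrow> t' < N ^ M \<Longrightarrow> h c' t' = G h c' t' N M" by simp
  let ?h = "h(n := \<lambda>t. G h n t N M)"
  have "?h c' t' = G ?h c' t' N M" if "c' < Suc n" "t' < N ^ M" for c' t'
  proof -
    have "G ?h c' t' N M = G h c' t' N M" using that by (intro G_cong) auto
    then show ?thesis using h that by (cases "c' = n") auto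
  qed
  then show ?case by blast
qed simp

lemma tab_exists: "\<exists>T. \<forall>c'<n. \<forall>t'<N ^ M. tab T c' t' = G (tab T) c' t' N M"
proof -
  obtain h where "\<forall>c'<n. \<forall>t'<N ^ M. h c' t' = G h c' t' N M"
    using table_exists[of n N M] by (rule exE)
  then have h: "\<And>c' t'. c' < n \<Longrightarrow> t' < N ^ M \<Longrightarrow> h c' t' = G h c' t' N M" by simp
  have "finite (prod_encode ` ({..<n} \<times> {..<N ^ M}))" by simp
  then obtain B where "\<forall>i\<in>prod_encode ` ({..<n} \<times> {..<N ^ M}). i < B"
    unfolding finite_nat_set_iff_bounded by blast
  then have B: "prod_encode (c, t) < B" if "c < n" "t < N ^ M" for c t using that by auto
  define T where "T = list_encode (map (\<lambda>i. case prod_decode i of (c, t) \<Rightarrow> h c t) [0..<B])"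
  have T: "tab T c t = h c t" if "c < n" "t < N ^ M" for c t
    using B[OF that] unfolding tab_def T_def by (subst nth_code) simp_all
  have "tab T c t = G (tab T) c t N M" if ct: "c < n" "t < N ^ M" for c t
  proof -
    have "G h c t N M = G (tab T) c t N M" using T ct by (intro G_cong) auto
    then show ?thesis using T h ct by simp
  qed
  then show ?thesis by blast
qed

lemma cov_eq:
  assumes "t < N ^ M"
  shows "cov G c t N M = G (\<lambda>c' t'. cov G c' t' N M) c t N M"
proof -
  let ?T = "\<lambda>c. LEAST T. \<forall>c'<Suc c. \<forall>t'<N ^ M. tab T c' t' = G (tab T) c' t' N M"
  have T: "\<forall>c'<Suc c. \<forall>t'<N ^ M. tab (?T c) c' t' = G (tab (?T c)) c' t' N M" for c
    by (rule LeastI_ex) (rule tab_exists)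
  have "cov G c t N M = G (tab (?T c)) c t N M" unfolding cov_def using T assms by blast
  also have "\<dots> = G (\<lambda>c' t'. cov G c' t' N M) c t N M"
    using assms
  proof (rule G_cong)
    fix c' t' assume "c' < c" "t' < N ^ M"
    then show "tab (?T c) c' t' = cov G c' t' N M"
      unfolding cov_def by (intro table_unique[OF T T]) auto
  qed
  finally show ?thesis .
qed

lemma computable_cov:
  assumes G: "computable (\<lambda>x. G (tab (x 4)) (x 0) (x 1) (x 2) (x 3))"
    and "computable f" "computable g" "computable h" "computable k"
  shows "computable (\<lambda>x. cov G (f x) (g x) (h x) (k x))"
proof -
  note G' = computable5[where F = "\<lambda>c t N M T. G (tab T) c t N M", OF G]
  have "computable (\<lambda>x. cov G (x 0) (x 1) (x 2) (x 3))"
    unfolding cov_def tab_def[where T = "LEAST T. _ T"]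
    apply (intro computable_nth_code computable_prod_encode computable_var computable_Least)
     apply (intro decidable_all decidable_eq G' computable_intros)
     apply (unfold tab_def)[1]
     apply (intro computable_nth_code computable_prod_encode computable_var)
    apply (rule tab_exists)
    done
  then show ?thesis using assms(2-) by (rule computable4)
qed

end

section \<open>Evaluation with finitely many atoms\<close>

text \<open>The bound \<open>B\<close> for the atoms of the listed variables is separate from
  \<open>N\<close>: evaluation takes both equal, and only the test for finitely many components
  takes \<open>B = N - 1\<close>.\<close>

definition ext :: "nat \<Rightarrow> nat \<Rightarrow> nat \<Rightarrow> nat \<Rightarrow> nat \<Rightarrow> nat \<Rightarrow> bool" where
  "ext N M B l t t' \<longleftrightarrow>
     (\<forall>y<M. if y \<in> set (list_decode l) then dig N t' y < B else dig N t' y = dig N t y)"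

lemma decidable_ext:
  "computable n \<Longrightarrow> computable m \<Longrightarrow> computable b \<Longrightarrow> computable f \<Longrightarrow> computable g \<Longrightarrow> computable h \<Longrightarrow>
   decidable (\<lambda>x. ext (n x) (m x) (b x) (f x) (g x) (h x))"
proof -
  have "computable (\<lambda>x. of_bool (ext (x 0) (x 1) (x 2) (x 3) (x 4) (x 5)))"
    unfolding ext_def by (intro computable_intros computable_dig decidable_in_list)
  then have "computable (\<lambda>z. of_bool (ext (z 0) (z 1) (z 2) (z 3) (z 4) (z 5)))" .
  from computable_list[OF this, of "[n, m, b, f, g, h]"]
  show "computable n \<Longrightarrow> computable m \<Longrightarrow> computable b \<Longrightarrow> computable f \<Longrightarrow> computable g \<Longrightarrow> computable h \<Longrightarrow>
    ?thesis"
    unfolding decidable_def by (simp add: numeral_eq_Suc)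
qed

text \<open>The tags are those of \<open>code_fm\<close>. Every tag above 2 is read as a quantifier,
  so that the function is total on numbers.\<close>

definition sat_step :: stepfun where
  "sat_step h c t N M = of_bool
     (if nth_code c 0 = 0 then dig N t (nth_code c 1) = dig N t (nth_code c 2)
      else if nth_code c 0 = 1 then h (nth_code c 1) t = 0
      else if nth_code c 0 = 2 then h (nth_code c 1) t \<noteq> 0 \<and> h (nth_code c 2) t \<noteq> 0
      else \<exists>t'<N ^ M. (\<forall>y<M. y = nth_code c 1 \<or> dig N t' y = dig N t y) \<and> h (nth_code c 2) t' \<noteq> 0)"

lemma below_sat_step: "below sat_step"
  unfolding below_def
proof (intro allI impI)
  fix h h' :: "nat \<Rightarrow> nat \<Rightarrow> nat" and c t N M :: nat
  assume t: "t < N ^ M" and h: "\<forall>c'<c. \<forall>t'<N ^ M. h c' t' = h' c' t'"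
  have *: "h (nth_code c i) t' = h' (nth_code c i) t'" if "nth_code c 0 \<noteq> 0" "t' < N ^ M" for i t'
  proof -
    \<comment> \<open>The code 0 has tag 0 and causes no recursive call, so all calls are made at
      strictly smaller codes.\<close>
    have "c \<noteq> 0" using that(1) nth_code_0 by metis
    then show ?thesis using h that(2) nth_code_less by blast
  qed
  show "sat_step h c t N M = sat_step h' c t N M"
  proof (cases "nth_code c 0 = 0")
    case False
    then have "(\<exists>t'<N ^ M. (\<forall>y<M. y = nth_code c 1 \<or> dig N t' y = dig N t y) \<and> h (nth_code c 2) t' \<noteq> 0) \<longleftrightarrow>
        (\<exists>t'<N ^ M. (\<forall>y<M. y = nth_code c 1 \<or> dig N t' y = dig N t y) \<and> h' (nth_code c 2) t' \<noteq> 0)"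
      using * by metis
    moreover have "h (nth_code c i) t = h' (nth_code c i) t" for i using *[OF False t] .
    ultimately show ?thesis unfolding sat_step_def using False by (simp only: if_False)
  qed (simp add: sat_step_def)
qed

lemma computable_tab:
  "computable f \<Longrightarrow> computable g \<Longrightarrow> computable h \<Longrightarrow> computable (\<lambda>x. tab (f x) (g x) (h x))"
  unfolding tab_def by (intro computable_nth_code computable_prod_encode)

lemma computable_sat_step: "computable (\<lambda>x. sat_step (tab (x 4)) (x 0) (x 1) (x 2) (x 3))"
  unfolding sat_step_def by (intro computable_intros computable_tab computable_nth_code computable_dig)

definition sat_code :: "nat \<Rightarrow> nat \<Rightarrow> nat \<Rightarrow> nat \<Rightarrow> bool" where
  "sat_code c t N M \<longleftrightarrow> cov sat_step c t N M \<noteq> 0"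

lemma sat_code_eq:
  assumes "t < N ^ M"
  shows "sat_code c t N M \<longleftrightarrow>
     (if nth_code c 0 = 0 then dig N t (nth_code c 1) = dig N t (nth_code c 2)
      else if nth_code c 0 = 1 then \<not> sat_code (nth_code c 1) t N M
      else if nth_code c 0 = 2 then sat_code (nth_code c 1) t N M \<and> sat_code (nth_code c 2) t N M
      else \<exists>t'<N ^ M. (\<forall>y<M. y = nth_code c 1 \<or> dig N t' y = dig N t y) \<and> sat_code (nth_code c 2) t' N M)"
  unfolding sat_code_def by (subst cov_eq[OF below_sat_step assms]) (simp add: sat_step_def)

lemma decidable_sat_code:
  "computable f \<Longrightarrow> computable g \<Longrightarrow> computable h \<Longrightarrow> computable k \<Longrightarrow>
   decidable (\<lambda>x. sat_code (f x) (g x) (h x) (k x))"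
  unfolding sat_code_def
  by (intro computable_intros computable_cov[OF below_sat_step computable_sat_step])

text \<open>A set is returned as the least number whose binary digits contain the values of all
  elements, hence as the code of exactly this set. Different expressions with the same elements get
  the same number, which is what makes equality of values decidable. Formulas are evaluated
  beforehand by \<open>sat_code\<close>, so only expressions recur.\<close>

definition ev_step :: stepfun where
  "ev_step h c t N M =
     (if nth_code c 0 = 0 then 2 * dig N t (nth_code c 1)
      else 2 * (LEAST s. \<forall>b<c. b \<in> set (list_decode (tl_code c)) \<longrightarrow>
             (\<forall>t'<N ^ M. ext N M N (nth_code b 1) t t' \<and> sat_code (nth_code b 2) t' N M \<longrightarrow>
                h (nth_code b 0) t' \<in> set_decode s)) + 1)"

lemma below_ev_step: "below ev_step"
  unfolding below_def
proof (intro allI impI)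
  fix h h' :: "nat \<Rightarrow> nat \<Rightarrow> nat" and c t N M :: nat
  assume t: "t < N ^ M" and h: "\<forall>c'<c. \<forall>t'<N ^ M. h c' t' = h' c' t'"
  have *: "h (nth_code b 0) t' = h' (nth_code b 0) t'" if "b < c" "t' < N ^ M" for b t'
  proof -
    have "nth_code b 0 < c"
      using that(1) nth_code_less[of b 0] nth_code_0[of 0] by (cases "b = 0") auto
    then show ?thesis using h that(2) by blast
  qed
  have "(\<forall>b<c. b \<in> set (list_decode (tl_code c)) \<longrightarrow>
             (\<forall>t'<N ^ M. ext N M N (nth_code b 1) t t' \<and> sat_code (nth_code b 2) t' N M \<longrightarrow>
                h (nth_code b 0) t' \<in> set_decode s)) \<longleftrightarrow>
        (\<forall>b<c. b \<in> set (list_decode (tl_code c)) \<longrightarrow>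
             (\<forall>t'<N ^ M. ext N M N (nth_code b 1) t t' \<and> sat_code (nth_code b 2) t' N M \<longrightarrow>
                h' (nth_code b 0) t' \<in> set_decode s))" for s
    using * by auto
  then show "ev_step h c t N M = ev_step h' c t N M"
    unfolding ev_step_def by (simp only:)
qed

lemma ev_step_Least_exists:
  fixes c K :: nat and h :: "nat \<Rightarrow> nat \<Rightarrow> nat"
  shows "\<exists>s. \<forall>b<c. Q b \<longrightarrow> (\<forall>t'<K. R b t' \<longrightarrow> h b t' \<in> set_decode s)"
proof
  let ?X = "(\<lambda>(b, t'). h b t') ` ({..<c} \<times> {..<K})"
  have "set_decode (set_encode ?X) = ?X"
    by (intro set_encode_inverse finite_imageI finite_cartesian_product) simp_all
  then show "\<forall>b<c. Q b \<longrightarrow> (\<forall>t'<K. R b t' \<longrightarrow> h b t' \<in> set_decode (set_encode ?X))"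
    by (simp only:) force
qed

lemma computable_ev_step: "computable (\<lambda>x. ev_step (tab (x 4)) (x 0) (x 1) (x 2) (x 3))"
  unfolding ev_step_def
  by (intro computable_intros computable_Least computable_tab computable_nth_code computable_dig
      decidable_in_list decidable_in_set_decode computable_tl_code decidable_ext decidable_sat_code
      ev_step_Least_exists)

definition ev_code :: "nat \<Rightarrow> nat \<Rightarrow> nat \<Rightarrow> nat \<Rightarrow> nat" where
  "ev_code = cov ev_step"

lemma computable_ev_code:
  "computable f \<Longrightarrow> computable g \<Longrightarrow> computable h \<Longrightarrow> computable k \<Longrightarrow>
   computable (\<lambda>x. ev_code (f x) (g x) (h x) (k x))"
  unfolding ev_code_def by (intro computable_cov[OF below_ev_step computable_ev_step])

lemma ev_code_var:
  "t < N ^ M \<Longrightarrow> nth_code c 0 = 0 \<Longrightarrow> ev_code c t N M = 2 * dig N t (nth_code c 1)"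
  unfolding ev_code_def by (subst cov_eq[OF below_ev_step]) (simp_all add: ev_step_def)

text \<open>Only the outermost bound variables are restricted to atoms below \<open>B\<close>; the inner ones range over
  the atoms below \<open>N\<close>.\<close>

definition elem_code :: "nat \<Rightarrow> nat \<Rightarrow> nat \<Rightarrow> nat \<Rightarrow> nat \<Rightarrow> nat \<Rightarrow> bool" where
  "elem_code B v c t N M \<longleftrightarrow> (\<exists>b<c. b \<in> set (list_decode (tl_code c)) \<and> (\<exists>t'<N ^ M.
     ext N M B (nth_code b 1) t t' \<and> sat_code (nth_code b 2) t' N M \<and> v = ev_code (nth_code b 0) t' N M))"

lemma ev_code_set:
  assumes t: "t < N ^ M" and c: "nth_code c 0 \<noteq> 0"
  shows "odd (ev_code c t N M)" "mem v (ev_code c t N M) \<longleftrightarrow> elem_code N v c t N M"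
proof -
  let ?P = "\<lambda>s. \<forall>b<c. b \<in> set (list_decode (tl_code c)) \<longrightarrow>
             (\<forall>t'<N ^ M. ext N M N (nth_code b 1) t t' \<and> sat_code (nth_code b 2) t' N M \<longrightarrow>
                ev_code (nth_code b 0) t' N M \<in> set_decode s)"
  have ev: "ev_code c t N M = 2 * (LEAST s. ?P s) + 1"
    unfolding ev_code_def by (subst cov_eq[OF below_ev_step t]) (simp add: ev_step_def c)
  then show "odd (ev_code c t N M)" by simp
  let ?X = "{v. elem_code N v c t N M}"
  have "?X \<subseteq> (\<lambda>(b, t'). ev_code (nth_code b 0) t' N M) ` ({..<c} \<times> {..<N ^ M})"
    unfolding elem_code_def by force
  then have fin: "finite ?X" by (rule finite_subset) simp
  have "set_decode (LEAST s. ?P s) = ?X"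
  proof (rule set_decode_Least)
    show "finite ?X" by (rule fin)
    show "?P (set_encode ?X)" using fin unfolding elem_code_def by simp blast
    show "?X \<subseteq> set_decode s" if "?P s" for s using that unfolding elem_code_def by blast
  qed
  then show "mem v (ev_code c t N M) \<longleftrightarrow> elem_code N v c t N M" unfolding ev mem_set by blast
qed

section \<open>Permutations of atoms\<close>

text \<open>A new point \<open>a\<close> is handled by composing with the transposition of
  \<open>\<pi> a\<close> and \<open>f a\<close>. By injectivity neither of these two is the image of
  a point treated before.\<close>

lemma bij_extension:
  fixes f :: "'a \<Rightarrow> 'a"
  assumes "finite A" "inj_on f A"
  shows "\<exists>\<pi>. bij \<pi> \<and> (\<forall>a\<in>A. \<pi> a = f a)"
  using assms
proof (induction A)
  case empty
  show ?case using bij_id by auto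
next
  case (insert a A)
  then obtain \<pi> where \<pi>: "bij \<pi>" "\<forall>a\<in>A. \<pi> a = f a" by auto
  let ?\<rho> = "transpose (\<pi> a) (f a) \<circ> \<pi>"
  have "?\<rho> b = f b" if "b \<in> insert a A" for b
  proof (cases "b = a")
    case False
    then have "b \<in> A" using that by simp
    then have "f b \<noteq> f a" using insert.prems insert.hyps by (auto simp: inj_on_def)
    moreover have "\<pi> b \<noteq> \<pi> a" using False \<pi>(1) by (metis bij_def injD)
    ultimately show ?thesis using \<pi>(2) \<open>b \<in> A\<close> by simp
  qed simp
  moreover have "bij ?\<rho>" using \<pi>(1) by (intro bij_comp) simp_all
  ultimately show ?case by blast
qed

text \<open>The counting behind the transfers: the atoms below \<open>B\<close> outside
  \<open>X\<close> are numerous enough to receive those of \<open>Y\<close> outside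
  \<open>X\<close>, and the resulting finite injection extends to a permutation.\<close>

lemma bij_move:
  fixes X Y :: "nat set"
  assumes "finite Y" "X \<subseteq> {..<B}" "card X + card Y \<le> B"
  obtains \<pi> where "bij \<pi>" "\<And>a. a \<in> X \<Longrightarrow> \<pi> a = a" "\<And>a. a \<in> Y \<Longrightarrow> \<pi> a < B"
proof -
  have X: "finite X" using assms(2) finite_subset by blast
  have "card (Y - X) \<le> card Y" using assms(1) by (intro card_mono) auto
  moreover have "card ({..<B} - X) = B - card X" using assms(2) X by (simp add: card_Diff_subset)
  ultimately have "card (Y - X) \<le> card ({..<B} - X)" using assms(3) by simp
  then obtain g where g: "g ` (Y - X) \<subseteq> {..<B} - X" "inj_on g (Y - X)"
    using card_le_inj[of "Y - X" "{..<B} - X"] assms(1) by auto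
  let ?f = "\<lambda>a. if a \<in> X then a else g a"
  have "inj_on ?f (X \<union> Y)" using g unfolding inj_on_def by auto
  then obtain \<pi> where \<pi>: "bij \<pi>" "\<forall>a\<in>X \<union> Y. \<pi> a = ?f a"
    using bij_extension[of "X \<union> Y" ?f] X assms(1) by auto
  have "\<pi> a < B" if "a \<in> Y" for a
    using that \<pi>(2) g(1) assms(2) by (cases "a \<in> X") auto
  with \<pi> show ?thesis using that[of \<pi>] by auto
qed

section \<open>The action of permutations of atoms on values\<close>

primrec act :: "(atom \<Rightarrow> atom) \<Rightarrow> val \<Rightarrow> val" where
  "act \<pi> (Atm a) = Atm (\<pi> a)"
| "act \<pi> (St X) = St (cimage (act \<pi>) X)"

definition velems :: "val \<Rightarrow> val set" where
  "velems v = (case v of Atm a \<Rightarrow> {} | St X \<Rightarrow> rcset X)"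

lemma velems_simps [simp]: "velems (Atm a) = {}" "velems (St X) = rcset X"
  unfolding velems_def by simp_all

lemma velems_act: "velems (act \<pi> v) = act \<pi> ` velems v"
  by (cases v) (simp_all add: cimage.rep_eq)

lemma act_comp: "act \<pi> (act \<rho> v) = act (\<pi> \<circ> \<rho>) v"
proof (induction v)
  case (St X)
  have "cimage (act \<pi>) (cimage (act \<rho>) X) = cimage (act \<pi> \<circ> act \<rho>) X"
    by (simp add: cset.map_comp)
  also have "\<dots> = cimage (act (\<pi> \<circ> \<rho>)) X"
    using refl by (rule cset.map_cong) (simp only: St comp_apply[of "act \<pi>"])
  finally show ?case by (simp only: act.simps)
qed simp

lemma act_id: "act id v = v"
proof (induction v)
  case (St X)
  have "cimage (act id) X = cimage id X"
    using refl by (rule cset.map_cong) (simp only: St id_apply[of "_ :: val"])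
  then show ?case by (simp only: act.simps cset.map_id)
qed simp

lemma act_inv:
  assumes "bij \<pi>" shows "act (inv \<pi>) (act \<pi> v) = v" "act \<pi> (act (inv \<pi>) v) = v"
proof -
  have "inv \<pi> \<circ> \<pi> = id" "\<pi> \<circ> inv \<pi> = id"
    using assms by (simp_all add: bij_is_inj bij_is_surj surj_iff[symmetric])
  then show "act (inv \<pi>) (act \<pi> v) = v" "act \<pi> (act (inv \<pi>) v) = v"
    by (simp_all only: act_comp act_id)
qed

lemma act_inject: "bij \<pi> \<Longrightarrow> act \<pi> u = act \<pi> v \<longleftrightarrow> u = v"
  by (metis act_inv(1))

lemma act_upair: "act \<pi> (upair u v) = upair (act \<pi> u) (act \<pi> v)"
  unfolding upair_def by simp

lemma act_vpair: "act \<pi> (vpair u v) = vpair (act \<pi> u) (act \<pi> v)"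
  unfolding vpair_def by (simp add: act_upair)

lemma velems_upair: "velems (upair u v) = {u, v}"
  unfolding upair_def by (simp add: cinsert.rep_eq bot_cset.rep_eq)

section \<open>Dependence of the semantics on free variables, and its equivariance\<close>

lemma sat_cong: "(\<And>x. x \<in> fv_fm \<phi> \<Longrightarrow> \<sigma> x = \<tau> x) \<Longrightarrow> sat \<phi> \<sigma> = sat \<phi> \<tau>"
proof (induction \<phi> arbitrary: \<sigma> \<tau>)
  case (Ex x \<phi>)
  have "sat \<phi> (\<sigma>(x := a)) = sat \<phi> (\<tau>(x := a))" for a
    using Ex.prems by (intro Ex.IH) auto
  then show ?case by simp
next
  case (Neg \<phi>)
  have "sat \<phi> \<sigma> = sat \<phi> \<tau>" by (rule Neg.IH) (use Neg.prems in simp)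
  then show ?case by simp
next
  case (Conj \<phi> \<psi>)
  have "sat \<phi> \<sigma> = sat \<phi> \<tau>" by (rule Conj.IH(1)) (use Conj.prems in simp)
  moreover have "sat \<psi> \<sigma> = sat \<psi> \<tau>" by (rule Conj.IH(2)) (use Conj.prems in simp)
  ultimately show ?case by simp
qed simp

lemma sat_perm: "bij \<pi> \<Longrightarrow> sat \<phi> (\<pi> \<circ> \<sigma>) = sat \<phi> \<sigma>"
proof (induction \<phi> arbitrary: \<sigma>)
  case (Eq x y)
  then show ?case by (simp add: bij_def inj_eq)
next
  case (Ex x \<phi>)
  have "sat \<phi> ((\<pi> \<circ> \<sigma>)(x := \<pi> a)) = sat \<phi> (\<sigma>(x := a))" for a
    using Ex.IH[OF Ex.prems, of "\<sigma>(x := a)"] by (simp only: fun_upd_comp)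
  moreover have "\<exists>a. b = \<pi> a" for b using Ex.prems by (metis bij_pointE)
  ultimately show ?case unfolding sat.simps by metis
qed simp_all

lemma mem_elems:
  "u \<in> elems (Builder e xs \<phi>) \<sigma> \<longleftrightarrow> (\<exists>\<tau>. (\<forall>y. y \<notin> set xs \<longrightarrow> \<tau> y = \<sigma> y) \<and> sat \<phi> \<tau> \<and> u = eval e \<tau>)"
  by auto

lemma velems_eval: "velems (eval (EUnion bs) \<sigma>) = (\<Union>b\<in>set bs. elems b \<sigma>)"
  by (simp add: rcset_acset_elems)

lemma val_set_eqI: "u = St X \<Longrightarrow> v = St Y \<Longrightarrow> velems u = velems v \<Longrightarrow> u = v"
  by (simp add: rcset_inject)

lemma eval_cong:
  "(\<And>x. x \<in> fv e \<Longrightarrow> \<sigma> x = \<tau> x) \<Longrightarrow> eval e \<sigma> = eval e \<tau>"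
  "(\<And>x. x \<in> fv_builder b \<Longrightarrow> \<sigma> x = \<tau> x) \<Longrightarrow> elems b \<sigma> = elems b \<tau>"
proof (induction e and b arbitrary: \<sigma> \<tau> and \<sigma> \<tau> rule: fv_fv_builder.induct)
  case (2 bs)
  have "elems b \<sigma> = elems b \<tau>" if "b \<in> set bs" for b
    by (rule 2(1)[OF that]) (use 2(2) that in auto)
  then show ?case by simp
next
  case (3 e xs \<phi>)
  have "elems (Builder e xs \<phi>) \<sigma> \<subseteq> elems (Builder e xs \<phi>) \<tau>"
    if *: "\<And>x. x \<in> fv_builder (Builder e xs \<phi>) \<Longrightarrow> \<sigma> x = \<tau> x" for \<sigma> \<tau>
  proof
    fix u assume "u \<in> elems (Builder e xs \<phi>) \<sigma>"
    then obtain \<rho> where \<rho>: "\<forall>y. y \<notin> set xs \<longrightarrow> \<rho> y = \<sigma> y" "sat \<phi> \<rho>" "u = eval e \<rho>"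
      unfolding mem_elems by blast
    define \<rho>' where "\<rho>' y = (if y \<in> set xs then \<rho> y else \<tau> y)" for y
    have "eval e \<rho> = eval e \<rho>'" using * \<rho>(1) by (intro 3) (auto simp: \<rho>'_def)
    moreover have "sat \<phi> \<rho> = sat \<phi> \<rho>'" using * \<rho>(1) by (intro sat_cong) (auto simp: \<rho>'_def)
    ultimately show "u \<in> elems (Builder e xs \<phi>) \<tau>"
      unfolding mem_elems using \<rho> by (intro exI[of _ \<rho>']) (auto simp: \<rho>'_def)
  qed
  note sub = this
  show ?case
  proof (rule subset_antisym)
    show "elems (Builder e xs \<phi>) \<sigma> \<subseteq> elems (Builder e xs \<phi>) \<tau>" using 3(2) by (rule sub)
    show "elems (Builder e xs \<phi>) \<tau> \<subseteq> elems (Builder e xs \<phi>) \<sigma>" using 3(2)[symmetric] by (rule sub)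
  qed
qed simp

text \<open>Expressions contain no atoms, all of which enter through the valuation, and formulas
  test only equality. For bound variables a witness is pulled back along \<open>inv \<pi>\<close> or
  pushed forward along \<pi>.\<close>

lemma eval_perm:
  assumes \<pi>: "bij \<pi>"
  shows "eval e (\<pi> \<circ> \<sigma>) = act \<pi> (eval e \<sigma>)" "elems b (\<pi> \<circ> \<sigma>) = act \<pi> ` elems b \<sigma>"
proof (induction e and b arbitrary: \<sigma> and \<sigma> rule: fv_fv_builder.induct)
  case (2 bs)
  have "velems (eval (EUnion bs) (\<pi> \<circ> \<sigma>)) = velems (act \<pi> (eval (EUnion bs) \<sigma>))"
    unfolding velems_act velems_eval image_UN by (simp only: 2 cong: SUP_cong)
  then show ?case by (rule val_set_eqI[rotated 2]) (simp_all only: eval.simps act.simps)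
next
  case (3 e xs \<phi>)
  have inv: "\<pi> (inv \<pi> a) = a" for a using \<pi> by (simp add: bij_is_surj surj_f_inv_f)
  show ?case
  proof (intro equalityI subsetI)
    fix u assume "u \<in> elems (Builder e xs \<phi>) (\<pi> \<circ> \<sigma>)"
    then obtain \<tau> where \<tau>: "\<forall>y. y \<notin> set xs \<longrightarrow> \<tau> y = \<pi> (\<sigma> y)" "sat \<phi> \<tau>" "u = eval e \<tau>"
      unfolding mem_elems by auto
    define \<rho> where "\<rho> = inv \<pi> \<circ> \<tau>"
    have \<rho>: "\<pi> \<circ> \<rho> = \<tau>" unfolding \<rho>_def using inv by auto
    have "eval e \<rho> \<in> elems (Builder e xs \<phi>) \<sigma>"
      unfolding mem_elems using \<tau> sat_perm[OF \<pi>, of \<phi> \<rho>] \<pi>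
      by (intro exI[of _ \<rho>]) (auto simp: \<rho>, simp add: \<rho>_def bij_is_inj)
    then show "u \<in> act \<pi> ` elems (Builder e xs \<phi>) \<sigma>"
      using 3[of \<rho>] \<tau>(3) \<rho> by auto
  next
    fix u assume "u \<in> act \<pi> ` elems (Builder e xs \<phi>) \<sigma>"
    then obtain \<tau> where \<tau>: "\<forall>y. y \<notin> set xs \<longrightarrow> \<tau> y = \<sigma> y" "sat \<phi> \<tau>" "u = act \<pi> (eval e \<tau>)"
      by (auto simp: mem_elems)
    have "u = eval e (\<pi> \<circ> \<tau>)" unfolding \<tau>(3) 3 ..
    then show "u \<in> elems (Builder e xs \<phi>) (\<pi> \<circ> \<sigma>)"
      unfolding mem_elems using sat_perm[OF \<pi>, of \<phi> \<tau>] \<tau>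
      by (intro exI[of _ "\<pi> \<circ> \<tau>"]) simp
  qed
qed simp

section \<open>Codes of expressions\<close>

lemma list_encode_less: "x \<in> set xs \<Longrightarrow> x < list_encode xs"
  using list_decode_less[of x "list_encode xs"] by simp

lemma nth_code_list_encode: "i < length xs \<Longrightarrow> nth_code (list_encode xs) i = xs ! i"
  by (simp add: nth_code)

text \<open>A code bounds the variables below it, so that any number above the codes of the inputs
  can serve as \<open>M\<close>.\<close>

lemma fv_fm_less: "x \<in> fv_fm \<phi> \<Longrightarrow> x < code_fm \<phi>"
proof (induction \<phi>)
  case (Eq y z)
  then show ?case unfolding code_fm.simps by (intro list_encode_less) auto
next
  case (Neg \<phi>)
  then have "x < code_fm \<phi>" by simp
  also have "\<dots> < code_fm (Neg \<phi>)" unfolding code_fm.simps by (intro list_encode_less) auto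
  finally show ?case .
next
  case (Conj \<phi> \<psi>)
  have "code_fm \<phi> < code_fm (Conj \<phi> \<psi>)" "code_fm \<psi> < code_fm (Conj \<phi> \<psi>)"
    unfolding code_fm.simps by (intro list_encode_less; auto)+
  then show ?case using Conj by auto
next
  case (Ex y \<phi>)
  then have "x < code_fm \<phi>" by simp
  also have "\<dots> < code_fm (Ex y \<phi>)" unfolding code_fm.simps by (intro list_encode_less) auto
  finally show ?case .
qed

lemma code_builder_less: "b \<in> set bs \<Longrightarrow> code_builder b < code_expr (EUnion bs)"
  by (simp only: code_expr.simps) (rule list_encode_less, simp)

lemma code_Builder_less:
  "code_expr e < code_builder (Builder e xs \<phi>)" "code_fm \<phi> < code_builder (Builder e xs \<phi>)"
  "x \<in> set xs \<Longrightarrow> x < code_builder (Builder e xs \<phi>)"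
proof -
  have "list_encode xs < code_builder (Builder e xs \<phi>)"
    by (simp only: code_builder.simps) (rule list_encode_less, simp)
  then show "x \<in> set xs \<Longrightarrow> x < code_builder (Builder e xs \<phi>)"
    using list_encode_less less_trans by blast
qed (simp only: code_builder.simps, rule list_encode_less, simp)+

lemma fv_less: "x \<in> fv e \<Longrightarrow> x < code_expr e" "x \<in> fv_builder b \<Longrightarrow> x < code_builder b"
proof (induction e and b rule: fv_fv_builder.induct)
  case (1 y)
  then show ?case unfolding code_expr.simps by (intro list_encode_less) simp
next
  case (2 bs)
  then obtain b where "b \<in> set bs" "x \<in> fv_builder b" by auto
  then show ?case using 2(1) code_builder_less less_trans by blast
next
  case (3 e xs \<phi>)
  then show ?case using code_Builder_less(1)[of e xs \<phi>] code_Builder_less(2)[of \<phi> e xs] fv_fm_less[of x \<phi>]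
    by (auto simp del: code_builder.simps)
qed

lemma nth_code_EVar: "nth_code (code_expr (EVar x)) 0 = 0" "nth_code (code_expr (EVar x)) 1 = x"
  by (simp_all only: code_expr.simps) (subst nth_code_list_encode; simp)+

lemma nth_code_EUnion: "nth_code (code_expr (EUnion bs)) 0 \<noteq> 0"
  by (simp only: code_expr.simps) (subst nth_code_list_encode; simp)

lemma tl_code_EUnion: "list_decode (tl_code (code_expr (EUnion bs))) = map code_builder bs"
  by (simp only: code_expr.simps tl_code) (simp only: list_encode_inverse list.sel)

lemma nth_code_Builder:
  "nth_code (code_builder (Builder e xs \<phi>)) 0 = code_expr e"
  "list_decode (nth_code (code_builder (Builder e xs \<phi>)) 1) = xs"
  "nth_code (code_builder (Builder e xs \<phi>)) 2 = code_fm \<phi>"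
  by (simp_all only: code_builder.simps) (subst nth_code_list_encode; simp)+

section \<open>Transfer between all atoms and finitely many atoms\<close>

text \<open>The factor 8 is what \<open>represented_move2\<close> uses: \<open>6 * M\<close> atoms
  to be fixed and \<open>2 * M\<close> to be moved. The summand 8 keeps \<open>N\<close> positive
  and leaves room below the atom \<open>N - 1\<close>.\<close>

locale finite_atoms =
  fixes N M :: nat
  assumes N: "N = 8 * M + 8"
begin

abbreviation "K \<equiv> N ^ M"

definition rng :: "(var \<Rightarrow> atom) \<Rightarrow> atom set" where
  "rng \<tau> = \<tau> ` {..<M}"

lemma finite_rng [simp]: "finite (rng \<tau>)" unfolding rng_def by simp

lemma card_rng: "card (rng \<tau>) \<le> M"
  unfolding rng_def using card_image_le[of "{..<M}" \<tau>] by simp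

lemma rng_mem: "y < M \<Longrightarrow> \<tau> y \<in> rng \<tau>" unfolding rng_def by simp

lemma dig_N: "dig N t y < N" using N by (simp add: dig_less)

lemma rng_dig: "rng (dig N t) \<subseteq> {..<N}" unfolding rng_def using dig_N by auto

lemma dig_obtain:
  assumes "\<And>y. y < M \<Longrightarrow> \<tau> y < N"
  obtains t where "t < K" "\<And>y. y < M \<Longrightarrow> dig N t y = \<tau> y"
  using ex_dig[of M \<tau> N] assms by auto

lemma sat_cong_M: "code_fm \<phi> < M \<Longrightarrow> (\<And>y. y < M \<Longrightarrow> \<sigma> y = \<tau> y) \<Longrightarrow> sat \<phi> \<sigma> = sat \<phi> \<tau>"
  by (intro sat_cong) (auto dest: fv_fm_less)

lemma eval_cong_M: "code_expr e < M \<Longrightarrow> (\<And>y. y < M \<Longrightarrow> \<sigma> y = \<tau> y) \<Longrightarrow> eval e \<sigma> = eval e \<tau>"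
  by (intro eval_cong) (auto dest: fv_less)

text \<open>The atoms of \<open>rng \<tau>\<close> support the value, because
  \<open>\<pi> \<circ> \<tau>\<close> agrees with \<tau> on all variables of
  \<open>e\<close>.\<close>

lemma act_fix:
  assumes "bij \<pi>" "code_expr e < M" "\<And>a. a \<in> rng \<tau> \<Longrightarrow> \<pi> a = a"
  shows "act \<pi> (eval e \<tau>) = eval e \<tau>"
  unfolding eval_perm(1)[OF assms(1), symmetric]
  by (intro eval_cong_M assms(2)) (simp add: assms(3) rng_mem)

text \<open>\<open>sat\<close> still quantifies over all atoms. A witness beyond \<open>N\<close> is
  brought below it by a permutation that fixes the atoms of the current valuation, and such a
  permutation does not change the truth of the body.\<close>

lemma sat_code_iff:
  "code_fm \<phi> < M \<Longrightarrow> t < K \<Longrightarrow> sat_code (code_fm \<phi>) t N M \<longleftrightarrow> sat \<phi> (dig N t)"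
proof (induction \<phi> arbitrary: t)
  case (Eq x y)
  then show ?case by (subst sat_code_eq) (simp_all add: nth_code_list_encode del: list_encode.simps)
next
  case (Neg \<phi>)
  have "code_fm \<phi> < code_fm (Neg \<phi>)" unfolding code_fm.simps by (intro list_encode_less) auto
  then show ?case using Neg
    by (subst sat_code_eq) (simp_all add: nth_code_list_encode del: list_encode.simps)
next
  case (Conj \<phi> \<psi>)
  have "code_fm \<phi> < code_fm (Conj \<phi> \<psi>)" "code_fm \<psi> < code_fm (Conj \<phi> \<psi>)"
    unfolding code_fm.simps by (intro list_encode_less; auto)+
  then show ?case using Conj
    by (subst sat_code_eq) (simp_all add: nth_code_list_encode del: list_encode.simps)
next
  case (Ex x \<phi>)
  have \<phi>: "code_fm \<phi> < M"
  proof -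
    have "code_fm \<phi> < code_fm (Ex x \<phi>)" unfolding code_fm.simps by (intro list_encode_less) auto
    then show ?thesis using Ex.prems(1) by simp
  qed
  have "sat_code (code_fm (Ex x \<phi>)) t N M \<longleftrightarrow>
      (\<exists>t'<K. (\<forall>y<M. y = x \<or> dig N t' y = dig N t y) \<and> sat_code (code_fm \<phi>) t' N M)"
    using Ex.prems(2) by (subst sat_code_eq) (simp_all add: nth_code_list_encode del: list_encode.simps)
  also have "\<dots> \<longleftrightarrow> (\<exists>t'<K. (\<forall>y<M. y = x \<or> dig N t' y = dig N t y) \<and> sat \<phi> (dig N t'))"
    using Ex.IH[OF \<phi>] by blast
  also have "\<dots> \<longleftrightarrow> (\<exists>a. sat \<phi> ((dig N t)(x := a)))"
  proof
    assume "\<exists>t'<K. (\<forall>y<M. y = x \<or> dig N t' y = dig N t y) \<and> sat \<phi> (dig N t')"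
    then obtain t' where t': "\<forall>y<M. y = x \<or> dig N t' y = dig N t y" "sat \<phi> (dig N t')" by blast
    have "sat \<phi> (dig N t') = sat \<phi> ((dig N t)(x := dig N t' x))"
      using \<phi> by (rule sat_cong_M) (use t' in auto)
    then show "\<exists>a. sat \<phi> ((dig N t)(x := a))" using t' by blast
  next
    assume "\<exists>a. sat \<phi> ((dig N t)(x := a))"
    then obtain a where a: "sat \<phi> ((dig N t)(x := a))" by blast
    obtain \<pi> where \<pi>: "bij \<pi>" "\<And>c. c \<in> rng (dig N t) \<Longrightarrow> \<pi> c = c" "\<And>c. c \<in> {a} \<Longrightarrow> \<pi> c < N"
      by (rule bij_move[of "{a}" "rng (dig N t)" N]) (use card_rng[of "dig N t"] N rng_dig in auto)
    obtain t' where t': "t' < K" "\<And>y. y < M \<Longrightarrow> dig N t' y = ((dig N t)(x := \<pi> a)) y"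
      by (rule dig_obtain[of "(dig N t)(x := \<pi> a)"]) (use \<pi>(3) dig_N in auto)
    have "sat \<phi> (dig N t') = sat \<phi> (\<pi> \<circ> (dig N t)(x := a))"
      using \<phi> by (rule sat_cong_M) (use t' \<pi>(2) rng_mem[of _ "dig N t"] in auto)
    then have "sat \<phi> (dig N t')" using a sat_perm[OF \<pi>(1)] by simp
    then show "\<exists>t'<K. (\<forall>y<M. y = x \<or> dig N t' y = dig N t y) \<and> sat \<phi> (dig N t')"
      using t' by (intro exI[of _ t']) auto
  qed
  finally show ?case by simp
qed

lemma code_sub:
  assumes "code_expr (EUnion bs) < M" "Builder e xs \<phi> \<in> set bs"
  shows "code_expr e < code_expr (EUnion bs)" "code_expr e < M" "code_fm \<phi> < M"
    "\<And>x. x \<in> set xs \<Longrightarrow> x < M"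
  using code_builder_less[OF assms(2)] code_Builder_less(1)[of e xs \<phi>] code_Builder_less(3)[of _ xs e \<phi>]
    code_Builder_less(2)[of \<phi> e xs] assms(1)
  by (auto simp del: code_builder.simps code_expr.simps dest: less_trans)

lemma elem_code_iff:
  assumes "code_expr (EUnion bs) < M" "t < K"
  shows "elem_code B v (code_expr (EUnion bs)) t N M \<longleftrightarrow>
    (\<exists>e xs \<phi> t'. Builder e xs \<phi> \<in> set bs \<and> t' < K \<and>
       (\<forall>y<M. if y \<in> set xs then dig N t' y < B else dig N t' y = dig N t y) \<and>
       sat \<phi> (dig N t') \<and> v = ev_code (code_expr e) t' N M)" (is "?l \<longleftrightarrow> ?r")
proof
  assume ?l
  then obtain b t' where b: "b \<in> set bs" "t' < K" "ext N M B (nth_code (code_builder b) 1) t t'"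
      "sat_code (nth_code (code_builder b) 2) t' N M" "v = ev_code (nth_code (code_builder b) 0) t' N M"
    unfolding elem_code_def tl_code_EUnion by auto
  obtain e xs \<phi> where e: "b = Builder e xs \<phi>" by (cases b)
  note sub = code_sub[OF assms(1) b(1)[unfolded e]]
  show ?r
    using b unfolding e nth_code_Builder ext_def sat_code_iff[OF sub(3) b(2)] by blast
next
  assume ?r
  then obtain e xs \<phi> t' where *: "Builder e xs \<phi> \<in> set bs" "t' < K"
       "\<forall>y<M. if y \<in> set xs then dig N t' y < B else dig N t' y = dig N t y"
       "sat \<phi> (dig N t')" "v = ev_code (code_expr e) t' N M" by blast
  let ?b = "Builder e xs \<phi>"
  have "ext N M B (nth_code (code_builder ?b) 1) t t'" "sat_code (nth_code (code_builder ?b) 2) t' N M"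
      "v = ev_code (nth_code (code_builder ?b) 0) t' N M"
    unfolding nth_code_Builder ext_def sat_code_iff[OF code_sub(3)[OF assms(1) *(1)] *(2)] using * by auto
  moreover have "code_builder ?b < code_expr (EUnion bs)" using *(1) by (rule code_builder_less)
  moreover have "code_builder ?b \<in> set (list_decode (tl_code (code_expr (EUnion bs))))"
    unfolding tl_code_EUnion set_map using *(1) by (rule imageI)
  ultimately show ?l unfolding elem_code_def using *(2) by blast
qed

lemma velems_eval_iff:
  "u \<in> velems (eval (EUnion bs) \<sigma>) \<longleftrightarrow> (\<exists>e xs \<phi> \<tau>. Builder e xs \<phi> \<in> set bs \<and>
     (\<forall>y. y \<notin> set xs \<longrightarrow> \<tau> y = \<sigma> y) \<and> sat \<phi> \<tau> \<and> u = eval e \<tau>)" (is "?l \<longleftrightarrow> ?r")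
proof
  assume ?l
  then obtain b where b: "b \<in> set bs" "u \<in> elems b \<sigma>" unfolding velems_eval by blast
  obtain e xs \<phi> where e: "b = Builder e xs \<phi>" by (cases b)
  show ?r using b unfolding e mem_elems by blast
next
  assume ?r
  then obtain e xs \<phi> \<tau> where b: "Builder e xs \<phi> \<in> set bs"
      and "\<forall>y. y \<notin> set xs \<longrightarrow> \<tau> y = \<sigma> y" "sat \<phi> \<tau>" "u = eval e \<tau>" by blast
  then have "u \<in> elems (Builder e xs \<phi>) \<sigma>" unfolding mem_elems by blast
  then show ?l unfolding velems_eval using b by blast
qed

lemma velems_evalI:
  assumes "code_expr (EUnion bs) < M" "Builder e xs \<phi> \<in> set bs"
    "\<And>y. y < M \<Longrightarrow> y \<notin> set xs \<Longrightarrow> \<tau> y = \<sigma> y" "sat \<phi> \<tau>"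
  shows "eval e \<tau> \<in> velems (eval (EUnion bs) \<sigma>)"
proof -
  note sub = code_sub[OF assms(1,2)]
  define \<rho> where "\<rho> y = (if y < M then \<tau> y else \<sigma> y)" for y
  have "eval e \<tau> = eval e \<rho>" using sub(2) by (rule eval_cong_M) (simp add: \<rho>_def)
  moreover have "sat \<phi> \<tau> = sat \<phi> \<rho>" using sub(3) by (rule sat_cong_M) (simp add: \<rho>_def)
  moreover have "\<forall>y. y \<notin> set xs \<longrightarrow> \<rho> y = \<sigma> y" using assms(3) by (auto simp: \<rho>_def)
  ultimately show ?thesis unfolding velems_eval_iff using assms(2,4) by auto
qed

lemma elem_codeI:
  assumes "code_expr (EUnion bs) < M" "t < K" "Builder e xs \<phi> \<in> set bs" "B \<le> N"
    "\<And>y. y < M \<Longrightarrow> y \<in> set xs \<Longrightarrow> \<tau> y < B"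
    "\<And>y. y < M \<Longrightarrow> y \<notin> set xs \<Longrightarrow> \<tau> y = dig N t y" "sat \<phi> \<tau>"
  obtains t' where "t' < K" "\<And>y. y < M \<Longrightarrow> dig N t' y = \<tau> y" "eval e (dig N t') = eval e \<tau>"
    "elem_code B (ev_code (code_expr e) t' N M) (code_expr (EUnion bs)) t N M"
proof -
  note sub = code_sub[OF assms(1,3)]
  have "\<tau> y < N" if "y < M" for y
    using assms(4) assms(5)[of y] assms(6)[of y] dig_N[of t y] that by (cases "y \<in> set xs") auto
  then obtain t' where t': "t' < K" "\<And>y. y < M \<Longrightarrow> dig N t' y = \<tau> y" by (rule dig_obtain) (assumption, rule that)
  have "sat \<phi> (dig N t')" using assms(7) sat_cong_M[OF sub(3), of "dig N t'" \<tau>] t' by simp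
  moreover have "eval e (dig N t') = eval e \<tau>" using sub(2) by (rule eval_cong_M) (rule t')
  moreover have "\<forall>y<M. if y \<in> set xs then dig N t' y < B else dig N t' y = dig N t y"
    using t' assms by auto
  ultimately have "elem_code B (ev_code (code_expr e) t' N M) (code_expr (EUnion bs)) t N M"
    unfolding elem_code_iff[OF assms(1,2)] using assms(3) t'(1) by blast
  with t' \<open>eval e (dig N t') = eval e \<tau>\<close> show ?thesis using that by blast
qed

lemma elem_codeE:
  assumes "code_expr (EUnion bs) < M" "t < K" "elem_code B v (code_expr (EUnion bs)) t N M"
  obtains e xs \<phi> t' where "Builder e xs \<phi> \<in> set bs" "t' < K" "sat \<phi> (dig N t')"
    "\<And>y. y < M \<Longrightarrow> y \<in> set xs \<Longrightarrow> dig N t' y < B"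
    "\<And>y. y < M \<Longrightarrow> y \<notin> set xs \<Longrightarrow> dig N t' y = dig N t y"
    "v = ev_code (code_expr e) t' N M" "eval e (dig N t') \<in> velems (eval (EUnion bs) (dig N t))"
proof -
  obtain e xs \<phi> t' where *: "Builder e xs \<phi> \<in> set bs" "t' < K"
      "\<forall>y<M. if y \<in> set xs then dig N t' y < B else dig N t' y = dig N t y"
      "sat \<phi> (dig N t')" "v = ev_code (code_expr e) t' N M"
    using assms(3) unfolding elem_code_iff[OF assms(1,2)] by blast
  have "eval e (dig N t') \<in> velems (eval (EUnion bs) (dig N t))"
    using assms(1) *(1) by (rule velems_evalI) (use * in auto)
  then show ?thesis using that[of e xs \<phi> t'] * by auto
qed

text \<open>An element of a definable set may use atoms beyond \<open>N\<close>. It is carried into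
  the finite structure by a permutation fixing the parameters of the set, so that it remains an
  element, and a further set \<open>X\<close> of atoms, chosen in each application to keep another
  value in place.\<close>

lemma move_elem:
  assumes c: "code_expr (EUnion bs) < M" and t: "t < K" and b: "Builder e xs \<phi> \<in> set bs"
    and \<tau>: "\<And>y. y \<notin> set xs \<Longrightarrow> \<tau> y = dig N t y" "sat \<phi> \<tau>"
    and X: "X \<subseteq> {..<N}" "card X \<le> 2 * M"
  obtains \<pi> t' where "bij \<pi>" "\<And>a. a \<in> X \<Longrightarrow> \<pi> a = a" "\<And>a. a \<in> rng (dig N t) \<Longrightarrow> \<pi> a = a"
    "t' < K" "eval e (dig N t') = act \<pi> (eval e \<tau>)"
    "elem_code N (ev_code (code_expr e) t' N M) (code_expr (EUnion bs)) t N M"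
proof -
  let ?X = "X \<union> rng (dig N t)"
  have "card ?X \<le> card X + card (rng (dig N t))" by (rule card_Un_le)
  then have "card ?X + card (rng \<tau>) \<le> N"
    using X(2) card_rng[of \<tau>] card_rng[of "dig N t"] N by simp
  then obtain \<pi> where \<pi>: "bij \<pi>" "\<And>a. a \<in> ?X \<Longrightarrow> \<pi> a = a" "\<And>a. a \<in> rng \<tau> \<Longrightarrow> \<pi> a < N"
    using bij_move[of "rng \<tau>" ?X N] X(1) rng_dig by (metis Un_least finite_rng)
  obtain t' where t': "t' < K" "eval e (dig N t') = eval e (\<pi> \<circ> \<tau>)"
      "elem_code N (ev_code (code_expr e) t' N M) (code_expr (EUnion bs)) t N M"
  proof (rule elem_codeI[OF c t b order_refl, of "\<pi> \<circ> \<tau>"])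
    show "(\<pi> \<circ> \<tau>) y < N" if "y < M" for y using that \<pi>(3) rng_mem by simp
    show "(\<pi> \<circ> \<tau>) y = dig N t y" if "y < M" "y \<notin> set xs" for y
      using that \<tau>(1) \<pi>(2) rng_mem by simp
    show "sat \<phi> (\<pi> \<circ> \<tau>)" using \<tau>(2) sat_perm[OF \<pi>(1)] by simp
  qed blast
  show ?thesis by (rule that[OF \<pi>(1) _ _ t'(1) _ t'(3)]) (use \<pi>(2) t'(2) eval_perm(1)[OF \<pi>(1)] in auto)
qed

lemma ev_code_var': "t < K \<Longrightarrow> ev_code (code_expr (EVar x)) t N M = 2 * dig N t x"
  by (simp only: ev_code_var nth_code_EVar)

lemma ev_code_EUnion:
  assumes "t < K"
  shows "odd (ev_code (code_expr (EUnion bs)) t N M)"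
    "mem v (ev_code (code_expr (EUnion bs)) t N M) \<longleftrightarrow> elem_code N v (code_expr (EUnion bs)) t N M"
  by (rule ev_code_set[OF assms nth_code_EUnion])+

text \<open>Sets are compared through their elements, whose expressions have smaller codes; hence
  the induction on the sum of the two codes. The difficulty is that an element of one set may have,
  as an element of the other, a description with atoms beyond \<open>N\<close>; such descriptions
  are moved. Atoms and sets are told apart by parity.\<close>

lemma ev_code_eq_iff:
  assumes "code_expr e < M" "code_expr e' < M" "t < K" "t' < K"
  shows "ev_code (code_expr e) t N M = ev_code (code_expr e') t' N M \<longleftrightarrow>
    eval e (dig N t) = eval e' (dig N t')"
  using assms
proof (induction "code_expr e + code_expr e'" arbitrary: e e' t t' rule: less_induct)
  case less
  show ?case
  proof (cases "(\<exists>x. e = EVar x) \<or> (\<exists>x. e' = EVar x)")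
    case True
    then show ?thesis
    proof (elim disjE exE)
      fix x assume e: "e = EVar x"
      show ?thesis
      proof (cases e')
        case (EVar y)
        then show ?thesis unfolding e EVar ev_code_var'[OF less.prems(3)] ev_code_var'[OF less.prems(4)] by simp
      next
        case (EUnion bs)
        have "ev_code (code_expr e) t N M \<noteq> ev_code (code_expr e') t' N M"
          using ev_code_EUnion(1)[OF less.prems(4), of bs] unfolding e EUnion ev_code_var'[OF less.prems(3)] by presburger
        then show ?thesis unfolding e EUnion by simp
      qed
    next
      fix x assume e: "e' = EVar x"
      show ?thesis
      proof (cases e)
        case (EVar y)
        then show ?thesis unfolding e EVar ev_code_var'[OF less.prems(3)] ev_code_var'[OF less.prems(4)] by simp
      next
        case (EUnion bs)
        have "ev_code (code_expr e) t N M \<noteq> ev_code (code_expr e') t' N M"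
          using ev_code_EUnion(1)[OF less.prems(3), of bs] unfolding e EUnion ev_code_var'[OF less.prems(4)] by presburger
        then show ?thesis unfolding e EUnion by simp
      qed
    qed
  next
    case False
    then obtain bs bs' where e: "e = EUnion bs" "e' = EUnion bs'" by (metis expr.exhaust)
    let ?S = "code_expr (EUnion bs) + code_expr (EUnion bs')"
    have IH: "ev_code (code_expr f) s N M = ev_code (code_expr f') s' N M \<longleftrightarrow> eval f (dig N s) = eval f' (dig N s')"
      if "code_expr f + code_expr f' < ?S" "code_expr f < M" "code_expr f' < M" "s < K" "s' < K" for f f' s s'
      using less.hyps that unfolding e by blast
    \<comment> \<open>The description of the common element in the second set is moved by a
      permutation that fixes the atoms of its first description. The element itself therefore stays
      in place, and the induction hypothesis identifies the codes.\<close>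
    have down: "elem_code N v (code_expr (EUnion cs')) s' N M"
      if *: "eval (EUnion cs) (dig N s) = eval (EUnion cs') (dig N s')"
        "elem_code N v (code_expr (EUnion cs)) s N M" "s < K" "s' < K"
        "code_expr (EUnion cs) < M" "code_expr (EUnion cs') < M"
        "code_expr (EUnion cs) + code_expr (EUnion cs') = ?S" for cs cs' s s' v
    proof -
      obtain e1 xs \<phi> s1 where 1: "Builder e1 xs \<phi> \<in> set cs" "s1 < K"
          "v = ev_code (code_expr e1) s1 N M" "eval e1 (dig N s1) \<in> velems (eval (EUnion cs) (dig N s))"
        using elem_codeE[OF *(5,3,2)] by metis
      then obtain e2 ys \<psi> \<tau> where 2: "Builder e2 ys \<psi> \<in> set cs'"
          "\<And>y. y \<notin> set ys \<Longrightarrow> \<tau> y = dig N s' y" "sat \<psi> \<tau>" "eval e1 (dig N s1) = eval e2 \<tau>"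
        unfolding *(1) velems_eval_iff by blast
      obtain \<pi> s2 where 3: "bij \<pi>" "\<And>a. a \<in> rng (dig N s1) \<Longrightarrow> \<pi> a = a" "s2 < K"
          "eval e2 (dig N s2) = act \<pi> (eval e2 \<tau>)"
          "elem_code N (ev_code (code_expr e2) s2 N M) (code_expr (EUnion cs')) s' N M"
      proof (rule move_elem[OF *(6,4) 2(1-3)])
        show "rng (dig N s1) \<subseteq> {..<N}" by (rule rng_dig)
        show "card (rng (dig N s1)) \<le> 2 * M" using card_rng[of "dig N s1"] by simp
      qed (assumption, rule that)
      note sub = code_sub[OF *(5) 1(1)] code_sub[OF *(6) 2(1)]
      have "eval e2 (dig N s2) = eval e1 (dig N s1)"
        unfolding 3(4) 2(4)[symmetric] using 3(1) sub(2) 3(2) by (rule act_fix)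
      then have "v = ev_code (code_expr e2) s2 N M"
        unfolding 1(3) using IH[of e1 e2 s1 s2] sub(1,2,5,6) *(7) 1(2) 3(3) by simp
      then show ?thesis using 3(5) by simp
    qed
    \<comment> \<open>Here the element \<open>u\<close> does move. Its image has a code in both
      sets, and since the permutation fixes the atoms of the second set, the membership of the image
      can be moved back to \<open>u\<close>.\<close>
    have up: "u \<in> velems (eval (EUnion cs') (dig N s'))"
      if *: "\<And>v. elem_code N v (code_expr (EUnion cs)) s N M \<longleftrightarrow> elem_code N v (code_expr (EUnion cs')) s' N M"
        "u \<in> velems (eval (EUnion cs) (dig N s))" "s < K" "s' < K"
        "code_expr (EUnion cs) < M" "code_expr (EUnion cs') < M"
        "code_expr (EUnion cs) + code_expr (EUnion cs') = ?S" for cs cs' s s' u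
    proof -
      obtain e1 xs \<phi> \<tau> where 1: "Builder e1 xs \<phi> \<in> set cs" "\<And>y. y \<notin> set xs \<Longrightarrow> \<tau> y = dig N s y"
          "sat \<phi> \<tau>" "u = eval e1 \<tau>"
        using *(2) unfolding velems_eval_iff by blast
      obtain \<pi> s1 where 2: "bij \<pi>" "\<And>a. a \<in> rng (dig N s') \<Longrightarrow> \<pi> a = a" "s1 < K"
          "eval e1 (dig N s1) = act \<pi> (eval e1 \<tau>)"
          "elem_code N (ev_code (code_expr e1) s1 N M) (code_expr (EUnion cs)) s N M"
      proof (rule move_elem[OF *(5,3) 1(1-3)])
        show "rng (dig N s') \<subseteq> {..<N}" by (rule rng_dig)
        show "card (rng (dig N s')) \<le> 2 * M" using card_rng[of "dig N s'"] by simp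
      qed (assumption, rule that)
      obtain e2 ys \<psi> s2 where 3: "Builder e2 ys \<psi> \<in> set cs'" "s2 < K"
          "ev_code (code_expr e1) s1 N M = ev_code (code_expr e2) s2 N M"
          "eval e2 (dig N s2) \<in> velems (eval (EUnion cs') (dig N s'))"
        using elem_codeE[OF *(6,4) 2(5)[unfolded *(1)]] by metis
      note sub = code_sub[OF *(5) 1(1)] code_sub[OF *(6) 3(1)]
      have "eval e2 (dig N s2) = act \<pi> u"
        using IH[of e1 e2 s1 s2] sub(1,2,5,6) *(7) 2(3,4) 3(2,3) 1(4) by simp
      then have "act \<pi> u \<in> velems (act \<pi> (eval (EUnion cs') (dig N s')))"
        using 3(4) act_fix[OF 2(1) *(6) 2(2)] by simp
      then show ?thesis unfolding velems_act using act_inject[OF 2(1)] by auto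
    qed
    have c: "code_expr (EUnion bs) < M" "code_expr (EUnion bs') < M" using less.prems e by auto
    show ?thesis
    proof
      assume "ev_code (code_expr e) t N M = ev_code (code_expr e') t' N M"
      then have eq: "elem_code N v (code_expr (EUnion bs)) t N M \<longleftrightarrow> elem_code N v (code_expr (EUnion bs')) t' N M" for v
        unfolding e using ev_code_EUnion(2)[OF less.prems(3)] ev_code_EUnion(2)[OF less.prems(4)] by metis
      have "velems (eval e (dig N t)) = velems (eval e' (dig N t'))"
        unfolding e
        using up[OF eq _ less.prems(3,4) c] up[OF eq[symmetric] _ less.prems(4,3) c(2,1)]
        by (intro equalityI subsetI) (auto simp only: add.commute)
      then show "eval e (dig N t) = eval e' (dig N t')"
        by (rule val_set_eqI[rotated 2]) (simp_all only: e eval.simps)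
    next
      assume "eval e (dig N t) = eval e' (dig N t')"
      then have eq: "eval (EUnion bs) (dig N t) = eval (EUnion bs') (dig N t')" unfolding e .
      show "ev_code (code_expr e) t N M = ev_code (code_expr e') t' N M"
        unfolding e
      proof (rule mem_ext)
        fix v
        show "mem v (ev_code (code_expr (EUnion bs)) t N M) = mem v (ev_code (code_expr (EUnion bs')) t' N M)"
          unfolding ev_code_EUnion(2)[OF less.prems(3)] ev_code_EUnion(2)[OF less.prems(4)]
          using down[OF eq _ less.prems(3,4) c] down[OF eq[symmetric] _ less.prems(4,3) c(2,1)]
          by (auto simp only: add.commute)
      qed (rule ev_code_EUnion less.prems)+
    qed
  qed
qed

end

section \<open>Steiner trees and connectivity\<close>

text \<open>Linked vertices may be equal.\<close>

definition link :: "val set \<Rightarrow> (val \<times> val) set" where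
  "link E = {(u, v). \<exists>d\<in>E. u \<in> velems d \<and> v \<in> velems d}"

lemma upair_commute: "upair u v = upair v u"
proof -
  have "velems (upair u v) = velems (upair v u)" by (auto simp: velems_upair)
  then show ?thesis by (rule val_set_eqI[rotated 2]) (auto simp: upair_def)
qed

lemma upair_eq_iff: "upair u v = upair x y \<longleftrightarrow> (u = x \<and> v = y) \<or> (u = y \<and> v = x)"
proof
  assume "upair u v = upair x y"
  then have "{u, v} = {x, y}" using velems_upair by metis
  then show "(u = x \<and> v = y) \<or> (u = y \<and> v = x)" by (simp only: doubleton_eq_iff)
qed (use upair_commute in auto)

lemma sym_link: "sym (link E)" unfolding link_def sym_def by auto

lemma link_rtrancl_sym: "(u, v) \<in> (link E)\<^sup>* \<Longrightarrow> (v, u) \<in> (link E)\<^sup>*"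
  using sym_rtrancl[OF sym_link] by (rule symD)

lemma link_mono: "E \<subseteq> E' \<Longrightarrow> (link E)\<^sup>* \<subseteq> (link E')\<^sup>*"
  by (rule rtrancl_mono) (auto simp: link_def)

lemma upair_link: "upair u v \<in> E \<Longrightarrow> (u, v) \<in> link E"
  unfolding link_def using velems_upair by auto

lemma is_graph_subset: "is_graph V E \<Longrightarrow> E' \<subseteq> E \<Longrightarrow> is_graph V E'"
  unfolding is_graph_def by blast

lemma link_upair:
  assumes "is_graph V E" "(u, v) \<in> link E" "u \<noteq> v" shows "upair u v \<in> E"
proof -
  obtain d where d: "d \<in> E" "u \<in> velems d" "v \<in> velems d" using assms(2) unfolding link_def by auto
  obtain x y where "d = upair x y" using assms(1) d(1) unfolding is_graph_def by blast
  then show ?thesis using d assms(3) upair_commute by (auto simp: velems_upair)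
qed

lemma link_rtrancl_upair:
  assumes "is_graph V E" "(u, v) \<in> (link E)\<^sup>*" shows "(u, v) \<in> {(x, y). upair x y \<in> E}\<^sup>*"
  using assms(2)
proof (induction rule: rtrancl_induct)
  case (step y z)
  then show ?case using link_upair[OF assms(1) step(2)] by (cases "y = z") (auto intro: rtrancl_into_rtrancl)
qed simp

text \<open>Every vertex other than the root is joined to one neighbour of smaller distance. The
  result is acyclic because on a cycle both neighbours of a vertex of maximal distance would have to
  be its parent.\<close>

lemma spanning_tree:
  assumes G: "is_graph V E" and r: "r \<in> V"
  shows "\<exists>D. is_tree_in {v. (r, v) \<in> (link E)\<^sup>*} D V E"
proof -
  define R where "R = {(x, y). upair x y \<in> E}"
  define T where "T = {v. (r, v) \<in> (link E)\<^sup>*}"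
  have T: "v \<in> T \<longleftrightarrow> (r, v) \<in> R\<^sup>*" for v
  proof
    show "v \<in> T \<Longrightarrow> (r, v) \<in> R\<^sup>*" unfolding T_def R_def using link_rtrancl_upair[OF G] by blast
    have "R \<subseteq> link E" unfolding R_def using upair_link by auto
    then show "(r, v) \<in> R\<^sup>* \<Longrightarrow> v \<in> T" unfolding T_def using rtrancl_mono by blast
  qed
  define dst where "dst v = (LEAST n. (r, v) \<in> R ^^ n)" for v
  have dst: "(r, v) \<in> R ^^ dst v" if "v \<in> T" for v
    unfolding dst_def using that T rtrancl_imp_relpow by (metis LeastI_ex)
  have dst_le: "dst v \<le> n" if "(r, v) \<in> R ^^ n" for v n
    unfolding dst_def using that by (rule Least_le)
  have "\<exists>p. p \<in> T \<and> dst p < dst v \<and> upair v p \<in> E" if v: "v \<in> T" "v \<noteq> r" for v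
  proof (cases "dst v")
    case 0
    then show ?thesis using dst[OF v(1)] v(2) by simp
  next
    case (Suc n)
    then obtain p where p: "(r, p) \<in> R ^^ n" "(p, v) \<in> R" using dst[OF v(1)] by auto
    then have "p \<in> T" using T relpow_imp_rtrancl by blast
    moreover have "dst p < dst v" using dst_le[OF p(1)] Suc by simp
    moreover have "upair v p \<in> E" using p(2) upair_commute unfolding R_def by auto
    ultimately show ?thesis by blast
  qed
  then obtain par where par: "\<And>v. v \<in> T \<Longrightarrow> v \<noteq> r \<Longrightarrow> par v \<in> T"
      "\<And>v. v \<in> T \<Longrightarrow> v \<noteq> r \<Longrightarrow> dst (par v) < dst v"
      "\<And>v. v \<in> T \<Longrightarrow> v \<noteq> r \<Longrightarrow> upair v (par v) \<in> E" by metis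
  define D where "D = {upair v (par v) | v. v \<in> T \<and> v \<noteq> r}"
  have "T \<subseteq> V"
  proof
    fix v assume "v \<in> T"
    then have "(r, v) \<in> R\<^sup>*" using T by blast
    then show "v \<in> V"
    proof (induction rule: rtrancl_induct)
      case (step y z)
      then obtain a b where "a \<in> V" "b \<in> V" "upair y z = upair a b"
        using G unfolding is_graph_def R_def by blast
      then show ?case unfolding upair_eq_iff by auto
    qed (rule r)
  qed
  moreover have "D \<subseteq> E" unfolding D_def using par(3) by blast
  moreover have "is_graph T D"
    unfolding is_graph_def
  proof
    fix d assume "d \<in> D"
    then obtain v where "v \<in> T" "v \<noteq> r" "d = upair v (par v)" unfolding D_def by blast
    then show "\<exists>u\<in>T. \<exists>w\<in>T. u \<noteq> w \<and> d = upair u w"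
      using par(1,2)[of v] by (metis less_irrefl)
  qed
  ultimately have sub: "is_subgraph T D V E" unfolding is_subgraph_def by blast
  let ?D = "{(x, y). upair x y \<in> D}"
  have "sym ?D" unfolding sym_def using upair_commute by auto
  then have symD: "(u, v) \<in> ?D\<^sup>* \<Longrightarrow> (v, u) \<in> ?D\<^sup>*" for u v using sym_rtrancl symD by metis
  have root: "(v, r) \<in> ?D\<^sup>*" if "v \<in> T" for v
    using that
  proof (induction "dst v" arbitrary: v rule: less_induct)
    case less
    show ?case
    proof (cases "v = r")
      case False
      then have "(par v, r) \<in> ?D\<^sup>*" using less par(1,2) by blast
      moreover have "(v, par v) \<in> ?D" unfolding D_def using less(2) False by blast
      ultimately show ?thesis by (rule converse_rtrancl_into_rtrancl[rotated])
    qed simp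
  qed
  have "connected_graph T D"
    unfolding connected_graph_def
  proof (intro ballI)
    fix u v assume "u \<in> T" "v \<in> T"
    then show "(u, v) \<in> ?D\<^sup>*" using root symD rtrancl_trans[of u r ?D v] by blast
  qed
  moreover have "acyclic_graph D"
    unfolding acyclic_graph_def
  proof
    assume "\<exists>c. is_cycle D c"
    then obtain c where c: "3 \<le> length c" "distinct c"
        "\<And>i. i < length c \<Longrightarrow> upair (c ! i) (c ! (Suc i mod length c)) \<in> D"
      unfolding is_cycle_def by blast
    let ?n = "length c"
    define m where "m = Max ((\<lambda>i. dst (c ! i)) ` {..<?n})"
    have "m \<in> (\<lambda>i. dst (c ! i)) ` {..<?n}" unfolding m_def using c(1) by (intro Max_in) (auto simp: lessThan_empty_iff)
    then obtain i where i: "i < ?n" "m = dst (c ! i)" by auto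
    have max: "dst (c ! k) \<le> dst (c ! i)" if "k < ?n" for k
      unfolding i(2)[symmetric] m_def using that by (intro Max_ge) auto
    \<comment> \<open>Every edge of \<open>D\<close> joins a vertex to a parent of strictly smaller
      distance, so the end \<open>x\<close>, whose distance is not smaller, must be the
      child.\<close>
    have up: "y = par x" if "upair x y \<in> D" "dst y \<le> dst x" for x y
    proof -
      obtain v where v: "v \<in> T" "v \<noteq> r" "upair x y = upair v (par v)" using \<open>upair x y \<in> D\<close> unfolding D_def by blast
      then show ?thesis using par(2)[OF v(1,2)] that(2) unfolding upair_eq_iff by auto
    qed
    \<comment> \<open>\<open>k\<close> and \<open>j\<close> are the cyclic predecessor and successor
      of \<open>i\<close>; they differ because a cycle has at least three vertices.\<close>
    define k where "k = (if i = 0 then ?n - 1 else i - 1)"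
    have k: "k < ?n" "Suc k mod ?n = i" unfolding k_def using i c(1) by auto
    define j where "j = Suc i mod ?n"
    have j: "j < ?n" unfolding j_def using i(1) by (intro mod_less_divisor) linarith
    have "c ! j = par (c ! i)" using up c(3)[OF i(1)] max[OF j] unfolding j_def by blast
    moreover have "c ! k = par (c ! i)"
      using up c(3)[OF k(1)] max[OF k(1)] unfolding k(2) by (metis upair_commute)
    ultimately have "j = k" using c(2) j k(1) by (metis nth_eq_iff_index_eq)
    moreover have "j \<noteq> k"
      unfolding j_def k_def using i(1) c(1) by (cases "Suc i = ?n") auto
    ultimately show False by blast
  qed
  ultimately have "is_tree_in T D V E" unfolding is_tree_in_def using sub by blast
  then show ?thesis unfolding T_def by blast
qed

lemma finite_path:
  assumes "(u, v) \<in> (link E)\<^sup>*" shows "\<exists>P\<subseteq>E. finite P \<and> (u, v) \<in> (link P)\<^sup>*"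
  using assms
proof (induction rule: rtrancl_induct)
  case (step y z)
  then obtain P where P: "P \<subseteq> E" "finite P" "(u, y) \<in> (link P)\<^sup>*" by blast
  obtain d where d: "d \<in> E" "y \<in> velems d" "z \<in> velems d" using step(2) unfolding link_def by auto
  have "(u, y) \<in> (link (insert d P))\<^sup>*" using P(3) link_mono[of P "insert d P"] by blast
  moreover have "(y, z) \<in> link (insert d P)" unfolding link_def using d by auto
  ultimately have "(u, z) \<in> (link (insert d P))\<^sup>*" by (rule rtrancl_into_rtrancl)
  then show ?case using P d(1) by (intro exI[of _ "insert d P"]) simp
qed blast

text \<open>In a tree as required, follow the path from \<open>w\<close> to a fixed
  \<open>w0\<close> up to the first endpoint of an edge from \<open>F\<close>: this part avoids
  \<open>F\<close>, and only finitely many such endpoints exist, which together with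
  \<open>w0\<close> form \<open>C\<close>.\<close>

lemma steiner_iff:
  assumes G: "is_graph V E" and W: "W \<subseteq> V" and F: "F \<subseteq> E"
  shows "has_steiner_tree V E W F \<longleftrightarrow>
    (\<forall>w\<in>W. \<forall>w'\<in>W. (w, w') \<in> (link E)\<^sup>*) \<and>
    (\<exists>C. finite C \<and> (\<forall>w\<in>W. \<exists>c\<in>C. (w, c) \<in> (link (E - F))\<^sup>*))" (is "_ \<longleftrightarrow> ?A \<and> ?B")
proof
  assume "has_steiner_tree V E W F"
  then obtain T D where TD: "is_tree_in T D V E" "W \<subseteq> T" "finite (D \<inter> F)"
    unfolding has_steiner_tree_def by blast
  then have D: "D \<subseteq> E" "connected_graph T D" "is_graph T D"
    unfolding is_tree_in_def is_subgraph_def by auto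
  let ?D = "{(x, y). upair x y \<in> D}"
  have conn: "(w, w') \<in> ?D\<^sup>*" if "w \<in> W" "w' \<in> W" for w w'
    using D(2) TD(2) that unfolding connected_graph_def by blast
  have "?D \<subseteq> link E" using D(1) upair_link by auto
  then have ?A using conn rtrancl_mono by blast
  moreover have ?B
  proof (cases "W = {}")
    case False
    then obtain w0 where w0: "w0 \<in> W" by blast
    define C where "C = insert w0 (\<Union>d\<in>D \<inter> F. velems d)"
    have "finite (velems d)" if "d \<in> D" for d
    proof -
      obtain x y where "d = upair x y" using D(3) \<open>d \<in> D\<close> unfolding is_graph_def by blast
      then show ?thesis by (simp add: velems_upair)
    qed
    then have "finite C" unfolding C_def using TD(3) by auto
    moreover have "\<exists>c\<in>C. (w, c) \<in> (link (E - F))\<^sup>*" if "w \<in> W" for w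
      using conn[OF that w0]
    proof (induction rule: converse_rtrancl_induct)
      case base
      then show ?case unfolding C_def by blast
    next
      case (step x y)
      have xy: "upair x y \<in> D" using step(1) by simp
      show ?case
      proof (cases "upair x y \<in> F")
        case True
        then have "x \<in> C" unfolding C_def using xy velems_upair by blast
        then show ?thesis by blast
      next
        case False
        then have "(x, y) \<in> link (E - F)" using upair_link xy D(1) by blast
        then show ?thesis using step(3) by (meson converse_rtrancl_into_rtrancl)
      qed
    qed
    ultimately show ?thesis by blast
  qed auto
  ultimately show "?A \<and> ?B" by blast
next
  assume "?A \<and> ?B"
  then obtain C where A: ?A and C: "finite C" "\<And>w. w \<in> W \<Longrightarrow> \<exists>c\<in>C. (w, c) \<in> (link (E - F))\<^sup>*" by blast
  show "has_steiner_tree V E W F"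
  proof (cases "W = {}")
    case True
    have "\<not> is_cycle {} c" for c unfolding is_cycle_def by (cases c) auto
    then have "is_tree_in {} {} V E"
      unfolding is_tree_in_def is_subgraph_def is_graph_def connected_graph_def acyclic_graph_def by auto
    then show ?thesis unfolding has_steiner_tree_def using True by blast
  next
    case False
    then obtain w0 where w0: "w0 \<in> W" by blast
    \<comment> \<open>Points of \<open>C\<close> that no vertex of \<open>W\<close> reaches are
      dropped, as they need not be connected to \<open>w0\<close> at all.\<close>
    define C1 where "C1 = {c \<in> C. \<exists>w\<in>W. (w, c) \<in> (link (E - F))\<^sup>*}"
    have "\<exists>P\<subseteq>E. finite P \<and> (w0, c) \<in> (link P)\<^sup>*" if c: "c \<in> C1" for c
    proof -
      obtain w where w: "w \<in> W" "(w, c) \<in> (link (E - F))\<^sup>*" using c unfolding C1_def by blast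
      have "(w, c) \<in> (link E)\<^sup>*" using w(2) link_mono[of "E - F" E] by blast
      then have "(w0, c) \<in> (link E)\<^sup>*" using A w(1) w0 rtrancl_trans by metis
      then show ?thesis by (rule finite_path)
    qed
    then obtain P where P: "\<And>c. c \<in> C1 \<Longrightarrow> P c \<subseteq> E" "\<And>c. c \<in> C1 \<Longrightarrow> finite (P c)"
        "\<And>c. c \<in> C1 \<Longrightarrow> (w0, c) \<in> (link (P c))\<^sup>*" by metis
    define E' where "E' = (E - F) \<union> (\<Union>c\<in>C1. P c)"
    have E': "E' \<subseteq> E" unfolding E'_def using P(1) by blast
    have fin: "finite (E' \<inter> F)"
    proof (rule finite_subset)
      show "E' \<inter> F \<subseteq> (\<Union>c\<in>C1. P c)" unfolding E'_def by blast
      show "finite (\<Union>c\<in>C1. P c)" using P(2) C(1) unfolding C1_def by auto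
    qed
    obtain D where D: "is_tree_in {v. (w0, v) \<in> (link E')\<^sup>*} D V E'"
      using spanning_tree[OF is_graph_subset[OF G E']] w0 W by blast
    have "is_tree_in {v. (w0, v) \<in> (link E')\<^sup>*} D V E"
      using D E' unfolding is_tree_in_def is_subgraph_def by blast
    moreover have "(w0, w) \<in> (link E')\<^sup>*" if "w \<in> W" for w
    proof -
      obtain c where c: "c \<in> C" "(w, c) \<in> (link (E - F))\<^sup>*" using C(2) \<open>w \<in> W\<close> by blast
      then have "c \<in> C1" unfolding C1_def using \<open>w \<in> W\<close> by blast
      then have "(w0, c) \<in> (link E')\<^sup>*" using P(3) link_mono[of "P c" E'] unfolding E'_def by blast
      moreover have "(c, w) \<in> (link E')\<^sup>*"
        using link_rtrancl_sym[OF c(2)] link_mono[of "E - F" E'] unfolding E'_def by blast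
      ultimately show ?thesis by (rule rtrancl_trans)
    qed
    moreover have "finite (D \<inter> F)"
      using fin D unfolding is_tree_in_def is_subgraph_def by (meson finite_subset inf_mono order_refl)
    ultimately show ?thesis unfolding has_steiner_tree_def by blast
  qed
qed

section \<open>Transfer of connectivity\<close>

text \<open>Values are well-founded. The pair \<open>{x, {x, y}}\<close> depends on this, because
  its two elements are told apart only by which of them lies in the other.\<close>

lemma mem_asym: "u \<in> velems v \<Longrightarrow> v \<notin> velems u"
proof (induction v arbitrary: u)
  case (St X)
  then show ?case using St.IH[of u "St X"] by auto
qed simp

lemma vpair_inject: "vpair a b = vpair c d \<longleftrightarrow> a = c \<and> b = d"
proof
  have m: "x \<in> velems (upair x y)" for x y by (simp add: velems_upair)
  assume "vpair a b = vpair c d"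
  then show "a = c \<and> b = d"
    unfolding vpair_def upair_eq_iff using m mem_asym by metis
qed simp

definition linkc :: "(nat \<Rightarrow> bool) \<Rightarrow> (nat \<times> nat) set" where
  "linkc P = {(v, y). \<exists>n. P n \<and> mem v n \<and> mem y n}"

text \<open>The notion of support known from nominal sets.\<close>

definition supports :: "atom set \<Rightarrow> val \<Rightarrow> bool" where
  "supports X u \<longleftrightarrow> (\<forall>\<pi>. bij \<pi> \<longrightarrow> (\<forall>a\<in>X. \<pi> a = a) \<longrightarrow> act \<pi> u = u)"

lemma supportsD: "supports X u \<Longrightarrow> bij \<pi> \<Longrightarrow> (\<And>a. a \<in> X \<Longrightarrow> \<pi> a = a) \<Longrightarrow> act \<pi> u = u"
  unfolding supports_def by blast

context finite_atoms
begin

text \<open>The partial isomorphism between hereditarily countable sets and codes of hereditarily finite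
  sets: both sides are the value of one expression, once with all atoms and once with the
  atoms below \<open>N\<close>.\<close>

definition matches :: "val \<Rightarrow> nat \<Rightarrow> bool" where
  "matches u v \<longleftrightarrow> (\<exists>e t. code_expr e < M \<and> t < K \<and> u = eval e (dig N t) \<and> v = ev_code (code_expr e) t N M)"

text \<open>In contrast to \<open>matches\<close>, the valuation may use atoms beyond
  \<open>N\<close>; these are the values that can be moved into the finite structure.\<close>

definition represented :: "val \<Rightarrow> bool" where
  "represented u \<longleftrightarrow> (\<exists>e \<tau>. code_expr e < M \<and> u = eval e \<tau>)"

lemma matches_represented: "matches u v \<Longrightarrow> represented u"
  unfolding matches_def represented_def by blast

lemma matches_eq_iff: "matches u v \<Longrightarrow> matches u' v' \<Longrightarrow> u = u' \<longleftrightarrow> v = v'"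
  unfolding matches_def using ev_code_eq_iff by metis

text \<open>There is no counterpart from elements of \<open>u\<close> to elements of
  \<open>v\<close>: the former may involve atoms beyond \<open>N\<close> and then match no
  code.\<close>

lemma matches_down:
  assumes "matches u v" "mem v' v" shows "\<exists>u'\<in>velems u. matches u' v'"
proof -
  obtain e t where e: "code_expr e < M" "t < K" "u = eval e (dig N t)" "v = ev_code (code_expr e) t N M"
    using assms(1) unfolding matches_def by blast
  show ?thesis
  proof (cases e)
    case (EVar x)
    then show ?thesis using assms(2) unfolding mem_def e(4) by (simp only: ev_code_var'[OF e(2)]) simp
  next
    case (EUnion bs)
    have el: "elem_code N v' (code_expr (EUnion bs)) t N M"
      using assms(2) unfolding e(4) EUnion ev_code_EUnion(2)[OF e(2)] .
    obtain e' xs \<phi> t' where *: "Builder e' xs \<phi> \<in> set bs" "t' < K"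
      "v' = ev_code (code_expr e') t' N M" "eval e' (dig N t') \<in> velems u"
      using elem_codeE[OF e(1)[unfolded EUnion] e(2) el] unfolding EUnion e(3) by metis
    then show ?thesis unfolding matches_def using code_sub(2)[OF e(1)[unfolded EUnion]] by blast
  qed
qed

lemma represented_down: "represented u \<Longrightarrow> u' \<in> velems u \<Longrightarrow> represented u'"
proof -
  assume "represented u" "u' \<in> velems u"
  then obtain e \<tau> where e: "code_expr e < M" "u' \<in> velems (eval e \<tau>)" unfolding represented_def by blast
  then obtain bs where bs: "e = EUnion bs" by (cases e) auto
  obtain e1 xs \<phi> \<rho> where 1: "Builder e1 xs \<phi> \<in> set bs" "u' = eval e1 \<rho>"
    using e(2) unfolding bs velems_eval_iff by blast
  show "represented u'"
    unfolding represented_def using code_sub(2)[OF e(1)[unfolded bs] 1(1)] 1(2) by blast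
qed

text \<open>From sets to codes, the description of \<open>u'\<close> as an element of
  \<open>u\<close> is moved with the atoms of its other description held fixed, so that
  \<open>u'\<close> itself stays in place.\<close>

lemma matches_mem:
  assumes "matches u v" "matches u' v'" shows "u' \<in> velems u \<longleftrightarrow> mem v' v"
proof
  assume "mem v' v"
  then show "u' \<in> velems u" using matches_down[OF assms(1)] matches_eq_iff[OF assms(2)] by metis
next
  assume u': "u' \<in> velems u"
  obtain e t where e: "code_expr e < M" "t < K" "u = eval e (dig N t)" "v = ev_code (code_expr e) t N M"
    using assms(1) unfolding matches_def by blast
  obtain e' s where e': "code_expr e' < M" "s < K" "u' = eval e' (dig N s)" "v' = ev_code (code_expr e') s N M"
    using assms(2) unfolding matches_def by blast
  obtain bs where bs: "e = EUnion bs" using u' e(3) by (cases e) auto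
  obtain e1 xs \<phi> \<tau> where 1: "Builder e1 xs \<phi> \<in> set bs" "\<And>y. y \<notin> set xs \<Longrightarrow> \<tau> y = dig N t y"
      "sat \<phi> \<tau>" "u' = eval e1 \<tau>"
    using u' unfolding e(3) bs velems_eval_iff by blast
  obtain \<pi> t' where 2: "bij \<pi>" "\<And>a. a \<in> rng (dig N s) \<Longrightarrow> \<pi> a = a" "t' < K"
      "eval e1 (dig N t') = act \<pi> (eval e1 \<tau>)"
      "elem_code N (ev_code (code_expr e1) t' N M) (code_expr (EUnion bs)) t N M"
  proof (rule move_elem[OF e(1)[unfolded bs] e(2) 1(1-3)])
    show "rng (dig N s) \<subseteq> {..<N}" by (rule rng_dig)
    show "card (rng (dig N s)) \<le> 2 * M" using card_rng[of "dig N s"] by simp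
  qed (assumption, rule that)
  have "act \<pi> u' = u'" unfolding e'(3) using 2(1) e'(1) 2(2) by (rule act_fix)
  then have "eval e1 (dig N t') = u'" using 2(4) 1(4) by simp
  then have "matches u' (ev_code (code_expr e1) t' N M)"
    unfolding matches_def using code_sub(2)[OF e(1)[unfolded bs] 1(1)] 2(3) by metis
  then have "v' = ev_code (code_expr e1) t' N M" using matches_eq_iff[OF assms(2)] by blast
  then show "mem v' v" using 2(5) unfolding e(4) bs ev_code_EUnion(2)[OF e(2)] by simp
qed

lemma matches_supported:
  assumes "matches u v" obtains X where "X \<subseteq> {..<N}" "card X \<le> M" "supports X u"
proof -
  obtain e t where e: "code_expr e < M" "t < K" "u = eval e (dig N t)"
    using assms unfolding matches_def by blast
  have "supports (rng (dig N t)) u"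
    unfolding supports_def e(3) using act_fix e(1) by blast
  then show ?thesis using that rng_dig card_rng by blast
qed

lemma matches_eval:
  assumes "code_expr e < M" "\<And>y. y < M \<Longrightarrow> \<tau> y < N" shows "\<exists>v. matches (eval e \<tau>) v"
proof -
  obtain t where t: "t < K" "\<And>y. y < M \<Longrightarrow> dig N t y = \<tau> y"
    using dig_obtain[of \<tau>] assms(2) by blast
  have "eval e \<tau> = eval e (dig N t)" using assms(1) by (rule eval_cong_M) (simp add: t(2))
  then show ?thesis unfolding matches_def using t(1) assms(1) by blast
qed

text \<open>One permutation has to move both values, since a relation between them is to be
  preserved: a vertex lying on an edge, or two vertices being connected.\<close>

lemma represented_move2:
  assumes "represented u" "represented u'" "X \<subseteq> {..<N}" "card X \<le> 6 * M"
  obtains \<pi> v v' where "bij \<pi>" "\<And>a. a \<in> X \<Longrightarrow> \<pi> a = a" "matches (act \<pi> u) v" "matches (act \<pi> u') v'"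
proof -
  obtain e \<tau> where e: "code_expr e < M" "u = eval e \<tau>" using assms(1) unfolding represented_def by blast
  obtain e' \<tau>' where e': "code_expr e' < M" "u' = eval e' \<tau>'" using assms(2) unfolding represented_def by blast
  have "card (rng \<tau> \<union> rng \<tau>') \<le> card (rng \<tau>) + card (rng \<tau>')" by (rule card_Un_le)
  then have "card X + card (rng \<tau> \<union> rng \<tau>') \<le> N"
    using card_rng[of \<tau>] card_rng[of \<tau>'] N assms(4) by simp
  then obtain \<pi> where \<pi>: "bij \<pi>" "\<And>a. a \<in> X \<Longrightarrow> \<pi> a = a" "\<And>a. a \<in> rng \<tau> \<union> rng \<tau>' \<Longrightarrow> \<pi> a < N"
    using bij_move[of "rng \<tau> \<union> rng \<tau>'" X N] assms(3) by (metis finite_UnI finite_rng)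
  have "\<exists>v. matches (eval e (\<pi> \<circ> \<tau>)) v"
    using e(1) by (rule matches_eval) (use \<pi>(3) rng_mem in auto)
  moreover have "\<exists>v'. matches (eval e' (\<pi> \<circ> \<tau>')) v'"
    using e'(1) by (rule matches_eval) (use \<pi>(3) rng_mem in auto)
  ultimately obtain v v' where "matches (act \<pi> u) v" "matches (act \<pi> u') v'"
    unfolding e(2) e'(2) eval_perm(1)[OF \<pi>(1), symmetric] by blast
  with \<pi>(1,2) show ?thesis by (rule that)
qed

text \<open>The permutation that moves the value into the finite structure may be chosen to fix a
  support of it, and then the value has not moved. This covers parts of the inputs that no
  expression presents directly.\<close>

lemma supported_matches:
  assumes "represented u" "supports X u" "X \<subseteq> {..<N}" "card X \<le> 6 * M" shows "\<exists>v. matches u v"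
  using represented_move2[OF assms(1,1,3,4)] supportsD[OF assms(2)] by metis

lemma link_rtrancl_act:
  assumes "\<And>d. d \<in> Ed \<Longrightarrow> act \<pi> d \<in> Ed" "(u, v) \<in> (link Ed)\<^sup>*"
  shows "(act \<pi> u, act \<pi> v) \<in> (link Ed)\<^sup>*"
  using assms(2)
proof (induction rule: rtrancl_induct)
  case (step y z)
  then obtain d where "d \<in> Ed" "y \<in> velems d" "z \<in> velems d" unfolding link_def by blast
  then have "(act \<pi> y, act \<pi> z) \<in> link Ed"
    unfolding link_def using assms(1) velems_act by blast
  then show ?case using step(3) by (rule rtrancl_into_rtrancl[rotated])
qed simp

text \<open>From codes to values a path is lifted edge by edge. In the other direction the inner
  vertices may use atoms beyond \<open>N\<close>, and the path as a whole unboundedly many. One edge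
  is treated at a time: its permutation fixes the atoms of the start \<open>u\<close> and of the
  current end \<open>u'\<close> and moves everything between them, so that the last edge still ends
  in \<open>u'\<close> and the shorter path still starts at \<open>u\<close>.\<close>

lemma link_transfer:
  assumes S: "S \<subseteq> {..<N}" "card S \<le> 3 * M"
    and perm: "\<And>\<pi> d. bij \<pi> \<Longrightarrow> (\<And>a. a \<in> S \<Longrightarrow> \<pi> a = a) \<Longrightarrow> d \<in> Ed \<Longrightarrow> act \<pi> d \<in> Ed"
    and Ed: "\<And>d. d \<in> Ed \<Longrightarrow> represented d"
    and P: "\<And>d n. matches d n \<Longrightarrow> d \<in> Ed \<longleftrightarrow> P n" "\<And>n. P n \<Longrightarrow> \<exists>d. matches d n"
    and u: "matches u v" "matches u' v'"
  shows "(u, u') \<in> (link Ed)\<^sup>* \<longleftrightarrow> (v, v') \<in> (linkc P)\<^sup>*"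
proof
  assume "(v, v') \<in> (linkc P)\<^sup>*"
  then have "\<exists>z. matches z v' \<and> (u, z) \<in> (link Ed)\<^sup>*"
  proof (induction rule: rtrancl_induct)
    case base
    then show ?case using u(1) by blast
  next
    case (step v1 v2)
    then obtain z where z: "matches z v1" "(u, z) \<in> (link Ed)\<^sup>*" by blast
    obtain n where n: "P n" "mem v1 n" "mem v2 n" using step(2) unfolding linkc_def by blast
    obtain d where d: "matches d n" using P(2)[OF n(1)] by blast
    then have dE: "d \<in> Ed" using P(1) n(1) by blast
    obtain z2 where z2: "z2 \<in> velems d" "matches z2 v2" using matches_down[OF d n(3)] by blast
    have "z \<in> velems d" using matches_mem[OF d z(1)] n(2) by blast
    then have "(z, z2) \<in> link Ed" unfolding link_def using dE z2 by blast
    then show ?case using z(2) z2(2) by (meson rtrancl_into_rtrancl)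
  qed
  then show "(u, u') \<in> (link Ed)\<^sup>*" using matches_eq_iff[OF u(2)] by metis
next
  \<comment> \<open>The induction is on the length of the path, because the hypothesis is applied
    not to the initial part of the path itself but to its image under a permutation, another path of
    the same length.\<close>
  have "(v, v') \<in> (linkc P)\<^sup>*" if "(u, u') \<in> link Ed ^^ n" "matches u' v'" for n u' v'
    using that
  proof (induction n arbitrary: u' v')
    case 0
    then have "u = u'" by simp
    then show ?case using matches_eq_iff[OF u(1) 0(2)] by simp
  next
    case (Suc n)
    then obtain z where z: "(u, z) \<in> link Ed ^^ n" "(z, u') \<in> link Ed" by auto
    obtain d where d: "d \<in> Ed" "z \<in> velems d" "u' \<in> velems d" using z(2) unfolding link_def by blast
    obtain X where X: "X \<subseteq> {..<N}" "card X \<le> M" "supports X u" using matches_supported[OF u(1)] .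
    obtain X' where X': "X' \<subseteq> {..<N}" "card X' \<le> M" "supports X' u'" using matches_supported[OF Suc.prems(2)] .
    have "card (S \<union> X \<union> X') \<le> card S + card X + card X'"
      using card_Un_le[of "S \<union> X" X'] card_Un_le[of S X] by simp
    then have "card (S \<union> X \<union> X') \<le> 6 * M" using S(2) X(2) X'(2) by simp
    moreover have "S \<union> X \<union> X' \<subseteq> {..<N}" using S(1) X(1) X'(1) by blast
    ultimately obtain \<pi> y m where \<pi>: "bij \<pi>" "\<And>a. a \<in> S \<union> X \<union> X' \<Longrightarrow> \<pi> a = a"
        "matches (act \<pi> z) y" "matches (act \<pi> d) m"
      using represented_move2[OF represented_down[OF Ed[OF d(1)] d(2)] Ed[OF d(1)]] by metis
    have fix': "act \<pi> u = u" "act \<pi> u' = u'"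
      using \<pi>(2) by (auto intro: supportsD[OF X(3) \<pi>(1)] supportsD[OF X'(3) \<pi>(1)])
    have perm': "act \<pi> d \<in> Ed" if "d \<in> Ed" for d using that \<pi> by (intro perm) auto
    have "(act \<pi> u, act \<pi> z) \<in> link Ed ^^ n"
      using z(1)
    proof (induction n arbitrary: z)
      case (Suc n)
      then obtain x where x: "(u, x) \<in> link Ed ^^ n" "(x, z) \<in> link Ed" by auto
      then obtain d where "d \<in> Ed" "x \<in> velems d" "z \<in> velems d" unfolding link_def by blast
      then have "(act \<pi> x, act \<pi> z) \<in> link Ed"
        unfolding link_def using perm' velems_act by blast
      then show ?case using Suc.IH[OF x(1)] by auto
    qed simp
    then have "(v, y) \<in> (linkc P)\<^sup>*" using Suc.IH[OF _ \<pi>(3)] fix' by simp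
    moreover have "(y, v') \<in> linkc P"
    proof -
      have "P m" using P(1)[OF \<pi>(4)] perm'[OF d(1)] by blast
      moreover have "mem y m" using matches_mem[OF \<pi>(4,3)] d(2) velems_act by blast
      moreover have "mem v' m" using matches_mem[OF \<pi>(4) Suc.prems(2)] d(3) velems_act fix'(2) by (metis imageI)
      ultimately show ?thesis unfolding linkc_def by blast
    qed
    ultimately show ?case by (rule rtrancl_into_rtrancl)
  qed
  then show "(u, u') \<in> (link Ed)\<^sup>* \<Longrightarrow> (v, v') \<in> (linkc P)\<^sup>*"
    using u(2) rtrancl_imp_relpow by metis
qed

end

section \<open>The decision procedure\<close>

text \<open>The component of \<open>v\<close> as the least set that contains \<open>v\<close> and is
  closed under the edges; the least code belongs to this set because codes respect
  inclusion.\<close>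

definition reach_code :: "nat \<Rightarrow> nat \<Rightarrow> nat \<Rightarrow> nat" where
  "reach_code r f v = (LEAST X. v \<in> set_decode X \<and> (\<forall>n<r. mem n r \<and> \<not> mem n f \<longrightarrow>
     (\<forall>a<n. \<forall>b<n. mem a n \<and> mem b n \<and> a \<in> set_decode X \<longrightarrow> b \<in> set_decode X)))"

abbreviation edge_code :: "nat \<Rightarrow> nat \<Rightarrow> nat \<Rightarrow> bool" where
  "edge_code r f n \<equiv> mem n r \<and> \<not> mem n f"

lemma reach_finite: "finite {y. (v, y) \<in> (linkc (edge_code r f))\<^sup>*}"
proof (rule finite_subset)
  show "{y. (v, y) \<in> (linkc (edge_code r f))\<^sup>*} \<subseteq> insert v {..<r}"
  proof
    fix y assume "y \<in> {y. (v, y) \<in> (linkc (edge_code r f))\<^sup>*}"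
    then have "(v, y) \<in> (linkc (edge_code r f))\<^sup>*" by simp
    then show "y \<in> insert v {..<r}"
      by (cases rule: rtrancl.cases) (auto simp: linkc_def dest!: mem_less)
  qed
qed simp

lemma reach_closed:
  "v \<in> set_decode (set_encode {y. (v, y) \<in> (linkc (edge_code r f))\<^sup>*}) \<and> (\<forall>n<r. mem n r \<and> \<not> mem n f \<longrightarrow>
     (\<forall>a<n. \<forall>b<n. mem a n \<and> mem b n \<and> a \<in> set_decode (set_encode {y. (v, y) \<in> (linkc (edge_code r f))\<^sup>*}) \<longrightarrow>
        b \<in> set_decode (set_encode {y. (v, y) \<in> (linkc (edge_code r f))\<^sup>*})))"
  unfolding set_encode_inverse[OF reach_finite] mem_Collect_eq
proof (intro conjI allI impI rtrancl_refl; elim conjE)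
  fix n a b assume "mem n r" "\<not> mem n f" "mem a n" "mem b n" "(v, a) \<in> (linkc (edge_code r f))\<^sup>*"
  moreover from this have "(a, b) \<in> linkc (edge_code r f)" unfolding linkc_def by blast
  ultimately show "(v, b) \<in> (linkc (edge_code r f))\<^sup>*" by (meson rtrancl_into_rtrancl)
qed

lemma reach_code: "y \<in> set_decode (reach_code r f v) \<longleftrightarrow> (v, y) \<in> (linkc (edge_code r f))\<^sup>*"
proof -
  have "set_decode (reach_code r f v) = {y. (v, y) \<in> (linkc (edge_code r f))\<^sup>*}"
    unfolding reach_code_def
  proof (rule set_decode_Least, rule reach_finite, rule reach_closed, rule subsetI)
    fix X y
    assume X: "v \<in> set_decode X \<and> (\<forall>n<r. mem n r \<and> \<not> mem n f \<longrightarrow>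
       (\<forall>a<n. \<forall>b<n. mem a n \<and> mem b n \<and> a \<in> set_decode X \<longrightarrow> b \<in> set_decode X))"
      and "y \<in> {y. (v, y) \<in> (linkc (edge_code r f))\<^sup>*}"
    then have "(v, y) \<in> (linkc (edge_code r f))\<^sup>*" by simp
    then show "y \<in> set_decode X"
    proof (induction rule: rtrancl_induct)
      case (step a b)
      then obtain n where "mem n r" "\<not> mem n f" "mem a n" "mem b n" unfolding linkc_def by blast
      then show ?case using X step(3) mem_less by blast
    qed (use X in blast)
  qed
  then show ?thesis by simp
qed

lemma computable_reach_code:
  assumes "computable f" "computable g" "computable h"
  shows "computable (\<lambda>x. reach_code (f x) (g x) (h x))"
proof -
  have "computable (\<lambda>x. reach_code (x 0) (x 1) (x 2))"
    unfolding reach_code_def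
    by (intro computable_Least computable_intros decidable_in_set_decode decidable_mem)
      (rule exI, rule reach_closed)
  then show ?thesis using assms by (rule computable3)
qed

text \<open>As membership has no cycles, the first component of \<open>{x, {x, y}}\<close> is the element that lies in
  another element.\<close>

definition pair_code :: "nat \<Rightarrow> nat \<Rightarrow> nat \<Rightarrow> bool" where
  "pair_code g p r \<longleftrightarrow> (\<exists>q<g. mem p g \<and> mem q g \<and> mem p q \<and> mem r q \<and> (\<forall>z<q. mem z q \<longrightarrow> z = p \<or> z = r))"

text \<open>The last conjunct expresses that \<open>W\<close> meets finitely many components of \<open>E - F\<close>; the atom \<open>N - 1\<close>
  is the one to be avoided.  In \<open>reach_code r 0\<close> no edge is excluded, since
  \<open>0\<close> codes an atom and has no elements.\<close>

definition steiner_code :: "nat \<Rightarrow> nat \<Rightarrow> nat \<Rightarrow> nat \<Rightarrow> nat \<Rightarrow> nat \<Rightarrow> nat \<Rightarrow> bool" where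
  "steiner_code g w f c t N M \<longleftrightarrow> (\<exists>p<g. \<exists>r<g. pair_code g p r \<and>
     (\<forall>v<w. \<forall>v'<w. mem v w \<and> mem v' w \<longrightarrow> v' \<in> set_decode (reach_code r 0 v)) \<and>
     (\<forall>v<w. mem v w \<longrightarrow> (\<exists>v'<reach_code r f v. elem_code (N - 1) v' c t N M \<and> v' \<in> set_decode (reach_code r f v))))"

text \<open>The parameters of all inputs stay below \<open>N - 1\<close>, so that the atom
  \<open>N - 1\<close> can be renamed while the graph, \<open>W\<close> and \<open>F\<close> remain
  fixed.\<close>

locale steiner_codes = finite_atoms +
  fixes V E W F :: "val cset" and eG eW eF :: expr and tG tW tF :: nat
  assumes codes: "code_expr eG < M" "code_expr eW < M" "code_expr eF < M"
    and vals: "tG < K" "tW < K" "tF < K"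
    and digs: "\<And>y. y < M \<Longrightarrow> dig N tG y < N - 1" "\<And>y. y < M \<Longrightarrow> dig N tW y < N - 1"
      "\<And>y. y < M \<Longrightarrow> dig N tF y < N - 1"
    and evals: "eval eG (dig N tG) = vpair (St V) (St E)" "eval eW (dig N tW) = St W"
      "eval eF (dig N tF) = St F"
    and graph: "is_graph (rcset V) (rcset E)" "rcset W \<subseteq> rcset V" "rcset F \<subseteq> rcset E"
begin

section \<open>Invariance of the inputs under permutations that fix their parameters\<close>

definition S :: "atom set" where
  "S = rng (dig N tG) \<union> rng (dig N tW) \<union> rng (dig N tF)"

definition g :: nat where "g = ev_code (code_expr eG) tG N M"
definition w :: nat where "w = ev_code (code_expr eW) tW N M"
definition f :: nat where "f = ev_code (code_expr eF) tF N M"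

abbreviation H :: "val set" where "H \<equiv> rcset E - rcset F"

lemma S: "S \<subseteq> {..<N - 1}" "S \<subseteq> {..<N}" "card S \<le> 3 * M"
proof -
  show "S \<subseteq> {..<N - 1}" unfolding S_def rng_def using digs by auto
  then show "S \<subseteq> {..<N}" by auto
  show "card S \<le> 3 * M"
    unfolding S_def
    using card_Un_le[of "rng (dig N tG) \<union> rng (dig N tW)" "rng (dig N tF)"]
      card_Un_le[of "rng (dig N tG)" "rng (dig N tW)"]
      card_rng[of "dig N tG"] card_rng[of "dig N tW"] card_rng[of "dig N tF"]
    by linarith
qed

lemma matches: "matches (vpair (St V) (St E)) g" "matches (St W) w" "matches (St F) f"
  unfolding g_def w_def f_def matches_def using codes vals evals by metis+

lemma act_fixed:
  assumes "bij \<pi>" "\<And>a. a \<in> S \<Longrightarrow> \<pi> a = a"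
  shows "act \<pi> (St V) = St V" "act \<pi> (St E) = St E" "act \<pi> (St W) = St W" "act \<pi> (St F) = St F"
proof -
  have "act \<pi> (vpair (St V) (St E)) = vpair (St V) (St E)"
    unfolding evals(1)[symmetric] using assms(1) codes(1) by (rule act_fix) (simp add: assms(2) S_def)
  then show "act \<pi> (St V) = St V" "act \<pi> (St E) = St E" unfolding act_vpair vpair_inject by blast+
  show "act \<pi> (St W) = St W"
    unfolding evals(2)[symmetric] using assms(1) codes(2) by (rule act_fix) (simp add: assms(2) S_def)
  show "act \<pi> (St F) = St F"
    unfolding evals(3)[symmetric] using assms(1) codes(3) by (rule act_fix) (simp add: assms(2) S_def)
qed

lemma act_elems:
  assumes "bij \<pi>" "\<And>a. a \<in> S \<Longrightarrow> \<pi> a = a"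
  shows "act \<pi> u \<in> rcset E \<longleftrightarrow> u \<in> rcset E" "act \<pi> u \<in> rcset W \<longleftrightarrow> u \<in> rcset W"
    "act \<pi> u \<in> rcset F \<longleftrightarrow> u \<in> rcset F"
proof -
  have *: "act \<pi> u \<in> rcset X \<longleftrightarrow> u \<in> rcset X" if "act \<pi> (St X) = St X" for X
  proof -
    have "rcset X = act \<pi> ` rcset X" using velems_act[of \<pi> "St X"] unfolding that by simp
    then have "act \<pi> u \<in> rcset X \<longleftrightarrow> act \<pi> u \<in> act \<pi> ` rcset X" by simp
    also have "\<dots> \<longleftrightarrow> u \<in> rcset X" using act_inject[OF assms(1)] by auto
    finally show ?thesis .
  qed
  show "act \<pi> u \<in> rcset E \<longleftrightarrow> u \<in> rcset E" "act \<pi> u \<in> rcset W \<longleftrightarrow> u \<in> rcset W"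
    "act \<pi> u \<in> rcset F \<longleftrightarrow> u \<in> rcset F"
    using act_fixed[OF assms] * by blast+
qed

text \<open>No expression for \<open>V\<close> or \<open>E\<close> is at hand, only one for the
  pair. Codes for them exist because \<open>S\<close> supports them.\<close>

lemma matches_pair: "\<exists>p. matches (St V) p" "\<exists>r. matches (St E) r" "\<exists>q. matches (upair (St V) (St E)) q"
proof -
  have rep: "represented (vpair (St V) (St E))" using matches(1) matches_represented by blast
  have repV: "represented (St V)" and repQ: "represented (upair (St V) (St E))"
    using represented_down[OF rep] by (simp_all add: vpair_def velems_upair)
  have repE: "represented (St E)" using represented_down[OF repQ] by (simp add: velems_upair)
  have supp: "supports S (St V)" "supports S (St E)" "supports S (upair (St V) (St E))"
    unfolding supports_def act_upair using act_fixed by metis+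
  have "card S \<le> 6 * M" using S(3) by simp
  then show "\<exists>p. matches (St V) p" "\<exists>r. matches (St E) r" "\<exists>q. matches (upair (St V) (St E)) q"
    using supported_matches repV repE repQ supp S(2) by blast+
qed

lemma pair_code_iff: "pair_code g p r \<longleftrightarrow> matches (St V) p \<and> matches (St E) r"
proof
  obtain p0 r0 q0 where 0: "matches (St V) p0" "matches (St E) r0" "matches (upair (St V) (St E)) q0"
    using matches_pair by blast
  {
    assume "pair_code g p r"
    then obtain q where q: "mem p g" "mem q g" "mem p q" "mem r q" "\<And>z. mem z q \<Longrightarrow> z = p \<or> z = r"
      unfolding pair_code_def using mem_less by blast
    obtain up where up: "up \<in> velems (vpair (St V) (St E))" "matches up p" using matches_down[OF matches(1) q(1)] by blast
    obtain uq where uq: "uq \<in> velems (vpair (St V) (St E))" "matches uq q" using matches_down[OF matches(1) q(2)] by blast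
    have "up \<in> velems uq" using matches_mem[OF uq(2) up(2)] q(3) by blast
    moreover have "St V \<in> velems (upair (St V) (St E))" by (simp add: velems_upair)
    ultimately have u: "up = St V" "uq = upair (St V) (St E)"
      using up(1) uq(1) mem_asym unfolding vpair_def velems_upair[of "St V" "upair (St V) (St E)"] by blast+
    have p: "p = p0" using matches_eq_iff[OF 0(1) up(2)] u(1) by simp
    obtain ur where ur: "ur \<in> velems uq" "matches ur r" using matches_down[OF uq(2) q(4)] by blast
    \<comment> \<open>If \<open>r\<close> were the code of \<open>V\<close>, then \<open>q\<close>
      would have no other element, so that \<open>r0\<close> would equal it as well; this is the
      case \<open>V = E\<close>.\<close>
    have "mem r0 q" using matches_mem[OF uq(2) 0(2)] u(2) by (simp add: velems_upair)
    then have "r0 = p \<or> r0 = r" by (rule q(5))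
    moreover have "r = p0 \<or> r = r0"
      using ur u(2) matches_eq_iff[OF 0(1) ur(2)] matches_eq_iff[OF 0(2) ur(2)] by (auto simp: velems_upair)
    ultimately have "r = r0" using p by auto
    then show "matches (St V) p \<and> matches (St E) r" using p 0 by simp
  next
    assume pr: "matches (St V) p \<and> matches (St E) r"
    have "mem p g" "mem q0 g"
      using matches_mem[OF matches(1)] pr 0(3) by (auto simp: vpair_def velems_upair)
    moreover have "mem p q0" "mem r q0" using matches_mem[OF 0(3)] pr by (auto simp: velems_upair)
    moreover have "z = p \<or> z = r" if z: "mem z q0" for z
    proof -
      obtain u where "u \<in> velems (upair (St V) (St E))" "matches u z" using matches_down[OF 0(3) z] by blast
      then show ?thesis using pr matches_eq_iff by (auto simp: velems_upair)
    qed
    ultimately show "pair_code g p r" unfolding pair_code_def using mem_less by blast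
  }
qed

lemma represented_elems: "d \<in> rcset E \<Longrightarrow> represented d" "u \<in> rcset W \<Longrightarrow> represented u"
proof -
  have "represented (St E)" using matches_pair(2) matches_represented by blast
  then show "d \<in> rcset E \<Longrightarrow> represented d" using represented_down by (metis velems_simps(2))
  have "represented (St W)" using matches(2) matches_represented by blast
  then show "u \<in> rcset W \<Longrightarrow> represented u" using represented_down by (metis velems_simps(2))
qed

lemma link_E:
  assumes r: "matches (St E) r" and u: "matches u v" "matches u' v'"
  shows "(u, u') \<in> (link (rcset E))\<^sup>* \<longleftrightarrow> v' \<in> set_decode (reach_code r 0 v)"
proof -
  have 0: "\<not> mem n 0" for n unfolding mem_def by simp
  have "(u, u') \<in> (link (rcset E))\<^sup>* \<longleftrightarrow> (v, v') \<in> (linkc (edge_code r 0))\<^sup>*"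
  proof (rule link_transfer[OF S(2,3) _ _ _ _ u])
    show "act \<pi> d \<in> rcset E" if "bij \<pi>" "\<And>a. a \<in> S \<Longrightarrow> \<pi> a = a" "d \<in> rcset E" for \<pi> d
      using act_elems(1)[OF that(1,2)] that(3) by blast
    show "d \<in> rcset E \<longleftrightarrow> edge_code r 0 n" if "matches d n" for d n
      using matches_mem[OF r that] 0 by simp
    show "\<exists>d. matches d n" if "edge_code r 0 n" for n
      using matches_down[OF r] that by blast
  qed (rule represented_elems(1))
  then show ?thesis unfolding reach_code .
qed

lemma link_H:
  assumes r: "matches (St E) r" and u: "matches u v" "matches u' v'"
  shows "(u, u') \<in> (link H)\<^sup>* \<longleftrightarrow> v' \<in> set_decode (reach_code r f v)"
proof -
  have "(u, u') \<in> (link H)\<^sup>* \<longleftrightarrow> (v, v') \<in> (linkc (edge_code r f))\<^sup>*"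
  proof (rule link_transfer[OF S(2,3) _ _ _ _ u])
    show "act \<pi> d \<in> H" if "bij \<pi>" "\<And>a. a \<in> S \<Longrightarrow> \<pi> a = a" "d \<in> H" for \<pi> d
      using act_elems(1,3)[OF that(1,2)] that(3) by blast
    show "represented d" if "d \<in> H" for d using represented_elems(1) that by blast
    show "d \<in> H \<longleftrightarrow> edge_code r f n" if "matches d n" for d n
      using matches_mem[OF r that] matches_mem[OF matches(3) that] by simp
    show "\<exists>d. matches d n" if "edge_code r f n" for n
      using matches_down[OF r] that by blast
  qed
  then show ?thesis unfolding reach_code .
qed

lemma link_H_act:
  assumes "bij \<pi>" "\<And>a. a \<in> S \<Longrightarrow> \<pi> a = a" "(u, v) \<in> (link H)\<^sup>*"
  shows "(act \<pi> u, act \<pi> v) \<in> (link H)\<^sup>*"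
  by (rule link_rtrancl_act[OF _ assms(3)]) (use act_elems[OF assms(1,2)] in auto)

text \<open>Connectivity is invariant under permutations fixing \<open>S\<close>, so two arbitrary
  vertices of \<open>W\<close> may be moved together into the finite structure, and the resulting
  path may be moved back.\<close>

lemma connected_iff:
  assumes r: "matches (St E) r"
  shows "(\<forall>u\<in>rcset W. \<forall>u'\<in>rcset W. (u, u') \<in> (link (rcset E))\<^sup>*) \<longleftrightarrow>
    (\<forall>v v'. mem v w \<and> mem v' w \<longrightarrow> v' \<in> set_decode (reach_code r 0 v))" (is "?l \<longleftrightarrow> ?r")
proof
  assume ?l
  show ?r
  proof (intro allI impI; elim conjE)
    fix v v' assume "mem v w" "mem v' w"
    then obtain u u' where "u \<in> rcset W" "matches u v" "u' \<in> rcset W" "matches u' v'"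
      using matches_down[OF matches(2)] by (metis velems_simps(2))
    then show "v' \<in> set_decode (reach_code r 0 v)" using \<open>?l\<close> link_E[OF r] by blast
  qed
next
  assume ?r
  show ?l
  proof (intro ballI)
    fix u u' assume u: "u \<in> rcset W" "u' \<in> rcset W"
    have "card S \<le> 6 * M" using S(3) by simp
    then obtain \<pi> v v' where \<pi>: "bij \<pi>" "\<And>a. a \<in> S \<Longrightarrow> \<pi> a = a" "matches (act \<pi> u) v" "matches (act \<pi> u') v'"
      using represented_move2[OF represented_elems(2)[OF u(1)] represented_elems(2)[OF u(2)] S(2)] by metis
    have "act \<pi> u \<in> rcset W" "act \<pi> u' \<in> rcset W" using act_elems(2)[OF \<pi>(1,2)] u by blast+
    then have "mem v w" "mem v' w" using matches_mem[OF matches(2)] \<pi>(3,4) by simp_all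
    then have conn: "(act \<pi> u, act \<pi> u') \<in> (link (rcset E))\<^sup>*" using \<open>?r\<close> link_E[OF r \<pi>(3,4)] by blast
    have "bij (inv \<pi>)" using \<pi>(1) by (rule bij_imp_bij_inv)
    moreover have "inv \<pi> a = a" if "a \<in> S" for a using \<pi>(1,2) that by (metis bij_inv_eq_iff)
    ultimately have "act (inv \<pi>) d \<in> rcset E" if "d \<in> rcset E" for d
      using act_elems(1)[of "inv \<pi>" d] that by blast
    then have "(act (inv \<pi>) (act \<pi> u), act (inv \<pi>) (act \<pi> u')) \<in> (link (rcset E))\<^sup>*"
      using conn by (rule link_rtrancl_act)
    then show "(u, u') \<in> (link (rcset E))\<^sup>*" by (simp add: act_inv[OF \<pi>(1)])
  qed
qed

lemma finite_components_imp:
  assumes r: "matches (St E) r" and C: "finite C" "\<And>u. u \<in> rcset W \<Longrightarrow> \<exists>c\<in>C. (u, c) \<in> (link H)\<^sup>*"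
    and v: "mem v w"
  shows "\<exists>v'. elem_code (N - 1) v' (code_expr eW) tW N M \<and> v' \<in> set_decode (reach_code r f v)"
proof -
  obtain bs where bs: "eW = EUnion bs" using evals(2) by (cases eW) auto
  have "mem v (ev_code (code_expr eW) tW N M)" using v unfolding w_def .
  then have el: "elem_code N v (code_expr (EUnion bs)) tW N M"
    unfolding bs ev_code_EUnion(2)[OF vals(2)] .
  obtain e xs \<phi> t where e: "Builder e xs \<phi> \<in> set bs" "t < K" "sat \<phi> (dig N t)"
    "\<And>y. y < M \<Longrightarrow> y \<notin> set xs \<Longrightarrow> dig N t y = dig N tW y"
    "v = ev_code (code_expr e) t N M" "eval e (dig N t) \<in> velems (eval (EUnion bs) (dig N tW))"
    using elem_codeE[OF codes(2)[unfolded bs] vals(2) el] by metis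
  note sub = code_sub[OF codes(2)[unfolded bs] e(1)]
  define \<tau> where "\<tau> = dig N t"
  define u where "u = eval e \<tau>"
  have uW: "u \<in> rcset W" using e(6) evals(2) unfolding u_def \<tau>_def bs by simp
  have uv: "matches u v" unfolding matches_def u_def \<tau>_def using sub(2) e(2,5) by blast
  define a where "a = N - 1"
  have aS: "a \<notin> S" using S(1) unfolding a_def by auto
  have aN: "a < N" unfolding a_def using N by simp
  have \<tau>N: "\<tau> y < N" for y unfolding \<tau>_def by (rule dig_N)
  \<comment> \<open>Copies of \<open>u\<close> with the last atom \<open>a\<close> replaced by atoms
    \<open>i\<close> beyond the finite structure. As \<open>a\<close> and these \<open>i\<close> lie
    outside \<open>S\<close>, the copies are vertices of \<open>W\<close>. If \<open>a\<close> does
    not occur in \<open>u\<close>, all copies are equal, which does no harm.\<close>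
  define z where "z i = act (transpose a i) u" for i
  have "z i \<in> rcset W" if "i \<ge> N" for i
  proof -
    have "transpose a i b = b" if "b \<in> S" for b
      using aS S(2) that \<open>i \<ge> N\<close> by (intro transpose_apply_other) auto
    then show ?thesis unfolding z_def using uW by (subst act_elems(2)) simp_all
  qed
  then have "\<exists>c. i \<ge> N \<longrightarrow> c \<in> C \<and> (z i, c) \<in> (link H)\<^sup>*" for i using C(2) by blast
  then obtain c where c: "\<And>i. i \<ge> N \<Longrightarrow> c i \<in> C" "\<And>i. i \<ge> N \<Longrightarrow> (z i, c i) \<in> (link H)\<^sup>*" by metis
  have "\<not> inj_on c {N..}"
  proof
    assume inj: "inj_on c {N..}"
    have "c ` {N..} \<subseteq> C" using c(1) by auto
    then have "finite (c ` {N..})" using C(1) finite_subset by blast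
    then show False using finite_imageD[OF _ inj] infinite_Ici by blast
  qed
  then obtain i j where ij: "i \<ge> N" "j \<ge> N" "i \<noteq> j" "c i = c j" unfolding inj_on_def by auto
  have "(c j, z j) \<in> (link H)\<^sup>*" using link_rtrancl_sym[OF c(2)[OF ij(2)]] .
  then have "(z i, z j) \<in> (link H)\<^sup>*" using c(2)[OF ij(1)] ij(4) by (metis rtrancl_trans)
  moreover have "transpose a i b = b" if "b \<in> S" for b
    using aS S(2) that ij(1) by (intro transpose_apply_other) auto
  ultimately have "(act (transpose a i) (z i), act (transpose a i) (z j)) \<in> (link H)\<^sup>*"
    by (intro link_H_act) auto
  moreover have "act (transpose a i) (z i) = u"
    unfolding z_def act_comp transpose_comp_involutory act_id ..
  \<comment> \<open>In \<open>z j\<close> the atom \<open>a\<close> has been replaced by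
    \<open>j\<close>, and \<open>i\<close> does not occur.\<close>
  moreover have "act (transpose a i) (z j) = z j"
  proof -
    have "transpose a i (transpose a j (\<tau> y)) = transpose a j (\<tau> y)" for y
      using \<tau>N[of y] aN ij by (cases "\<tau> y = a") (simp_all add: transpose_apply_other)
    then have "transpose a i \<circ> (transpose a j \<circ> \<tau>) = transpose a j \<circ> \<tau>" by (auto simp: fun_eq_iff)
    then show ?thesis unfolding z_def u_def by (simp only: eval_perm(1)[OF bij_transpose, symmetric])
  qed
  ultimately have uz: "(u, z j) \<in> (link H)\<^sup>*" by simp
  have "card (S \<union> rng \<tau>) \<le> 4 * M" using card_Un_le[of S "rng \<tau>"] S(3) card_rng[of \<tau>] by linarith
  then have "card (S \<union> rng \<tau>) < card {..<a}" unfolding a_def using N by simp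
  moreover have "finite (S \<union> rng \<tau>)" using S(2) finite_subset by auto
  ultimately have "\<not> {..<a} \<subseteq> S \<union> rng \<tau>" using card_mono by (metis not_le)
  \<comment> \<open>An atom below \<open>N - 1\<close> that is foreign to \<open>u\<close> and to
    the inputs, to stand in for the fresh atom \<open>j\<close>.\<close>
  then obtain b where b: "b < a" "b \<notin> S" "b \<notin> rng \<tau>" by auto
  \<comment> \<open>On the variables below \<open>M\<close> this is \<tau> with \<open>a\<close>
    replaced by \<open>b\<close>. As a composition with permutations it inherits the satisfaction of
    the formula by invariance.\<close>
  define \<sigma> where "\<sigma> = transpose j b \<circ> (transpose a j \<circ> \<tau>)"
  have \<sigma>: "\<sigma> y = (if \<tau> y = a then b else \<tau> y)" if "y < M" for y
  proof -
    have "\<tau> y \<noteq> b" using b(3) rng_mem[OF that, of \<tau>] by auto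
    moreover have "\<tau> y \<noteq> j" using \<tau>N[of y] ij(2) by auto
    ultimately show ?thesis unfolding \<sigma>_def by (simp add: transpose_apply_other)
  qed
  have "transpose j b s = s" if "s \<in> S" for s
    using that S(2) b(2) ij(2) by (intro transpose_apply_other) auto
  then have "(act (transpose j b) u, act (transpose j b) (z j)) \<in> (link H)\<^sup>*"
    using uz by (intro link_H_act) auto
  moreover have "act (transpose j b) u = u"
    unfolding u_def using bij_transpose sub(2)
  proof (rule act_fix)
    fix s assume "s \<in> rng \<tau>"
    then show "transpose j b s = s"
      using b(3) \<tau>N ij(2) by (intro transpose_apply_other) (auto simp: rng_def not_less[symmetric])
  qed
  moreover have "act (transpose j b) (z j) = eval e \<sigma>"
    unfolding z_def u_def \<sigma>_def by (simp only: eval_perm(1)[OF bij_transpose, symmetric])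
  ultimately have conn: "(u, eval e \<sigma>) \<in> (link H)\<^sup>*" by simp
  obtain t'' where t'': "t'' < K" "eval e (dig N t'') = eval e \<sigma>"
    "elem_code (N - 1) (ev_code (code_expr e) t'' N M) (code_expr (EUnion bs)) tW N M"
  proof (rule elem_codeI[OF codes(2)[unfolded bs] vals(2) e(1), of "N - 1" \<sigma>])
    show "N - 1 \<le> N" by simp
    show "\<sigma> y < N - 1" if "y < M" for y
      using \<sigma>[OF that] b(1) \<tau>N[of y] unfolding a_def by auto
    show "\<sigma> y = dig N tW y" if y: "y < M" "y \<notin> set xs" for y
    proof -
      have "\<tau> y = dig N tW y" unfolding \<tau>_def using e(4) y .
      then show ?thesis using \<sigma>[OF y(1)] digs(2)[OF y(1)] unfolding a_def by auto
    qed
    show "sat \<phi> \<sigma>" unfolding \<sigma>_def \<tau>_def using e(3) by (simp only: sat_perm[OF bij_transpose])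
  qed blast
  have "matches (eval e \<sigma>) (ev_code (code_expr e) t'' N M)"
    unfolding matches_def using t''(1,2) sub(2) by metis
  then show ?thesis using link_H[OF r uv] conn t''(3) unfolding bs by blast
qed

text \<open>Induction on the number of atoms from \<open>N - 1\<close> on that a description uses.
  The hypothesis speaks only about the finite structure, so the element is first moved there in such
  a way that exactly one of these atoms lands on \<open>N - 1\<close>. The connected element
  provided by the hypothesis avoids \<open>N - 1\<close>, and moving it back loses that
  atom.\<close>

lemma finite_components_if:
  assumes r: "matches (St E) r"
    and conn: "\<And>v. mem v w \<Longrightarrow>
      \<exists>v'. elem_code (N - 1) v' (code_expr eW) tW N M \<and> v' \<in> set_decode (reach_code r f v)"
  shows "\<exists>C. finite C \<and> (\<forall>u\<in>rcset W. \<exists>c\<in>C. (u, c) \<in> (link H)\<^sup>*)"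
proof -
  obtain bs where bs: "eW = EUnion bs" using evals(2) by (cases eW) auto
  note cW = codes(2)[unfolded bs]
  have W: "velems (eval (EUnion bs) (dig N tW)) = rcset W" using evals(2) unfolding bs by simp
  have "\<forall>v. \<exists>u. mem v w \<longrightarrow> u \<in> rcset W \<and> matches u v"
    using matches_down[OF matches(2)] by auto
  then obtain pick where pick: "\<And>v. mem v w \<Longrightarrow> matches (pick v) v" by metis
  \<comment> \<open>One matching vertex for each of the finitely many codes in
    \<open>w\<close>.\<close>
  define C where "C = pick ` {v. mem v w}"
  have "{v. mem v w} \<subseteq> {..<w}" using mem_less by auto
  then have fin: "finite C" unfolding C_def using finite_subset by blast
  define B where "B = N - 1"
  define m where "m \<tau> = card (rng \<tau> - {..<B})" for \<tau>
  have key: "\<exists>c\<in>C. (eval e \<tau>, c) \<in> (link H)\<^sup>*"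
    if "Builder e xs \<phi> \<in> set bs" "\<And>y. y < M \<Longrightarrow> y \<notin> set xs \<Longrightarrow> \<tau> y = dig N tW y" "sat \<phi> \<tau>" for e xs \<phi> \<tau>
    using that
  proof (induction "m \<tau>" arbitrary: e xs \<phi> \<tau> rule: less_induct)
    case less
    note e = less.prems
    note sub = code_sub[OF cW e(1)]
    show ?case
    proof (cases "rng \<tau> \<subseteq> {..<B}")
      case True
      have "\<tau> y < N" if "y < M" for y using True rng_mem[OF that, of \<tau>] unfolding B_def by auto
      then obtain v where v: "matches (eval e \<tau>) v" using matches_eval[OF sub(2)] by blast
      have "eval e \<tau> \<in> rcset W" using velems_evalI[OF cW e(1), of \<tau> "dig N tW"] e W by blast
      then have "mem v w" using matches_mem[OF matches(2) v] by simp
      then have "eval e \<tau> \<in> C" unfolding C_def using pick v matches_eq_iff by blast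
      then show ?thesis by blast
    next
      case False
      define Out where "Out = rng \<tau> - {..<B}"
      obtain y1 where y1: "y1 \<in> Out" using False unfolding Out_def by auto
      have finOut: "finite Out" unfolding Out_def by simp
      have "card Out \<le> M" unfolding Out_def using card_rng[of \<tau>] by (meson card_Diff_subset_Int card_mono Diff_subset finite_rng le_trans)
      moreover have "card (S \<union> rng \<tau>) \<le> 4 * M" using card_Un_le[of S "rng \<tau>"] S(3) card_rng[of \<tau>] by linarith
      moreover have "card {..<B} - card (S \<union> rng \<tau>) \<le> card ({..<B} - (S \<union> rng \<tau>))"
        using S(2) by (intro diff_card_le_card_Diff) (auto intro: finite_subset)
      ultimately have "card Out \<le> card ({..<B} - (S \<union> rng \<tau>))" unfolding B_def using N by simp
      then have "card (Out - {y1}) \<le> card ({..<B} - (S \<union> rng \<tau>))"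
        using card_Diff1_le[of Out y1] by linarith
      then obtain h where h: "h ` (Out - {y1}) \<subseteq> {..<B} - (S \<union> rng \<tau>)" "inj_on h (Out - {y1})"
        using card_le_inj[of "Out - {y1}" "{..<B} - (S \<union> rng \<tau>)"] finOut by auto
      define G where "G = h ` (Out - {y1})"
      define k where "k x = (if x < B then x else if x = y1 then B else h x)" for x
      have hB: "h x < B \<and> h x \<notin> S \<and> h x \<notin> rng \<tau> \<and> h x \<in> G" if "x \<in> Out" "x \<noteq> y1" for x
        using h(1) that unfolding G_def by blast
      have Out_B: "x \<in> Out \<Longrightarrow> \<not> x < B" for x unfolding Out_def by simp
      \<comment> \<open>The atoms of \<open>G\<close> are left out of the domain, because their
        places are taken by the atoms moved there.\<close>
      have "inj_on k (({..<B} - G) \<union> Out)"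
      proof (rule inj_onI)
        fix x y assume xy: "x \<in> ({..<B} - G) \<union> Out" "y \<in> ({..<B} - G) \<union> Out" "k x = k y"
        show "x = y"
        proof (cases "x < B")
          case True
          then have "x \<notin> G" using xy(1) Out_B by blast
          then show ?thesis using True xy(2,3) hB[of y] unfolding k_def by (auto split: if_splits)
        next
          case x: False
          show ?thesis
          proof (cases "y < B")
            case True
            then have "y \<notin> G" using xy(2) Out_B by blast
            then show ?thesis using True x xy(1,3) hB[of x] unfolding k_def by (auto split: if_splits)
          next
            case False
            then have Out: "x \<in> Out" "y \<in> Out" using x xy by auto
            have k: "k x = (if x = y1 then B else h x)" "k y = (if y = y1 then B else h y)"
              using x False unfolding k_def by simp_all
            have less: "x \<noteq> y1 \<Longrightarrow> h x < B" "y \<noteq> y1 \<Longrightarrow> h y < B" using hB Out by blast+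
            show ?thesis
            proof (cases "x = y1 \<or> y = y1")
              case True
              then show ?thesis using xy(3) less unfolding k by (auto split: if_splits)
            next
              case False
              then have "h x = h y" using xy(3) unfolding k by simp
              then show ?thesis using inj_onD[OF h(2)] Out False by blast
            qed
          qed
        qed
      qed
      then obtain \<pi> where \<pi>: "bij \<pi>" "\<And>x. x \<in> ({..<B} - G) \<union> Out \<Longrightarrow> \<pi> x = k x"
        using bij_extension[of "({..<B} - G) \<union> Out" k] finOut by auto
      have \<pi>S: "\<pi> x = x" if "x \<in> S" for x
      proof -
        have "x < B" using that S(1) unfolding B_def by auto
        moreover have "x \<notin> G" using that h(1) unfolding G_def by blast
        ultimately show ?thesis using \<pi>(2)[of x] unfolding k_def by simp
      qed
      have \<pi>\<tau>: "\<pi> x < N" if "x \<in> rng \<tau>" for x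
      proof (cases "x < B")
        case True
        moreover have "x \<notin> G" using that h(1) unfolding G_def by blast
        ultimately show ?thesis using \<pi>(2)[of x] unfolding k_def B_def by simp
      next
        case False
        then have x: "x \<in> Out" using that unfolding Out_def by simp
        then show ?thesis using \<pi>(2)[of x] False hB[of x] N unfolding k_def B_def by auto
      qed
      have inv\<pi>: "bij (inv \<pi>)" using \<pi>(1) by (rule bij_imp_bij_inv)
      have inv_eq: "inv \<pi> y = x" if "\<pi> x = y" for x y using that \<pi>(1) by (metis bij_inv_eq_iff)
      have invS: "inv \<pi> x = x" if "x \<in> S" for x using inv_eq \<pi>S that by blast
      \<comment> \<open>Moving back turns atoms of \<open>G\<close> into atoms of \<open>Out\<close>
        other than \<open>y1\<close> and fixes the remaining atoms below \<open>B\<close>, so that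
        \<open>y1\<close> cannot reappear and no new large atom arises.\<close>
      have inv_B: "inv \<pi> y \<in> {..<B} \<union> (Out - {y1})" if y: "y < B" for y
      proof (cases "y \<in> G")
        case True
        then obtain x where x: "x \<in> Out - {y1}" "y = h x" unfolding G_def by blast
        then have "\<pi> x = y" using \<pi>(2)[of x] Out_B[of x] unfolding k_def by simp
        from inv_eq[OF this] show ?thesis using x(1) by simp
      next
        case False
        then have "\<pi> y = y" using \<pi>(2)[of y] y unfolding k_def by simp
        from inv_eq[OF this] show ?thesis using y by simp
      qed
      have "(\<pi> \<circ> \<tau>) y < N" if "y < M" for y using \<pi>\<tau> rng_mem[OF that, of \<tau>] by simp
      then obtain v where v: "matches (eval e (\<pi> \<circ> \<tau>)) v" using matches_eval[OF sub(2)] by blast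
      have "eval e \<tau> \<in> rcset W" using velems_evalI[OF cW e(1), of \<tau> "dig N tW"] e W by blast
      then have "eval e (\<pi> \<circ> \<tau>) \<in> rcset W"
        unfolding eval_perm(1)[OF \<pi>(1)] using act_elems(2)[OF \<pi>(1) \<pi>S] by blast
      then have "mem v w" using matches_mem[OF matches(2) v] by simp
      then obtain v' where v': "elem_code B v' (code_expr (EUnion bs)) tW N M" "v' \<in> set_decode (reach_code r f v)"
        using conn unfolding bs B_def by blast
      obtain e2 ys \<psi> t2 where 2: "Builder e2 ys \<psi> \<in> set bs" "t2 < K" "sat \<psi> (dig N t2)"
          "\<And>y. y < M \<Longrightarrow> y \<in> set ys \<Longrightarrow> dig N t2 y < B"
          "\<And>y. y < M \<Longrightarrow> y \<notin> set ys \<Longrightarrow> dig N t2 y = dig N tW y"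
          "v' = ev_code (code_expr e2) t2 N M"
        using elem_codeE[OF cW vals(2) v'(1)] by metis
      note sub2 = code_sub[OF cW 2(1)]
      have "matches (eval e2 (dig N t2)) v'" unfolding matches_def using sub2(2) 2(2,6) by blast
      then have "(eval e (\<pi> \<circ> \<tau>), eval e2 (dig N t2)) \<in> (link H)\<^sup>*" using link_H[OF r v] v'(2) by blast
      then have "(act (inv \<pi>) (eval e (\<pi> \<circ> \<tau>)), act (inv \<pi>) (eval e2 (dig N t2))) \<in> (link H)\<^sup>*"
        using inv\<pi> invS by (intro link_H_act) auto
      then have step: "(eval e \<tau>, eval e2 (inv \<pi> \<circ> dig N t2)) \<in> (link H)\<^sup>*"
        unfolding eval_perm(1)[OF \<pi>(1)] act_inv(1)[OF \<pi>(1)] eval_perm(1)[OF inv\<pi>] .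
      have digB: "dig N t2 y < B" if "y < M" for y
        using 2(4,5)[OF that] digs(2)[OF that] unfolding B_def by (cases "y \<in> set ys") auto
      have "rng (inv \<pi> \<circ> dig N t2) - {..<B} \<subseteq> Out - {y1}"
        unfolding rng_def using inv_B digB by auto
      then have "m (inv \<pi> \<circ> dig N t2) \<le> card (Out - {y1})"
        unfolding m_def using finOut by (intro card_mono) auto
      also have "\<dots> < card Out" using finOut y1 by (rule card_Diff1_less)
      also have "\<dots> = m \<tau>" unfolding m_def Out_def ..
      finally have "m (inv \<pi> \<circ> dig N t2) < m \<tau>" .
      moreover have "(inv \<pi> \<circ> dig N t2) y = dig N tW y" if y: "y < M" "y \<notin> set ys" for y
      proof -
        have "dig N tW y \<in> S" unfolding S_def using rng_mem[OF y(1)] by blast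
        then show ?thesis using 2(5)[OF y] invS by simp
      qed
      moreover have "sat \<psi> (inv \<pi> \<circ> dig N t2)" using 2(3) sat_perm[OF inv\<pi>] by blast
      ultimately obtain c where "c \<in> C" "(eval e2 (inv \<pi> \<circ> dig N t2), c) \<in> (link H)\<^sup>*"
        using less.hyps[OF _ 2(1)] by blast
      then show ?thesis using step rtrancl_trans by metis
    qed
  qed
  have "\<exists>c\<in>C. (u, c) \<in> (link H)\<^sup>*" if "u \<in> rcset W" for u
    using that key unfolding W[symmetric] velems_eval_iff by blast
  then show ?thesis using fin by blast
qed

lemma steiner_code_iff:
  "has_steiner_tree (rcset V) (rcset E) (rcset W) (rcset F) \<longleftrightarrow> steiner_code g w f (code_expr eW) tW N M"
proof -
  have *: "steiner_code g w f (code_expr eW) tW N M \<longleftrightarrow> (\<exists>p r. matches (St V) p \<and> matches (St E) r \<and>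
     (\<forall>v v'. mem v w \<and> mem v' w \<longrightarrow> v' \<in> set_decode (reach_code r 0 v)) \<and>
     (\<forall>v. mem v w \<longrightarrow> (\<exists>v'. elem_code (N - 1) v' (code_expr eW) tW N M \<and> v' \<in> set_decode (reach_code r f v))))"
  proof -
    have "p < g \<and> r < g" if "pair_code g p r" for p r
      using that unfolding pair_code_def using mem_less less_trans by blast
    then show ?thesis
      unfolding steiner_code_def pair_code_iff using mem_less[of _ w] set_decode_less by meson
  qed
  have fin: "(\<exists>C. finite C \<and> (\<forall>u\<in>rcset W. \<exists>c\<in>C. (u, c) \<in> (link H)\<^sup>*)) \<longleftrightarrow>
     (\<forall>v. mem v w \<longrightarrow> (\<exists>v'. elem_code (N - 1) v' (code_expr eW) tW N M \<and> v' \<in> set_decode (reach_code r f v)))"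
    if r: "matches (St E) r" for r
    using finite_components_imp[OF r] finite_components_if[OF r] by meson
  obtain p0 r0 where 0: "matches (St V) p0" "matches (St E) r0" using matches_pair by blast
  show ?thesis
    unfolding steiner_iff[OF graph] *
  proof (intro iffI; (elim exE conjE)?)
    fix p r
    assume r: "matches (St E) r" and
      1: "\<forall>v v'. mem v w \<and> mem v' w \<longrightarrow> v' \<in> set_decode (reach_code r 0 v)" and
      2: "\<forall>v. mem v w \<longrightarrow> (\<exists>v'. elem_code (N - 1) v' (code_expr eW) tW N M \<and> v' \<in> set_decode (reach_code r f v))"
    show "(\<forall>u\<in>rcset W. \<forall>u'\<in>rcset W. (u, u') \<in> (link (rcset E))\<^sup>*) \<and>
      (\<exists>C. finite C \<and> (\<forall>u\<in>rcset W. \<exists>c\<in>C. (u, c) \<in> (link H)\<^sup>*))"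
      unfolding connected_iff[OF r] fin[OF r] using 1 2 by (rule conjI)
  next
    fix C assume 1: "\<forall>u\<in>rcset W. \<forall>u'\<in>rcset W. (u, u') \<in> (link (rcset E))\<^sup>*"
      and "finite C" "\<forall>u\<in>rcset W. \<exists>c\<in>C. (u, c) \<in> (link H)\<^sup>*"
    then have 2: "\<exists>C. finite C \<and> (\<forall>u\<in>rcset W. \<exists>c\<in>C. (u, c) \<in> (link H)\<^sup>*)" by blast
    show "\<exists>p r. matches (St V) p \<and> matches (St E) r \<and>
       (\<forall>v v'. mem v w \<and> mem v' w \<longrightarrow> v' \<in> set_decode (reach_code r 0 v)) \<and>
       (\<forall>v. mem v w \<longrightarrow> (\<exists>v'. elem_code (N - 1) v' (code_expr eW) tW N M \<and> v' \<in> set_decode (reach_code r f v)))"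
      using 0 1[unfolded connected_iff[OF 0(2)]] 2[unfolded fin[OF 0(2)]]
      by (intro exI[of _ p0] exI[of _ r0] conjI)
  qed
qed

end

text \<open>The alternative \<open>t = N ^ M\<close> makes the search total on arbitrary numbers;
  for the presentations at hand it stops earlier. Keeping all digits below \<open>N - 1\<close>
  makes the inputs avoid the last atom.\<close>

definition valuation_code :: "nat \<Rightarrow> nat \<Rightarrow> nat \<Rightarrow> nat" where
  "valuation_code l N M = (LEAST t.
     ((\<forall>p<l. p \<in> set (list_decode l) \<longrightarrow> dig N t (fst (prod_decode p)) = snd (prod_decode p)) \<and>
      (\<forall>y<M. dig N t y < N - 1)) \<or> t = N ^ M)"

lemma computable_valuation_code:
  assumes "computable f" "computable g" "computable h"
  shows "computable (\<lambda>x. valuation_code (f x) (g x) (h x))"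
proof -
  have "computable (\<lambda>x. valuation_code (x 0) (x 1) (x 2))"
    unfolding valuation_code_def
    by (intro computable_Least computable_intros decidable_in_list computable_dig
        computable_fst_prod_decode computable_snd_prod_decode) blast
  then show ?thesis using assms by (rule computable3)
qed

text \<open>The atoms of the given valuation are part of the code and hence below \<open>M\<close>,
  so that they lie below \<open>N - 1\<close> without any renaming.\<close>

lemma (in finite_atoms) presentsE:
  assumes "presents p u" "code_presentation p < M"
  obtains e where "fst (prod_decode (code_presentation p)) = code_expr e" "code_expr e < M"
    "valuation_code (snd (prod_decode (code_presentation p))) N M < K"
    "\<And>y. y < M \<Longrightarrow> dig N (valuation_code (snd (prod_decode (code_presentation p))) N M) y < N - 1"
    "eval e (dig N (valuation_code (snd (prod_decode (code_presentation p))) N M)) = u"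
proof -
  obtain e \<sigma> where p: "p = (e, \<sigma>)" by (cases p)
  have pr: "distinct (map fst \<sigma>)" "set (map fst \<sigma>) = fv e" "eval e (\<lambda>x. the (map_of \<sigma> x)) = u"
    using assms(1) unfolding presents_def p by auto
  define l where "l = list_encode (map prod_encode \<sigma>)"
  have c: "code_presentation p = prod_encode (code_expr e, l)" unfolding code_presentation_def p l_def by simp
  have dec: "prod_decode (code_presentation p) = (code_expr e, l)" unfolding c by simp
  have eM: "code_expr e < M" and lM: "l < M"
    using assms(2) le_prod_encode_1[of "code_expr e" l] le_prod_encode_2[of l "code_expr e"] unfolding c by linarith+
  have small: "x < M" "a < M" if xa: "(x, a) \<in> set \<sigma>" for x a
  proof -
    have "prod_encode (x, a) < l" unfolding l_def using xa by (intro list_encode_less) force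
    then show "x < M" "a < M" using le_prod_encode_1[of x a] le_prod_encode_2[of a x] lM by linarith+
  qed
  \<comment> \<open>Variables outside the presentation get the atom 0, which is below
    \<open>N - 1\<close>.\<close>
  define \<tau> where "\<tau> y = (case map_of \<sigma> y of None \<Rightarrow> 0 | Some a \<Rightarrow> a)" for y
  have \<tau>: "\<tau> y < N - 1" for y
    unfolding \<tau>_def using small(2) map_of_SomeD[of \<sigma> y] N by (fastforce split: option.splits)
  have "\<tau> y < N" for y using \<tau>[of y] by simp
  then obtain t where t: "t < K" "\<And>y. y < M \<Longrightarrow> dig N t y = \<tau> y" using dig_obtain[of \<tau>] by metis
  let ?P = "\<lambda>t. (\<forall>p<l. p \<in> set (list_decode l) \<longrightarrow> dig N t (fst (prod_decode p)) = snd (prod_decode p)) \<and>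
      (\<forall>y<M. dig N t y < N - 1)"
  have Pt: "?P t"
  proof (intro conjI allI impI)
    fix q assume "q \<in> set (list_decode l)"
    then obtain x a where xa: "(x, a) \<in> set \<sigma>" "q = prod_encode (x, a)" unfolding l_def by auto
    have "map_of \<sigma> x = Some a" using pr(1) xa(1) by simp
    then show "dig N t (fst (prod_decode q)) = snd (prod_decode q)"
      using t(2)[OF small(1)[OF xa(1)]] unfolding xa(2) \<tau>_def by simp
  qed (use t(2) \<tau> in simp)
  define s where "s = valuation_code l N M"
  have sK: "s < K" unfolding s_def valuation_code_def using t(1) Pt by (intro le_less_trans[OF Least_le t(1)]) blast
  have "?P s \<or> s = K"
    unfolding s_def valuation_code_def by (rule LeastI_ex) blast
  then have Ps: "?P s" using sK by blast
  have "eval e (dig N s) = eval e (\<lambda>x. the (map_of \<sigma> x))"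
  proof (rule eval_cong)
    fix x assume "x \<in> fv e"
    then have "x \<in> fst ` set \<sigma>" using pr(2) by simp
    then obtain a where xa: "(x, a) \<in> set \<sigma>" by auto
    let ?p = "prod_encode (x, a)"
    have "?p \<in> set (list_decode l)" unfolding l_def using xa by simp
    then have "dig N s (fst (prod_decode ?p)) = snd (prod_decode ?p)" using Ps list_decode_less by blast
    then have "dig N s x = a" by simp
    then show "dig N s x = the (map_of \<sigma> x)" using pr(1) xa by simp
  qed
  then show ?thesis using that[of e] dec eM sK Ps pr(3) unfolding s_def by simp
qed

definition decide :: "nat \<Rightarrow> nat \<Rightarrow> nat \<Rightarrow> nat \<Rightarrow> nat \<Rightarrow> bool" where
  "decide N M cG cW cF \<longleftrightarrow> (
     let c = fst (prod_decode cW); t = valuation_code (snd (prod_decode cW)) N M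
     in steiner_code
       (ev_code (fst (prod_decode cG)) (valuation_code (snd (prod_decode cG)) N M) N M)
       (ev_code c t N M)
       (ev_code (fst (prod_decode cF)) (valuation_code (snd (prod_decode cF)) N M) N M) c t N M)"

section \<open>Computability of the procedure and the final assembly\<close>

lemma decidable_elem_code:
  assumes "computable b" "computable v" "computable c" "computable t" "computable n" "computable m"
  shows "decidable (\<lambda>x. elem_code (b x) (v x) (c x) (t x) (n x) (m x))"
proof -
  have "computable (\<lambda>x. of_bool (elem_code (x 0) (x 1) (x 2) (x 3) (x 4) (x 5)))"
    unfolding elem_code_def
    by (intro computable_intros decidable_in_list computable_tl_code computable_nth_code decidable_ext
        decidable_sat_code computable_ev_code)
  from computable_list[OF this, of "[b, v, c, t, n, m]"] assms
  show ?thesis unfolding decidable_def by (simp add: numeral_eq_Suc)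
qed

lemma decidable_decide:
  assumes "computable n" "computable m" "computable f" "computable g" "computable h"
  shows "decidable (\<lambda>x. decide (n x) (m x) (f x) (g x) (h x))"
proof -
  have "decidable (\<lambda>x. decide (x 0) (x 1) (x 2) (x 3) (x 4))"
    unfolding decide_def Let_def steiner_code_def pair_code_def
    by (intro computable_intros decidable_mem computable_reach_code decidable_in_set_decode decidable_elem_code
        computable_ev_code computable_valuation_code computable_fst_prod_decode computable_snd_prod_decode)
  then show ?thesis using assms unfolding decidable_def by (rule computable5)
qed

theorem theorem6p2:
  "\<exists>f. recursive 3 f \<and>
     (\<forall>pG pW pF V E W F.
        presents pG (vpair (St V) (St E)) \<and> is_graph (rcset V) (rcset E) \<and>
        presents pW (St W) \<and> rcset W \<subseteq> rcset V \<and>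
        presents pF (St F) \<and> rcset F \<subseteq> rcset E \<longrightarrow>
        f [code_presentation pG, code_presentation pW, code_presentation pF] =
          (if has_steiner_tree (rcset V) (rcset E) (rcset W) (rcset F) then 1 else 0))"
proof -
  let ?M = "\<lambda>x. x 0 + x 1 + x 2 + 1 :: nat"
  have "computable (\<lambda>x. of_bool (decide (8 * ?M x + 8) (?M x) (x 0) (x 1) (x 2)))"
    by (intro computable_intros decidable_decide)
  from recursive_computable[OF this, of 3] obtain f where f: "recursive 3 f"
    "\<And>x. \<forall>i\<ge>3. x i = 0 \<Longrightarrow> f (map x [0..<3]) = of_bool (decide (8 * ?M x + 8) (?M x) (x 0) (x 1) (x 2))"
    by blast
  have f3: "f [a, b, c] = of_bool (decide (8 * (a + b + c + 1) + 8) (a + b + c + 1) a b c)" for a b c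
    using f(2)[of "\<lambda>i. if i = 0 then a else if i = 1 then b else if i = 2 then c else 0"]
    by (simp add: numeral_3_eq_3 numeral_2_eq_2)
  have "f [code_presentation pG, code_presentation pW, code_presentation pF] =
      (if has_steiner_tree (rcset V) (rcset E) (rcset W) (rcset F) then 1 else 0)"
    if pres: "presents pG (vpair (St V) (St E))" "presents pW (St W)" "presents pF (St F)"
      and graph: "is_graph (rcset V) (rcset E)" "rcset W \<subseteq> rcset V" "rcset F \<subseteq> rcset E" for pG pW pF V E W F
  proof -
    define M where "M = code_presentation pG + code_presentation pW + code_presentation pF + 1"
    define N where "N = 8 * M + 8"
    interpret finite_atoms N M by unfold_locales (rule N_def)
    obtain eG where G: "fst (prod_decode (code_presentation pG)) = code_expr eG" "code_expr eG < M"
      "valuation_code (snd (prod_decode (code_presentation pG))) N M < K"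
      "\<And>y. y < M \<Longrightarrow> dig N (valuation_code (snd (prod_decode (code_presentation pG))) N M) y < N - 1"
      "eval eG (dig N (valuation_code (snd (prod_decode (code_presentation pG))) N M)) = vpair (St V) (St E)"
      using presentsE[OF pres(1)] unfolding M_def by auto
    obtain eW where W: "fst (prod_decode (code_presentation pW)) = code_expr eW" "code_expr eW < M"
      "valuation_code (snd (prod_decode (code_presentation pW))) N M < K"
      "\<And>y. y < M \<Longrightarrow> dig N (valuation_code (snd (prod_decode (code_presentation pW))) N M) y < N - 1"
      "eval eW (dig N (valuation_code (snd (prod_decode (code_presentation pW))) N M)) = St W"
      using presentsE[OF pres(2)] unfolding M_def by auto
    obtain eF where F: "fst (prod_decode (code_presentation pF)) = code_expr eF" "code_expr eF < M"
      "valuation_code (snd (prod_decode (code_presentation pF))) N M < K"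
      "\<And>y. y < M \<Longrightarrow> dig N (valuation_code (snd (prod_decode (code_presentation pF))) N M) y < N - 1"
      "eval eF (dig N (valuation_code (snd (prod_decode (code_presentation pF))) N M)) = St F"
      using presentsE[OF pres(3)] unfolding M_def by auto
    interpret steiner_codes N M V E W F eG eW eF
      "valuation_code (snd (prod_decode (code_presentation pG))) N M"
      "valuation_code (snd (prod_decode (code_presentation pW))) N M"
      "valuation_code (snd (prod_decode (code_presentation pF))) N M"
      using G W F graph by unfold_locales
    have "decide N M (code_presentation pG) (code_presentation pW) (code_presentation pF) \<longleftrightarrow>
        has_steiner_tree (rcset V) (rcset E) (rcset W) (rcset F)"
      unfolding decide_def Let_def G(1) W(1) F(1) steiner_code_iff g_def w_def f_def ..
    then show ?thesis unfolding f3 M_def[symmetric] N_def[symmetric] by simp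
  qed
  then show ?thesis using f(1) by blast
qed

end
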